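(* Let $I \subseteq \mathbb{R}$ be an interval. Let $I \ni t \mapsto A(t)=(A_{ij}(t))_{1 \le i,j \le n}$ be a generic smooth curve of normal complex matrices acting on the complex vector space $V = \mathbb{C}^n$. Then: (1) For each $t_0 \in I$ there exists a positive integer $N$ such that, for each choice of the sign $\pm$, $t \mapsto A(t_0\pm(t-t_0)^N)$ allows a smooth parameterization of its eigenvalues and eigenvectors near $t_0$. If $A$ is real analytic, then the eigenvalues and eigenvectors of $t \mapsto A(t_0\pm(t-t_0)^N)$ may be parameterized real analytically near $t_0$. (2) There exist locally absolutely continuous parameterizations of the eigenvalues and the eigenvectors of $A$.
   Context: Smooth means $C^\infty$; a matrix is normal if it commutes with its adjoint. A (smooth, real analytic, locally absolutely continuous) parameterization of the eigenvalues and eigenvectors of a curve $t\mapsto B(t)$ of $n\times n$ matrices consists of functions $\lambda_1,\ldots,\lambda_n$ with values in $\mathbb{C}$ and $v_1,\ldots,v_n$ with values in $\mathbb{C}^n$, all of the indicated regularity, such that for each $t$ the vectors $v_1(t),\ldots,v_n(t)$ form a basis of $\mathbb{C}^n$ and $B(t)v_j(t)=\lambda_j(t)v_j(t)$ for all $j$. Locally absolutely continuous means absolutely continuous on a neighborhood of each point. If $t_0$ is an endpoint of $I$, "near $t_0$" refers to those $t$ near $t_0$ for which $t_0 \pm (t-t_0)^N \in I$. Generic: the smooth curve $A$ is called generic if the curve of its characteristic polynomials $t\mapsto \chi_{A(t)}(\lambda)=\det(A(t)-\lambda\mathbb{I})$ (made monic by multiplication with $(-1)^n$) is generic in the following sense.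 For a monic polynomial $P$ of degree $n$ with roots $\lambda_1,\ldots,\lambda_n\in\mathbb{C}$ (with multiplicity) and $1\le k\le n$ put \[ \tilde\Delta_k(P) := \sum_{i_1<\cdots<i_k}\ \prod_{1\le p<q\le k} (\lambda_{i_p}-\lambda_{i_q})^2 , \] a polynomial in the coefficients of $P$ (so $\tilde\Delta_1(P)=n$). For a continuous function $f$ near $t_0$, $m_{t_0}(f)$ is the supremum of all integers $p$ such that $f(t)=(t-t_0)^p g(t)$ near $t_0$ with $g$ continuous; $f$ is infinitely flat at $t_0$ if $m_{t_0}(f)=\infty$. A curve $I\ni t\mapsto P(t)$ of monic polynomials of degree $n$ with smooth coefficients is generic if for every $t_0\in I$: when $k$ is maximal such that the germ at $t_0$ of $t\mapsto \tilde\Delta_k(P(t))$ is not $0$, then $t\mapsto\tilde\Delta_k(P(t))$ is not infinitely flat at $t_0$. (Equivalently: for continuous parameterizations of the roots, if two of the roots meet of infinite order of flatness at $t_0$, i.e. $m_{t_0}(\lambda_i-\lambda_j)=\infty$, then their germs at $t_0$ are equal.) *)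

theory Defs
  imports "HOL-Analysis.Analysis"
    "HOL-Computational_Algebra.Computational_Algebra"
    "HOL-Combinatorics.Combinatorics"
begin

section \<open>Regularity of curves\<close>

text \<open>The regularity notions are applied to intervals \<open>S\<close>, possibly with endpoints (and possibly
  degenerate); derivatives at an endpoint are one-sided. \<open>F k\<close> is the \<open>k\<close>-th derivative of \<open>f\<close>.\<close>

definition smooth_on :: "real set \<Rightarrow> (real \<Rightarrow> 'a::real_normed_vector) \<Rightarrow> bool" where
  "smooth_on S f \<longleftrightarrow>
     (\<exists>F :: nat \<Rightarrow> real \<Rightarrow> 'a. (\<forall>t\<in>S. F 0 t = f t) \<and>
        (\<forall>k. \<forall>t\<in>S. (F k has_vector_derivative F (Suc k) t) (at t within S)))"

definition real_analytic_on :: "real set \<Rightarrow> (real \<Rightarrow> 'a::real_normed_vector) \<Rightarrow> bool" where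
  "real_analytic_on S f \<longleftrightarrow>
     (\<forall>t\<^sub>0\<in>S. \<exists>r>0. \<exists>a :: nat \<Rightarrow> 'a. \<forall>t\<in>S \<inter> ball t\<^sub>0 r. (\<lambda>k. (t - t\<^sub>0) ^ k *\<^sub>R a k) sums f t)"

text \<open>A pair \<open>(a, b) \<in> D\<close> stands for the subinterval with endpoints \<open>a\<close> and \<open>b\<close>.\<close>

definition absolutely_continuous_on :: "real set \<Rightarrow> (real \<Rightarrow> 'a::real_normed_vector) \<Rightarrow> bool" where
  "absolutely_continuous_on S f \<longleftrightarrow>
     (\<forall>\<epsilon>>0. \<exists>\<delta>>0. \<forall>D :: (real \<times> real) set.
        finite D \<longrightarrow> (\<forall>(a, b)\<in>D. a < b \<and> {a..b} \<subseteq> S) \<longrightarrow>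
        pairwise (\<lambda>(a, b) (c, d). disjnt {a<..<b} {c<..<d}) D \<longrightarrow>
        (\<Sum>(a, b)\<in>D. b - a) < \<delta> \<longrightarrow> (\<Sum>(a, b)\<in>D. norm (f b - f a)) < \<epsilon>)"

definition locally_absolutely_continuous_on ::
    "real set \<Rightarrow> (real \<Rightarrow> 'a::real_normed_vector) \<Rightarrow> bool" where
  "locally_absolutely_continuous_on S f \<longleftrightarrow>
     (\<forall>t\<in>S. \<exists>r>0. absolutely_continuous_on (S \<inter> ball t r) f)"


section \<open>Normal matrices and the characteristic polynomial\<close>

definition conj_transpose :: "complex^'n^'m \<Rightarrow> complex^'m^'n" where
  "conj_transpose A = map_matrix cnj (transpose A)"

definition normal_matrix :: "complex^'n^'n \<Rightarrow> bool" where
  "normal_matrix A \<longleftrightarrow> A ** conj_transpose A = conj_transpose A ** A"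

definition monic_charpoly :: "complex^'n^'n \<Rightarrow> complex poly" where
  "monic_charpoly A = smult ((- 1) ^ CARD('n)) (det (map_matrix (\<lambda>a. [:a:]) A - mat [:0, 1:]))"

lemma poly_monic_charpoly:
  fixes A :: "complex^'n^'n"
  shows "poly (monic_charpoly A) x = (- 1) ^ CARD('n) * det (A - mat x)"
proof -
  have "poly ((map_matrix (\<lambda>a. [:a:]) A - mat [:0, 1:]) $ i $ j) x = (A - mat x) $ i $ j" for i j
    by (simp add: mat_def)
  then show ?thesis
    by (simp add: monic_charpoly_def det_def poly_sum poly_prod)
qed


section \<open>Generic curves of polynomials\<close>

definition root_discr_list :: "nat \<Rightarrow> complex list \<Rightarrow> complex" where
  "root_discr_list k xs =
     (\<Sum>S | S \<subseteq> {..<length xs} \<and> card S = k.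
        \<Prod>(p, q) | p \<in> S \<and> q \<in> S \<and> p < q. (xs ! p - xs ! q)\<^sup>2)"

lemma root_discr_list_cong:
  assumes "mset xs = mset ys"
  shows "root_discr_list k xs = root_discr_list k ys"
proof -
  obtain \<pi> where \<pi>: "\<pi> permutes {..<length ys}" and xs: "permute_list \<pi> ys = xs"
    using mset_eq_permutation[OF assms] by blast
  have len: "length xs = length ys"
    using assms by (rule mset_eq_length)
  have inj: "\<pi> a = \<pi> b \<longleftrightarrow> a = b" for a b
    using permutes_inj[OF \<pi>] by (auto dest: injD)
  have inj': "inj_on \<pi> S" for S
    using permutes_inj[OF \<pi>] by (rule inj_on_subset) simp
  define Q where "Q S = {(p, q). p \<in> S \<and> q \<in> S \<and> p < q}" for S :: "nat set"
  have nth: "xs ! p = ys ! \<pi> p" if "p < length ys" for p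
    using permute_list_nth[OF \<pi> that] xs by simp
  have eq: "(\<Prod>(p, q)\<in>Q S. (xs ! p - xs ! q)\<^sup>2) = (\<Prod>(p, q)\<in>Q (\<pi> ` S). (ys ! p - ys ! q)\<^sup>2)"
    if S: "S \<subseteq> {..<length ys}" for S
  proof -
    define \<sigma> where "\<sigma> = inv \<pi>"
    have \<sigma>: "\<sigma> (\<pi> x) = x" "\<pi> (\<sigma> x) = x" for x
      using permutes_inverses[OF \<pi>] by (simp_all add: \<sigma>_def)
    have \<sigma>S: "\<sigma> x \<in> S" if "x \<in> \<pi> ` S" for x
      using that \<sigma> by auto
    show ?thesis
    proof (rule prod.reindex_bij_witness
        [where i = "\<lambda>(p, q). (min (\<sigma> p) (\<sigma> q), max (\<sigma> p) (\<sigma> q))"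
           and j = "\<lambda>(p, q). (min (\<pi> p) (\<pi> q), max (\<pi> p) (\<pi> q))"], goal_cases)
      case (1 a)
      then show ?case by (auto simp: Q_def min_def max_def \<sigma>)
    next
      case (2 a)
      then show ?case by (auto simp: Q_def min_def max_def inj intro!: le_neq_implies_less split: if_splits)
    next
      case (3 a)
      then show ?case by (auto simp: Q_def min_def max_def \<sigma>)
    next
      case (4 a)
      moreover have "\<sigma> x = \<sigma> y \<longleftrightarrow> x = y" for x y
        by (metis \<sigma>(2))
      ultimately show ?case using \<sigma>S
        by (auto simp: Q_def min_def max_def intro!: le_neq_implies_less split: if_splits)
    next
      case (5 a)
      then show ?case using S nth
        by (auto simp: Q_def min_def max_def power2_commute subset_eq)
    qed
  qed
  have "root_discr_list k xs =
      (\<Sum>S | S \<subseteq> {..<length ys} \<and> card S = k. \<Prod>(p, q)\<in>Q (\<pi> ` S). (ys ! p - ys ! q)\<^sup>2)"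
    unfolding root_discr_list_def len using eq by (intro sum.cong) (auto simp: Q_def)
  also have "\<dots> = (\<Sum>S | S \<subseteq> {..<length ys} \<and> card S = k. \<Prod>(p, q)\<in>Q S. (ys ! p - ys ! q)\<^sup>2)"
  proof (rule sum.reindex_bij_witness[where i = "\<lambda>S. inv \<pi> ` S" and j = "\<lambda>S. \<pi> ` S"], goal_cases)
    case (2 S)
    then show ?case
      using permutes_image[OF \<pi>] card_image[OF inj', of S] by auto
  next
    case (4 S)
    then show ?case
      using permutes_image[OF permutes_inv[OF \<pi>]]
        card_image[OF inj_on_subset[OF permutes_inj[OF permutes_inv[OF \<pi>]]], of S] by auto
  qed (simp_all add: image_comp permutes_inv_o[OF \<pi>])
  finally show ?thesis
    by (simp add: root_discr_list_def Q_def)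
qed

text \<open>The value does not depend on the chosen enumeration \<open>xs\<close> of the roots.\<close>

definition Delta_tilde :: "nat \<Rightarrow> complex poly \<Rightarrow> complex" where
  "Delta_tilde k P = root_discr_list k (SOME xs. mset xs = proots P)"

lemma Delta_tilde_eq:
  assumes "mset xs = proots P"
  shows "Delta_tilde k P = root_discr_list k xs"
proof -
  have "mset (SOME xs. mset xs = proots P) = proots P"
    using assms by (rule someI)
  then show ?thesis
    unfolding Delta_tilde_def using assms by (intro root_discr_list_cong) simp
qed

text \<open>Negative exponents can be left out of the supremum, since \<open>p = 0\<close> is always admissible for
  continuous \<open>f\<close>.\<close>

definition vanishing_order :: "real set \<Rightarrow> real \<Rightarrow> (real \<Rightarrow> complex) \<Rightarrow> enat" where
  "vanishing_order I t\<^sub>0 f =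
     Sup {enat p | p. \<exists>\<delta>>0. \<exists>g. continuous_on (I \<inter> ball t\<^sub>0 \<delta>) g \<and>
                      (\<forall>t\<in>I \<inter> ball t\<^sub>0 \<delta>. f t = of_real (t - t\<^sub>0) ^ p * g t)}"

definition infinitely_flat :: "real set \<Rightarrow> real \<Rightarrow> (real \<Rightarrow> complex) \<Rightarrow> bool" where
  "infinitely_flat I t\<^sub>0 f \<longleftrightarrow> vanishing_order I t\<^sub>0 f = \<infinity>"

definition germ_zero :: "real set \<Rightarrow> real \<Rightarrow> (real \<Rightarrow> complex) \<Rightarrow> bool" where
  "germ_zero I t\<^sub>0 f \<longleftrightarrow> (\<exists>\<delta>>0. \<forall>t\<in>I \<inter> ball t\<^sub>0 \<delta>. f t = 0)"

definition generic_poly_curve :: "nat \<Rightarrow> real set \<Rightarrow> (real \<Rightarrow> complex poly) \<Rightarrow> bool" where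
  "generic_poly_curve n I P \<longleftrightarrow>
     (\<forall>t\<^sub>0\<in>I. \<forall>k\<in>{1..n}.
        \<not> germ_zero I t\<^sub>0 (\<lambda>t. Delta_tilde k (P t)) \<longrightarrow>
        (\<forall>j\<in>{k<..n}. germ_zero I t\<^sub>0 (\<lambda>t. Delta_tilde j (P t))) \<longrightarrow>
        \<not> infinitely_flat I t\<^sub>0 (\<lambda>t. Delta_tilde k (P t)))"

definition generic_matrix_curve :: "real set \<Rightarrow> (real \<Rightarrow> complex^'n^'n) \<Rightarrow> bool" where
  "generic_matrix_curve I A \<longleftrightarrow> generic_poly_curve CARD('n) I (\<lambda>t. monic_charpoly (A t))"


section \<open>Parameterizations of eigenvalues and eigenvectors\<close>

text \<open>Bases are meant over the complex numbers: \<open>vec\<close> is the vector space structure given by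
  \<^term>\<open>(*s)\<close>. The same regularity is passed twice, for values in \<^typ>\<open>complex\<close> and in
  \<^typ>\<open>complex^'n\<close>.\<close>

definition has_eigen_parameterization ::
    "(real set \<Rightarrow> (real \<Rightarrow> complex) \<Rightarrow> bool) \<Rightarrow> (real set \<Rightarrow> (real \<Rightarrow> complex^'n) \<Rightarrow> bool) \<Rightarrow>
     real set \<Rightarrow> (real \<Rightarrow> complex^'n^'n) \<Rightarrow> bool" where
  "has_eigen_parameterization reg_val reg_vec S B \<longleftrightarrow>
     (\<exists>(ev :: 'n \<Rightarrow> real \<Rightarrow> complex) (v :: 'n \<Rightarrow> real \<Rightarrow> complex^'n).
        (\<forall>j. reg_val S (ev j) \<and> reg_vec S (v j)) \<and>
        (\<forall>t\<in>S. inj (\<lambda>j. v j t) \<and> vec.independent (range (\<lambda>j. v j t)) \<and>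
               vec.span (range (\<lambda>j. v j t)) = UNIV \<and>
               (\<forall>j. B t *v v j t = ev j t *s v j t)))"

text \<open>The \<open>t\<close> for which the argument of \<open>t \<mapsto> A (t\<^sub>0 + s (t - t\<^sub>0) ^ N)\<close>, where \<open>s = \<plusminus>1\<close>,
  stays in \<open>I\<close>.\<close>

definition power_domain :: "real set \<Rightarrow> real \<Rightarrow> real \<Rightarrow> nat \<Rightarrow> real set" where
  "power_domain I t\<^sub>0 s N = {t. t\<^sub>0 + s * (t - t\<^sub>0) ^ N \<in> I}"

end

theory Submission
  imports Defs "HOL-Complex_Analysis.Complex_Analysis"
begin

text \<open>For a curve of normal matrices the reparameterization is not needed: \<open>N = 1\<close> works. Near
  \<open>t\<^sub>0\<close> one splits the identity into orthogonal projections that commute with \<open>A\<close>. On the range of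
  such a projection \<open>P\<close> subtract the mean eigenvalue \<open>\<mu> = tr (A P) / tr P\<close>. If
  \<open>(A - \<mu>) P = (t - t\<^sub>0)\<^sup>m C\<close> with \<open>C(t\<^sub>0) \<noteq> 0\<close>, then \<open>C\<close> is again a curve of normal matrices, and
  \<open>C(t\<^sub>0)\<close> is nonzero and trace-free, so it has a nonzero eigenvalue which does not exhaust the range
  of \<open>P(t\<^sub>0)\<close>; the spectral projection of \<open>C\<close> around it, a contour integral of the resolvent and
  hence as regular as \<open>A\<close>, splits \<open>P\<close>. The process stops with blocks on which \<open>A - \<mu>\<close> is
  infinitely flat; as soon as there are more distinct eigenvalues than blocks, two of them share a
  block, which would make the leading discriminant infinitely flat. So by genericity \<open>A\<close> is scalar on
  each block, and eigenvectors are obtained by projecting a fixed basis.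

  Eigenvalues of different blocks differ for \<open>t \<noteq> t\<^sub>0\<close>, so two local parameterizations can be matched
  by a constant matrix at any point other than the two base points, which gives a global, locally
  Lipschitz parameterization.\<close>

section \<open>Spectral theory of normal matrices\<close>

subsection \<open>Adjoints and normal matrices\<close>

text \<open>Normality is what makes division by powers of \<open>t - t\<^sub>0\<close> productive.
  It is a closed condition that tolerates scalar factors, so it survives in the quotient for
  \<open>t \<noteq> t\<^sub>0\<close> and reaches \<open>t\<^sub>0\<close> by continuity; and a
  nonzero normal matrix has a nonzero eigenvalue. A general trace-free matrix could be nilpotent at
  \<open>t\<^sub>0\<close>, and this is where fractional powers of \<open>t - t\<^sub>0\<close>
  would come in. Genericity speaks of one discriminant only, the last one whose germ is not zero.
  With \<open>b\<close> blocks, every \<open>Delta_tilde k\<close> with \<open>k > b\<close> is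
  infinitely flat, hence has zero germ, by descent from the dimension. Conversely
  \<open>Delta_tilde d\<close> does not vanish at a matrix with exactly \<open>d\<close> distinct
  eigenvalues, so \<open>d \<le> b\<close> near \<open>t\<^sub>0\<close>. As the blocks have
  pairwise different eigenvalues for \<open>t \<noteq> t\<^sub>0\<close>, each of them has just one.
  The reduction needs only ring operations, division by \<open>t - t\<^sub>0\<close> and resolvent
  integrals. These closure properties form a locale, which is verified for smooth and for real
  analytic germs, so that both regularities share one argument.\<close>

lemma conj_transpose_nth [simp]: "conj_transpose A $ i $ j = cnj (A $ j $ i)"
  by (simp add: conj_transpose_def transpose_def)

lemma conj_transpose_conj_transpose [simp]: "conj_transpose (conj_transpose A) = A"
  by (simp add: vec_eq_iff)

lemma conj_transpose_mult: "conj_transpose (A ** B) = conj_transpose B ** conj_transpose A"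
  by (simp add: vec_eq_iff matrix_matrix_mult_def mult.commute)

lemma conj_transpose_diff: "conj_transpose (A - B) = conj_transpose A - conj_transpose B"
  by (simp add: vec_eq_iff)

lemma conj_transpose_mat: "conj_transpose (mat c) = mat (cnj c)"
  by (simp add: vec_eq_iff mat_def)

lemma inner_complex_Re: "inner (a::complex) b = Re (a * cnj b)"
  by (simp add: inner_complex_def)

text \<open>The real inner product suffices: on complex subspaces it yields the same orthogonality
  relation as the Hermitian one, and the same adjoint.\<close>

lemma inner_matrix_vector: "inner (A *v x) y = inner x (conj_transpose A *v y)"
  for A :: "complex^'n^'m"
proof -
  have "inner (A *v x) y = (\<Sum>i\<in>UNIV. \<Sum>j\<in>UNIV. Re (A $ i $ j * x $ j * cnj (y $ i)))"
    by (simp only: inner_vec_def inner_complex_Re matrix_vector_mult_def vec_lambda_beta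
        sum_distrib_right Re_sum)
  also have "\<dots> = (\<Sum>j\<in>UNIV. \<Sum>i\<in>UNIV. Re (A $ i $ j * x $ j * cnj (y $ i)))"
    by (rule sum.swap)
  also have "\<dots> = inner x (conj_transpose A *v y)"
    by (simp only: inner_vec_def inner_complex_Re matrix_vector_mult_def vec_lambda_beta
        sum_distrib_left Re_sum cnj_sum conj_transpose_nth complex_cnj_mult complex_cnj_cnj)
      (simp only: mult.assoc mult.left_commute)
  finally show ?thesis .
qed

lemma inner_scalar_left: "inner (c *s x) y = inner x (cnj c *s y)" for x :: "complex^'n"
  by (simp add: inner_vec_def inner_complex_Re mult.assoc mult.left_commute del: times_complex.sel)

text \<open>Both squared norms have the form \<open>inner x (M *v x)\<close>, where \<open>M\<close>
  is one of the two products that normality identifies.\<close>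

lemma normal_matrix_norm:
  assumes "normal_matrix A"
  shows "norm (A *v x) = norm (conj_transpose A *v x)"
proof -
  have "inner (A *v x) (A *v x) = inner x (conj_transpose A *v (A *v x))"
    by (rule inner_matrix_vector)
  also have "\<dots> = inner x (A *v (conj_transpose A *v x))"
    using assms by (simp add: normal_matrix_def matrix_vector_mul_assoc)
  also have "\<dots> = inner (conj_transpose A *v x) (conj_transpose A *v x)"
    by (simp add: inner_matrix_vector)
  finally show ?thesis
    by (simp add: norm_eq)
qed

lemma matrix_mult_mat_left: "mat c ** A = (\<chi> i j. c * A $ i $ j)" for A :: "'a::comm_ring_1^'n^'m"
  by (simp add: vec_eq_iff matrix_matrix_mult_def mat_def if_distrib if_distribR cong: if_cong)

lemma matrix_mult_mat_right: "A ** mat c = (\<chi> i j. c * A $ i $ j)" for A :: "'a::comm_ring_1^'n^'m"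
  by (simp add: vec_eq_iff matrix_matrix_mult_def mat_def if_distrib if_distribR mult.commute cong: if_cong)

lemma matrix_mult_mat_commute: "A ** mat c = mat c ** A" for A :: "'a::comm_ring_1^'n^'m"
  by (simp add: matrix_mult_mat_left matrix_mult_mat_right)

lemma mat_vector_mult: "mat c *v x = c *s x" for x :: "'a::comm_ring_1^'n"
  by (simp add: vec_eq_iff matrix_vector_mult_def mat_def if_distrib if_distribR cong: if_cong)

lemma matrix_mult_diff_left: "A ** (B - C) = A ** B - A ** C" for A :: "'a::comm_ring_1^'n^'m"
  by (simp add: vec_eq_iff matrix_matrix_mult_def algebra_simps sum_subtractf)

lemma matrix_mult_diff_right: "(B - C) ** A = B ** A - C ** A" for A :: "'a::comm_ring_1^'n^'m"
  by (simp add: vec_eq_iff matrix_matrix_mult_def algebra_simps sum_subtractf)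

lemma normal_matrix_diff_mat:
  fixes A :: "complex^'n^'n"
  assumes "normal_matrix A"
  shows "normal_matrix (A - mat c)"
proof -
  have "mat (cnj c) ** mat c = (mat c ** mat (cnj c) :: complex^'n^'n)"
    by (rule matrix_mult_mat_commute)
  then show ?thesis
    using assms
    by (simp add: normal_matrix_def conj_transpose_diff conj_transpose_mat matrix_mult_diff_left
        matrix_mult_diff_right matrix_mult_mat_commute[of A] matrix_mult_mat_commute[of "conj_transpose A"])
qed

text \<open>The shifted matrix \<open>A - mat c\<close> is normal too, so it has the same kernel as
  its adjoint.\<close>

lemma normal_matrix_eigenvector_adjoint:
  assumes "normal_matrix A" "A *v x = c *s x"
  shows "conj_transpose A *v x = cnj c *s x"
proof -
  have "norm (conj_transpose (A - mat c) *v x) = norm ((A - mat c) *v x)"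
    using normal_matrix_norm[OF normal_matrix_diff_mat[OF assms(1)]] by simp
  also have "\<dots> = 0"
    using assms(2) by (simp add: matrix_vector_mult_diff_rdistrib mat_vector_mult)
  finally show ?thesis
    by (simp add: conj_transpose_diff conj_transpose_mat matrix_vector_mult_diff_rdistrib mat_vector_mult)
qed

lemma normal_matrix_eigenvectors_orthogonal:
  assumes "normal_matrix A" "A *v x = c *s x" "A *v y = d *s y" "c \<noteq> d"
  shows "inner x y = 0"
proof -
  have *: "inner ((c - d) *s u) y = 0" if "A *v u = c *s u" for u
  proof -
    have "inner (c *s u) y = inner u (conj_transpose A *v y)"
      using that inner_matrix_vector[of A u y] by simp
    also have "\<dots> = inner (d *s u) y"
      using normal_matrix_eigenvector_adjoint[OF assms(1,3)] by (simp add: inner_scalar_left)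
    finally show ?thesis
      by (simp add: vec.scale_left_diff_distrib inner_diff_left)
  qed
  \<comment> \<open>The complex factor \<open>c - d\<close> cannot be pulled out of a real inner
    product; it is cancelled by applying \<open>*\<close> to a rescaled eigenvector.\<close>
  have "inner ((c - d) *s (inverse (c - d) *s x)) y = 0"
    by (rule *) (use assms(2) in \<open>simp add: vector_scalar_commute mult.commute\<close>)
  then show ?thesis
    using assms(4) by simp
qed


subsection \<open>Existence of an eigenbasis\<close>

text \<open>Any \<open>CARD('n) + 1\<close> vectors are linearly dependent, and the coefficients of
  the dependence are stored in a polynomial. Dependence is a property of sets, so a repetition in
  the sequence is treated separately, by a difference of two monomials.\<close>

lemma exists_annihilating_poly:
  fixes w :: "nat \<Rightarrow> complex^'n"
  shows "\<exists>p. p \<noteq> 0 \<and> (\<Sum>i\<le>degree p. coeff p i *s w i) = 0"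
proof -
  have "\<exists>p N. p \<noteq> 0 \<and> degree p \<le> N \<and> (\<Sum>i\<le>N. coeff p i *s w i) = 0"
  proof (cases "inj_on w {..CARD('n)}")
    case True
    have "vec.dependent (w ` {..CARD('n)})"
      by (rule vec.dependent_biggerset_general)
        (use card_image[OF True] dim_subset_UNIV_cart_gen[of "w ` {..CARD('n)}"] in simp)
    then obtain u where u: "\<exists>v\<in>w ` {..CARD('n)}. u v \<noteq> 0" "(\<Sum>v\<in>w ` {..CARD('n)}. u v *s v) = 0"
      by (auto simp: vec.dependent_finite)
    define p where "p = (\<Sum>i\<le>CARD('n). monom (u (w i)) i)"
    have p: "coeff p i = (if i \<le> CARD('n) then u (w i) else 0)" for i
      by (auto simp: p_def coeff_sum)
    have "p \<noteq> 0"
      using u(1) p by (metis atMost_iff coeff_0 imageE)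
    moreover have "degree p \<le> CARD('n)"
      by (rule degree_le) (simp add: p)
    moreover have "(\<Sum>i\<le>CARD('n). coeff p i *s w i) = 0"
      using u(2) by (simp add: sum.reindex[OF True] p)
    ultimately show ?thesis by blast
  next
    case False
    then obtain i j where ij: "w i = w j" "i < j"
      by (auto simp: inj_on_def) (metis linorder_neqE_nat)
    define p where "p = monom (1::complex) j - monom 1 i"
    have p: "coeff p k = (if k = j then 1 else if k = i then - 1 else 0)" for k
      using ij by (auto simp: p_def)
    have "p \<noteq> 0"
      using p[of j] by auto
    moreover have "degree p \<le> j"
      by (rule degree_le) (use ij in \<open>simp add: p\<close>)
    moreover have "(\<Sum>k\<le>j. coeff p k *s w k) = (\<Sum>k\<in>{i,j}. coeff p k *s w k)"
      by (rule sum.mono_neutral_right) (use ij in \<open>auto simp: p\<close>)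
    then have "(\<Sum>k\<le>j. coeff p k *s w k) = 0"
      using ij by (auto simp: p)
    ultimately show ?thesis by blast
  qed
  then obtain p N where p: "p \<noteq> 0" "degree p \<le> N" "(\<Sum>i\<le>N. coeff p i *s w i) = 0"
    by blast
  have "(\<Sum>i\<le>degree p. coeff p i *s w i) = (\<Sum>i\<le>N. coeff p i *s w i)"
    by (rule sum.mono_neutral_left) (use p in \<open>auto simp: coeff_eq_0\<close>)
  with p show ?thesis by auto
qed

text \<open>This is \<open>p(A) x\<close>, evaluated at a vector so that no polynomials of matrices
  are required.\<close>

definition poly_matrix_vec :: "complex^'n^'n \<Rightarrow> complex poly \<Rightarrow> complex^'n \<Rightarrow> complex^'n" where
  "poly_matrix_vec A p x = (\<Sum>i\<le>degree p. coeff p i *s ((*v) A ^^ i) x)"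

lemma poly_matrix_vec_eq:
  assumes "degree p \<le> N"
  shows "poly_matrix_vec A p x = (\<Sum>i\<le>N. coeff p i *s ((*v) A ^^ i) x)"
  unfolding poly_matrix_vec_def
  by (rule sum.mono_neutral_left) (use assms in \<open>auto simp: coeff_eq_0\<close>)

lemma poly_matrix_vec_factor:
  "poly_matrix_vec A ([:- c, 1:] * q) x = A *v poly_matrix_vec A q x - c *s poly_matrix_vec A q x"
proof -
  define N where "N = Suc (degree q)"
  have 1: "degree ([:- c, 1:] * q) \<le> N" "degree q \<le> N" "degree q \<le> degree q"
    using degree_mult_le[of "[:- c, 1:]" q] by (auto simp: N_def)
  have "[:- c, 1:] * q = pCons 0 q - smult c q"
    by simp
  then have c: "coeff ([:- c, 1:] * q) i = coeff (pCons 0 q) i - c * coeff q i" for i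
    by simp
  have "poly_matrix_vec A ([:- c, 1:] * q) x =
      (\<Sum>i\<le>N. coeff (pCons 0 q) i *s ((*v) A ^^ i) x) - (\<Sum>i\<le>N. (c * coeff q i) *s ((*v) A ^^ i) x)"
    by (subst poly_matrix_vec_eq[OF 1(1)], subst c)
      (simp add: vec.scale_left_diff_distrib sum_subtractf)
  also have "(\<Sum>i\<le>N. coeff (pCons 0 q) i *s ((*v) A ^^ i) x) = A *v poly_matrix_vec A q x"
    unfolding N_def
    by (simp only: sum.atMost_Suc_shift)
      (simp add: coeff_pCons poly_matrix_vec_def vec.linear_sum matrix_vector_mult_scaleR
        vec.sum vec.scale)
  also have "(\<Sum>i\<le>N. (c * coeff q i) *s ((*v) A ^^ i) x) = c *s poly_matrix_vec A q x"
    by (simp add: poly_matrix_vec_eq[OF 1(2)] vec.scale_sum_right)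
  finally show ?thesis .
qed

lemma poly_matrix_vec_in_subspace:
  assumes "vec.subspace W" "\<And>x. x \<in> W \<Longrightarrow> A *v x \<in> W" "x \<in> W"
  shows "poly_matrix_vec A p x \<in> W"
proof -
  have "((*v) A ^^ i) x \<in> W" for i
    by (induction i) (use assms in auto)
  then show ?thesis
    unfolding poly_matrix_vec_def by (intro vec.subspace_sum vec.subspace_scale assms)
qed

text \<open>Take \<open>p\<close> of least degree with \<open>p(A) x = 0\<close> and split off a
  linear factor belonging to a root \<open>c\<close>. By minimality the cofactor does not annihilate
  \<open>x\<close>, and its value at \<open>x\<close> is an eigenvector for \<open>c\<close> inside
  \<open>W\<close>.\<close>

lemma exists_eigenvector_in_subspace:
  fixes A :: "complex^'n^'n"
  assumes W: "vec.subspace W" "\<And>x. x \<in> W \<Longrightarrow> A *v x \<in> W" and x: "x \<in> W" "x \<noteq> 0"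
  shows "\<exists>y c. y \<in> W \<and> y \<noteq> 0 \<and> A *v y = c *s y"
proof -
  define d where "d = (LEAST d. \<exists>p. p \<noteq> 0 \<and> degree p = d \<and> poly_matrix_vec A p x = 0)"
  have "\<exists>d p. p \<noteq> 0 \<and> degree p = d \<and> poly_matrix_vec A p x = 0"
    using exists_annihilating_poly[of "\<lambda>i. ((*v) A ^^ i) x"] by (auto simp: poly_matrix_vec_def)
  then have "\<exists>p. p \<noteq> 0 \<and> degree p = d \<and> poly_matrix_vec A p x = 0"
    unfolding d_def by (rule LeastI_ex)
  then obtain p where p: "p \<noteq> 0" "degree p = d" "poly_matrix_vec A p x = 0"
    by blast
  have "degree p \<noteq> 0"
  proof
    assume d0: "degree p = 0"
    then obtain a where "p = [:a:]"
      by (rule degree_eq_zeroE)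
    with p x show False
      by (simp add: poly_matrix_vec_def)
  qed
  then have "\<not> constant (poly p)"
    by (simp add: constant_degree)
  then obtain c where "poly p c = 0"
    using Fundamental_Theorem_Algebra.fundamental_theorem_of_algebra by blast
  then obtain q where q: "p = [:- c, 1:] * q"
    by (metis dvd_def poly_eq_0_iff_dvd)
  with p have "q \<noteq> 0" by auto
  then have "degree q < d"
    using p(2) by (simp add: q degree_mult_eq del: mult_pCons_left)
  then have "poly_matrix_vec A q x \<noteq> 0"
    using not_less_Least[of "degree q" "\<lambda>d. \<exists>p. p \<noteq> 0 \<and> degree p = d \<and> poly_matrix_vec A p x = 0"] \<open>q \<noteq> 0\<close>
    unfolding d_def by blast
  moreover have "A *v poly_matrix_vec A q x = c *s poly_matrix_vec A q x"
    using p(3) unfolding q poly_matrix_vec_factor by simp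
  ultimately show ?thesis
    using poly_matrix_vec_in_subspace[OF W x(1)] by blast
qed

text \<open>The zero vector is included, which makes the set closed under scalar multiples.\<close>

definition eigenvectors :: "complex^'n^'n \<Rightarrow> (complex^'n) set" where
  "eigenvectors A = {x. \<exists>c. A *v x = c *s x}"

lemma scaleR_eq_scalar_mult: "r *\<^sub>R x = complex_of_real r *s x" for x :: "complex^'n"
  by (simp add: vec_eq_iff complex_eq_iff)

lemma real_subspace_of_complex:
  fixes V :: "(complex^'n) set"
  assumes "vec.subspace V"
  shows "subspace V"
proof (rule subspaceI)
  show "r *\<^sub>R x \<in> V" if "x \<in> V" for r x
    unfolding scaleR_eq_scalar_mult by (rule vec.subspace_scale[OF assms that])
qed (use assms in \<open>simp_all add: vec.subspace_0 vec.subspace_add\<close>)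

text \<open>The span \<open>V\<close> is invariant under the adjoint, because eigenvectors of
  \<open>A\<close> are eigenvectors of the adjoint. Hence the orthogonal complement \<open>W\<close>
  is invariant under \<open>A\<close>; if it were nonzero it would contain an eigenvector, which
  lies in \<open>V\<close> as well.\<close>

theorem normal_matrix_span_eigenvectors:
  fixes A :: "complex^'n^'n"
  assumes "normal_matrix A"
  shows "vec.span (eigenvectors A) = UNIV"
proof (rule ccontr)
  define V where "V = vec.span (eigenvectors A)"
  define W where "W = {y. \<forall>x\<in>V. inner x y = 0}"
  assume "vec.span (eigenvectors A) \<noteq> UNIV"
  then obtain z where z: "z \<notin> V"
    by (auto simp: V_def)
  have V: "vec.subspace V"
    by (simp add: V_def)
  have "span V = V"
    using real_subspace_of_complex[OF V] by simp
  from orthogonal_subspace_decomp_exists[of V z]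
  obtain a b where "a \<in> span V" "\<And>w. w \<in> span V \<Longrightarrow> orthogonal b w" "z = a + b"
    by blast
  then have ab: "a \<in> V" "\<And>w. w \<in> V \<Longrightarrow> orthogonal b w" "z = a + b"
    unfolding \<open>span V = V\<close> by auto
  have b: "b \<in> W" "b \<noteq> 0"
    using ab z by (auto simp: W_def orthogonal_def inner_commute)
  \<comment> \<open>Orthogonality is real, so closure of \<open>W\<close> under complex scalars uses
    that \<open>V\<close> is a complex subspace: the scalar moves to \<open>x\<close> as its
    conjugate.\<close>
  have "inner x (c *s y) = 0" if "x \<in> V" "\<forall>x\<in>V. inner x y = 0" for c x y
    using that vec.subspace_scale[OF V, of x "cnj c"] inner_scalar_left[of "cnj c" x y] by auto
  then have W: "vec.subspace W"
    by (auto simp: vec.subspace_def W_def inner_add_right)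
  have adj: "conj_transpose A *v x \<in> V" if "x \<in> V" for x
  proof -
    have "conj_transpose A *v y \<in> V" if y: "y \<in> eigenvectors A" for y
    proof -
      obtain c where "A *v y = c *s y"
        using y by (auto simp: eigenvectors_def)
      then have "conj_transpose A *v y = cnj c *s y"
        by (rule normal_matrix_eigenvector_adjoint[OF assms])
      with y show ?thesis
        by (simp add: V_def vec.span_scale vec.span_base)
    qed
    then have "(*v) (conj_transpose A) ` eigenvectors A \<subseteq> V"
      by auto
    then have "vec.span ((*v) (conj_transpose A) ` eigenvectors A) \<subseteq> V"
      using V by (simp add: vec.span_minimal)
    with that show ?thesis
      by (auto simp: vec.span_image V_def)
  qed
  have "A *v y \<in> W" if "y \<in> W" for y
    using that adj inner_matrix_vector[of "conj_transpose A" _ y] by (simp add: W_def) metis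
  then obtain y c where y: "y \<in> W" "y \<noteq> 0" "A *v y = c *s y"
    using exists_eigenvector_in_subspace[OF W _ b] by blast
  then have "y \<in> V"
    by (auto simp: V_def eigenvectors_def intro!: vec.span_base)
  with y show False
    by (auto simp: W_def)
qed

section \<open>Complex bases and the factorization of the characteristic polynomial\<close>

lemma matrix_eq_on_span:
  fixes M N :: "complex^'n^'m"
  assumes "vec.span S = UNIV" "\<And>x. x \<in> S \<Longrightarrow> M *v x = N *v x"
  shows "M = N"
proof -
  have "vec.span S \<subseteq> {x. (M - N) *v x = 0}"
    using assms(2)
    by (intro vec.span_minimal)
      (auto simp: vec.subspace_def matrix_vector_mult_diff_rdistrib vec.add vec.scale)
  then show ?thesis
    using assms(1) by (auto simp: matrix_eq matrix_vector_mult_diff_rdistrib)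
qed

definition complex_basis :: "('n \<Rightarrow> complex^'n) \<Rightarrow> bool" where
  "complex_basis e \<longleftrightarrow> inj e \<and> vec.independent (range e) \<and> vec.span (range e) = UNIV"

text \<open>This makes being a basis an open condition: along a continuous family of vectors it
  persists near a point, since the determinant is continuous.\<close>

lemma complex_basis_iff_det: "complex_basis e \<longleftrightarrow> det (\<chi> i j. e j $ i) \<noteq> 0"
proof -
  define M where "M = (\<chi> i j. e j $ i)"
  have col: "column j M = e j" for j
    by (simp add: M_def column_def vec_eq_iff)
  then have cols: "columns M = range e"
    by (auto simp: columns_def)
  have span: "vec.span (range e) = UNIV \<longleftrightarrow> det M \<noteq> 0"
    using matrix_right_invertible_span_columns[of M] cols
    by (metis invertible_det_nz invertible_right_inverse)
  have "complex_basis e" if "det M \<noteq> 0"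
  proof -
    have inj: "inj e"
      using det_identical_columns[of _ _ M] col that by (metis injI)
    then have "vec.independent (range e)"
      using that span
      by (intro vec.card_le_dim_spanning[of _ UNIV]) (auto simp: card_image vec_dim_card simp del: vec.dim_UNIV)
    with inj that span show ?thesis
      by (simp add: complex_basis_def)
  qed
  then show ?thesis
    using span by (auto simp: complex_basis_def M_def)
qed

lemma complex_basis_in_spanning_set:
  fixes S :: "(complex^'n) set"
  assumes "vec.span S = UNIV"
  shows "\<exists>e. complex_basis e \<and> range e \<subseteq> S"
proof -
  obtain B where B: "B \<subseteq> S" "vec.independent B" "S \<subseteq> vec.span B"
    using vec.maximal_independent_subset[of S] by blast
  have "vec.span B = UNIV"
    using vec.span_mono[OF B(3)] assms unfolding vec.span_span by blast
  moreover have "finite B"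
    using B(2) by (rule vec.finiteI_independent)
  moreover have "card B = CARD('n)"
    using calculation vec.dim_eq_card[of B UNIV] B(2) by (simp add: vec_dim_card del: vec.dim_UNIV)
  ultimately obtain e where "bij_betw e (UNIV :: 'n set) B"
    by (metis finite_same_card_bij finite_class.finite_UNIV)
  then have "inj e" "range e = B"
    by (auto simp: bij_betw_def)
  then show ?thesis
    using B \<open>vec.span B = UNIV\<close> by (auto simp: complex_basis_def)
qed

lemma complex_basis_nonzero: "complex_basis e \<Longrightarrow> e j \<noteq> 0"
  unfolding complex_basis_def using vec.dependent_zero[of "range e"] by (metis rangeI)

lemma complex_basis_expand:
  assumes "complex_basis e"
  shows "\<exists>c. x = (\<Sum>j\<in>UNIV. c j *s e j)"
proof -
  have "x \<in> vec.span (range e)"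
    using assms by (simp add: complex_basis_def)
  then obtain u where "x = (\<Sum>y\<in>range e. u y *s y)"
    by (subst (asm) vec.span_finite) auto
  also have "\<dots> = (\<Sum>j\<in>UNIV. u (e j) *s e j)"
    using assms by (subst sum.reindex) (auto simp: complex_basis_def)
  finally show ?thesis
    by (intro exI[of _ "\<lambda>j. u (e j)"])
qed

text \<open>With the eigenvectors as columns of \<open>M\<close> and \<open>D\<close> the diagonal
  matrix of the numbers \<open>l j - x\<close>, one has \<open>(A - mat x) ** M = M ** D\<close>;
  the determinant of \<open>M\<close> cancels.\<close>

lemma monic_charpoly_eq_prod:
  fixes A :: "complex^'n^'n"
  assumes e: "complex_basis e" and eig: "\<And>j. A *v e j = l j *s e j"
  shows "monic_charpoly A = (\<Prod>j\<in>UNIV. [:- l j, 1:])"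
proof -
  define M :: "complex^'n^'n" where "M = (\<chi> i j. e j $ i)"
  have M: "det M \<noteq> 0"
    using e by (simp add: complex_basis_iff_det M_def)
  have "poly (monic_charpoly A) x = poly (\<Prod>j\<in>UNIV. [:- l j, 1:]) x" for x
  proof -
    define D :: "complex^'n^'n" where "D = (\<chi> i j. if i = j then l i - x else 0)"
    have "((A - mat x) ** M) $ i $ j = (M ** D) $ i $ j" for i j
    proof -
      have "((A - mat x) ** M) $ i $ j = ((A - mat x) *v e j) $ i"
        by (simp add: matrix_matrix_mult_def matrix_vector_mult_def M_def)
      also have "\<dots> = (l j - x) * e j $ i"
        by (simp add: matrix_vector_mult_diff_rdistrib mat_vector_mult eig algebra_simps)
      also have "\<dots> = (M ** D) $ i $ j"
        by (simp add: matrix_matrix_mult_def M_def D_def if_distrib cong: if_cong)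
      finally show ?thesis .
    qed
    then have "det (A - mat x) * det M = det M * det D"
      by (metis det_mul vec_eq_iff)
    then have "det (A - mat x) = det D"
      using M by simp
    also have "det D = (\<Prod>j\<in>UNIV. l j - x)"
      by (subst det_diagonal) (auto simp: D_def)
    also have "\<dots> = (\<Prod>j\<in>UNIV. (- 1) * (x - l j))"
      by simp
    also have "\<dots> = (- 1) ^ CARD('n) * (\<Prod>j\<in>UNIV. x - l j)"
      by (simp only: prod.distrib prod_constant)
    finally have "det (A - mat x) = (- 1) ^ CARD('n) * (\<Prod>j\<in>UNIV. x - l j)" .
    then show ?thesis
      by (simp only: poly_monic_charpoly poly_prod mult.assoc[symmetric] power_add[symmetric]) simp
  qed
  then show ?thesis
    by (simp add: poly_eq_poly_eq_iff[symmetric] fun_eq_iff)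
qed

lemma proots_monic_charpoly:
  fixes A :: "complex^'n^'n"
  assumes "complex_basis e" "\<And>j. A *v e j = l j *s e j"
  shows "proots (monic_charpoly A) = image_mset l (mset_set UNIV)"
  using monic_charpoly_eq_prod[OF assms] by (simp add: proots_prod sum_unfold_sum_mset)

section \<open>The discriminants of the characteristic polynomial\<close>

abbreviation index_pairs :: "nat set \<Rightarrow> (nat \<times> nat) set" where
  "index_pairs S \<equiv> {(p, q). p \<in> S \<and> q \<in> S \<and> p < q}"

lemma finite_index_pairs: "finite S \<Longrightarrow> finite (index_pairs S)"
  by (rule finite_subset[of _ "S \<times> S"]) auto

text \<open>The left side does not refer to the order of the indices, so it depends only on the
  values that \<open>x\<close> takes when \<open>x\<close> is injective on \<open>S\<close>. This
  allows summands of the discriminant for different index sets to be compared.\<close>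

lemma prod_off_diagonal:
  fixes x :: "nat \<Rightarrow> complex"
  assumes "finite S"
  shows "(\<Prod>(p, q) | p \<in> S \<and> q \<in> S \<and> p \<noteq> q. x p - x q) =
    (- 1) ^ card (index_pairs S) * (\<Prod>(p, q)\<in>index_pairs S. (x p - x q)\<^sup>2)"
proof -
  define T where "T = {(p, q). p \<in> S \<and> q \<in> S \<and> q < p}"
  have U: "{(p, q). p \<in> S \<and> q \<in> S \<and> p \<noteq> q} = index_pairs S \<union> T"
    by (auto simp: T_def)
  have fin: "finite (index_pairs S)" "finite T"
    using assms by (auto simp: finite_index_pairs intro!: finite_subset[of T "S \<times> S"]) (auto simp: T_def)
  have "(\<Prod>(p, q)\<in>T. x p - x q) = (\<Prod>(p, q)\<in>index_pairs S. (- 1) * (x p - x q))"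
    by (rule prod.reindex_bij_witness[of _ prod.swap prod.swap]) (auto simp: T_def)
  also have "\<dots> = (- 1) ^ card (index_pairs S) * (\<Prod>(p, q)\<in>index_pairs S. x p - x q)"
    by (simp only: case_prod_unfold prod.distrib prod_constant)
  finally have "(\<Prod>(p, q)\<in>T. x p - x q) = \<dots>" .
  then show ?thesis
    unfolding U using fin
    by (subst prod.union_disjoint)
      (auto simp: T_def power2_eq_square prod.distrib case_prod_unfold mult_ac)
qed

text \<open>Sums of complex squares may cancel, but not here. An index set that repeats a value
  contributes 0. Every other one of this size picks each distinct value exactly once, so all of them
  contribute the same nonzero number.\<close>

lemma root_discr_list_card_nonzero:
  "root_discr_list (card (set xs)) xs \<noteq> 0"
proof -
  define d where "d = card (set xs)"
  define F where "F S = (\<Prod>(p, q)\<in>index_pairs S. (xs ! p - xs ! q)\<^sup>2)" for S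
  define G where "G = (\<Prod>(a, b) | a \<in> set xs \<and> b \<in> set xs \<and> a \<noteq> b. a - b)"
  define \<S> where "\<S> = {S. S \<subseteq> {..<length xs} \<and> card S = d}"
  define \<T> where "\<T> = {S \<in> \<S>. inj_on ((!) xs) S}"
  have finS: "finite S" if "S \<in> \<S>" for S
    using that finite_subset by (auto simp: \<S>_def)
  have [simp]: "finite \<S>"
    by (rule finite_subset[of _ "Pow {..<length xs}"]) (auto simp: \<S>_def)
  then have finT: "finite \<T>"
    by (simp add: \<T>_def)
  have "F S = 0" if S: "S \<in> \<S> - \<T>" for S
  proof -
    obtain p q where "p \<in> S" "q \<in> S" "xs ! p = xs ! q" "p < q"
      using S by (auto simp: \<T>_def inj_on_def) (metis linorder_neqE_nat)
    then show ?thesis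
      unfolding F_def using finite_index_pairs[OF finS] S
      by (intro prod_zero) auto
  qed
  \<comment> \<open>The sign in \<open>prod_off_diagonal\<close> must not vary with
    \<open>S\<close>: the increasing enumeration of \<open>S\<close> shows that the number of pairs
    depends only on its size.\<close>
  have pairs: "card (index_pairs S) = card (index_pairs {..<d})" if S: "S \<in> \<S>" for S
  proof -
    obtain f where f: "bij_betw f {..<card S} S" "strict_mono_on {..<card S} f"
      using ex_bij_betw_strict_mono_card[OF finS[OF S]] unfolding lessThan_atLeast0 by blast
    have "bij_betw (\<lambda>(p, q). (f p, f q)) (index_pairs {..<d}) (index_pairs S)"
    proof -
      have less: "f p < f q \<longleftrightarrow> p < q" if "p < d" "q < d" for p q
        using f(2) S that by (auto simp: \<S>_def strict_mono_on_less)
      have d: "card S = d" using S by (simp add: \<S>_def)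
      have inj: "f p = f q \<longleftrightarrow> p = q" if "p < d" "q < d" for p q
        using bij_betw_imp_inj_on[OF f(1)] that by (auto simp: d inj_on_eq_iff)
      have mem: "f p \<in> S" if "p < d" for p
        using bij_betw_imp_surj_on[OF f(1)] that d by auto
      show ?thesis
      proof (rule bij_betwI'; clarify)
        fix a b assume "a \<in> S" "b \<in> S" "a < b"
        moreover obtain p q where "p < d" "q < d" "a = f p" "b = f q"
          using bij_betw_imp_surj_on[OF f(1)] d calculation by (metis imageE lessThan_iff)
        ultimately show "\<exists>x\<in>index_pairs {..<d}. (a, b) = (case x of (p, q) \<Rightarrow> (f p, f q))"
          using less by (intro bexI[of _ "(p, q)"]) auto
      qed (use less inj mem in auto)
    qed
    then show ?thesis
      by (rule bij_betw_same_card[symmetric])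
  qed
  have FG: "F S = (- 1) ^ card (index_pairs {..<d}) * G" if S: "S \<in> \<T>" for S
  proof -
    have inj: "inj_on ((!) xs) S" and S': "S \<in> \<S>"
      using S by (auto simp: \<T>_def)
    have im: "(!) xs ` S = set xs"
    proof (rule card_subset_eq)
      show "(!) xs ` S \<subseteq> set xs"
        using S' by (auto simp: \<S>_def)
      show "card ((!) xs ` S) = card (set xs)"
        using S' inj by (simp add: card_image \<S>_def d_def)
    qed simp
    have "G = (\<Prod>(p, q) | p \<in> S \<and> q \<in> S \<and> p \<noteq> q. xs ! p - xs ! q)"
      unfolding G_def
    proof (rule prod.reindex_bij_betw[symmetric, of "\<lambda>(p, q). (xs ! p, xs ! q)", THEN trans])
      show "bij_betw (\<lambda>(p, q). (xs ! p, xs ! q)) {(p, q). p \<in> S \<and> q \<in> S \<and> p \<noteq> q}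
          {(a, b). a \<in> set xs \<and> b \<in> set xs \<and> a \<noteq> b}"
        using inj unfolding bij_betw_def im[symmetric] by (auto simp: inj_on_def image_iff)
    qed (auto simp: case_prod_unfold)
    also have "\<dots> = (- 1) ^ card (index_pairs {..<d}) * F S"
      by (simp add: prod_off_diagonal[OF finS[OF S']] F_def pairs[OF S'])
    finally show ?thesis
      by simp
  qed
  have "G \<noteq> 0"
  proof -
    have "finite {(a, b). a \<in> set xs \<and> b \<in> set xs \<and> a \<noteq> b}"
      by (rule finite_subset[of _ "set xs \<times> set xs"]) auto
    then show ?thesis
      by (auto simp: G_def)
  qed
  have "\<T> \<noteq> {}"
  proof -
    have "\<forall>a\<in>set xs. \<exists>i. i < length xs \<and> xs ! i = a"
      by (auto simp: in_set_conv_nth)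
    from bchoice[OF this] obtain f where f: "\<And>a. a \<in> set xs \<Longrightarrow> f a < length xs \<and> xs ! f a = a"
      by blast
    have "inj_on f (set xs)"
      by (rule inj_on_inverseI[of _ "(!) xs"]) (use f in auto)
    then have "f ` set xs \<in> \<T>"
      using f by (auto simp: \<T>_def \<S>_def card_image d_def inj_on_def)
    then show ?thesis by blast
  qed
  have "root_discr_list d xs = sum F \<S>"
    by (simp add: root_discr_list_def \<S>_def F_def)
  also have "\<dots> = sum F \<T>"
    by (rule sum.mono_neutral_right) (use \<open>\<And>S. S \<in> \<S> - \<T> \<Longrightarrow> F S = 0\<close> in \<open>auto simp: \<T>_def\<close>)
  also have "\<dots> = of_nat (card \<T>) * ((- 1) ^ card (index_pairs {..<d}) * G)"
    by (simp add: FG)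
  finally show ?thesis
    using \<open>G \<noteq> 0\<close> \<open>\<T> \<noteq> {}\<close> finT by (simp add: d_def)
qed

text \<open>The constant is crude: there are at most \<open>2 ^ n\<close> index sets, for
  \<open>n\<close> the length, and in each product one close pair contributes at most
  \<open>e\<^sup>2\<close>. At most \<open>n\<^sup>2\<close> factors remain, each bounded by
  \<open>(2 * K)\<^sup>2\<close>; this base is at least 1, so the exponent may be enlarged to
  \<open>n\<^sup>2\<close>.\<close>

lemma root_discr_list_norm_le:
  assumes K: "K \<ge> 1" "\<And>i. i < length xs \<Longrightarrow> norm (xs ! i) \<le> K"
    and close: "\<And>S. S \<subseteq> {..<length xs} \<Longrightarrow> card S = k \<Longrightarrow>
      \<exists>p\<in>S. \<exists>q\<in>S. p < q \<and> norm (xs ! p - xs ! q) \<le> e"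
  shows "norm (root_discr_list k xs) \<le> 2 ^ length xs * ((2 * K)\<^sup>2) ^ (length xs)\<^sup>2 * e\<^sup>2"
proof -
  define n where "n = length xs"
  define g where "g = (\<lambda>(p, q). (xs ! p - xs ! q)\<^sup>2)"
  define \<S> where "\<S> = {S. S \<subseteq> {..<n} \<and> card S = k}"
  have finS: "finite \<S>"
    by (rule finite_subset[of _ "Pow {..<n}"]) (auto simp: \<S>_def)
  have one: "1 \<le> (2 * K)\<^sup>2"
    using K(1) by (intro one_le_power) simp
  have bound: "norm (prod g (index_pairs S)) \<le> ((2 * K)\<^sup>2) ^ n\<^sup>2 * e\<^sup>2" if S: "S \<in> \<S>" for S
  proof -
    have sub: "S \<subseteq> {..<n}" and "card S = k"
      using S by (auto simp: \<S>_def)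
    then obtain p q where pq: "p \<in> S" "q \<in> S" "p < q" "norm (xs ! p - xs ! q) \<le> e"
      using close by (metis n_def)
    have "finite S"
      using sub finite_subset by blast
    then have fin: "finite (index_pairs S)"
      by (rule finite_index_pairs)
    have "card (index_pairs S - {(p, q)}) \<le> card ({..<n} \<times> {..<n})"
      using sub by (intro card_mono) auto
    then have card: "card (index_pairs S - {(p, q)}) \<le> n\<^sup>2"
      by (simp add: power2_eq_square)
    have 1: "norm (g (p, q)) \<le> e\<^sup>2"
      using power_mono[OF pq(4), of 2] by (simp add: g_def norm_power)
    have "norm (prod g (index_pairs S - {(p, q)})) = (\<Prod>r\<in>index_pairs S - {(p, q)}. norm (g r))"
      by (simp add: prod_norm)
    also have "\<dots> \<le> (\<Prod>r\<in>index_pairs S - {(p, q)}. (2 * K)\<^sup>2)"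
    proof (rule prod_mono)
      fix c assume "c \<in> index_pairs S - {(p, q)}"
      then obtain a b where ab: "c = (a, b)" "a \<in> S" "b \<in> S"
        by blast
      have "norm (xs ! a) \<le> K" "norm (xs ! b) \<le> K"
        using sub K(2) ab by (auto simp: n_def)
      then have "norm (xs ! a - xs ! b) \<le> 2 * K"
        using norm_triangle_ineq4[of "xs ! a" "xs ! b"] by linarith
      then show "0 \<le> norm (g c) \<and> norm (g c) \<le> (2 * K)\<^sup>2"
        using power_mono[of "norm (xs ! a - xs ! b)" "2 * K" 2] by (simp add: ab g_def norm_power)
    qed
    also have "\<dots> \<le> ((2 * K)\<^sup>2) ^ n\<^sup>2"
      using power_increasing[OF card one] by simp
    finally have 2: "norm (prod g (index_pairs S - {(p, q)})) \<le> ((2 * K)\<^sup>2) ^ n\<^sup>2" .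
    have "norm (prod g (index_pairs S)) = norm (prod g (index_pairs S - {(p, q)})) * norm (g (p, q))"
      using pq fin by (subst prod.remove[of _ "(p, q)"]) (auto simp: norm_mult)
    also have "\<dots> \<le> ((2 * K)\<^sup>2) ^ n\<^sup>2 * e\<^sup>2"
      by (intro mult_mono 1 2) auto
    finally show ?thesis .
  qed
  have "norm (root_discr_list k xs) = norm (\<Sum>S\<in>\<S>. prod g (index_pairs S))"
    by (simp add: root_discr_list_def \<S>_def g_def n_def)
  also have "\<dots> \<le> (\<Sum>S\<in>\<S>. ((2 * K)\<^sup>2) ^ n\<^sup>2 * e\<^sup>2)"
    by (rule sum_norm_le) (rule bound)
  also have "\<dots> = card \<S> * (((2 * K)\<^sup>2) ^ n\<^sup>2 * e\<^sup>2)"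
    by simp
  also have "\<dots> \<le> 2 ^ n * (((2 * K)\<^sup>2) ^ n\<^sup>2 * e\<^sup>2)"
  proof (rule mult_right_mono)
    have "card \<S> \<le> card (Pow {..<n})"
      by (rule card_mono) (auto simp: \<S>_def)
    then have "card \<S> \<le> 2 ^ n"
      by (simp add: card_Pow)
    then show "real (card \<S>) \<le> 2 ^ n"
      by (metis of_nat_le_iff of_nat_numeral of_nat_power)
  qed simp
  finally show ?thesis
    by (simp add: n_def mult.assoc)
qed

text \<open>Three properties matter below: it bounds the operator norm and hence the eigenvalues, it
  is visibly continuous in the entries, and it is homogeneous under scalar factors.\<close>

definition entry_norm :: "complex^'n^'m \<Rightarrow> real" where
  "entry_norm A = (\<Sum>i\<in>UNIV. \<Sum>j\<in>UNIV. norm (A $ i $ j))"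

lemma entry_norm_nonneg: "0 \<le> entry_norm A"
  by (simp add: entry_norm_def sum_nonneg)

lemma norm_le_entry_norm: "norm (A *v x) \<le> entry_norm A * norm x"
proof -
  have "norm (A *v x) \<le> (\<Sum>i\<in>UNIV. norm ((A *v x) $ i))"
    by (simp add: norm_vec_def L2_set_le_sum)
  also have "\<dots> \<le> (\<Sum>i\<in>UNIV. \<Sum>j\<in>UNIV. norm (A $ i $ j) * norm x)"
    by (intro sum_mono)
      (auto simp: matrix_vector_mult_def norm_mult Finite_Cartesian_Product.norm_nth_le
        intro!: sum_norm_le mult_left_mono)
  finally show ?thesis
    by (simp add: entry_norm_def sum_distrib_right)
qed

lemma eigenvalue_norm_le_entry_norm:
  assumes "A *v x = c *s x" "x \<noteq> 0"
  shows "norm c \<le> entry_norm A"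
proof -
  have "norm c * norm x = norm (c *s x)"
    by (simp add: norm_vec_def norm_mult L2_set_right_distrib)
  also have "\<dots> \<le> entry_norm A * norm x"
    using norm_le_entry_norm[of A x] assms(1) by simp
  finally show ?thesis
    using assms(2) by simp
qed

lemma normal_matrix_exists_eigenbasis:
  assumes "normal_matrix A"
  shows "\<exists>e l. complex_basis e \<and> (\<forall>j. A *v e j = l j *s e j)"
proof -
  obtain e where e: "complex_basis e" "range e \<subseteq> eigenvectors A"
    using complex_basis_in_spanning_set[OF normal_matrix_span_eigenvectors[OF assms]] by blast
  then have "\<forall>j. \<exists>c. A *v e j = c *s e j"
    by (auto simp: eigenvectors_def)
  with e show ?thesis
    by metis
qed

lemma Delta_tilde_monic_charpoly:
  fixes A :: "complex^'n^'n"
  assumes "complex_basis e" "\<And>j. A *v e j = l j *s e j" and js: "distinct js" "set js = (UNIV :: 'n set)"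
  shows "Delta_tilde k (monic_charpoly A) = root_discr_list k (map l js)"
proof (rule Delta_tilde_eq)
  have "mset_set (UNIV :: 'n set) = mset js"
    using js by (metis mset_set_set)
  then show "mset (map l js) = proots (monic_charpoly A)"
    using proots_monic_charpoly[OF assms(1,2)] by simp
qed

lemma tendsto_det [tendsto_intros]:
  fixes M :: "'a \<Rightarrow> complex^'n^'n"
  assumes "\<And>i j. ((\<lambda>x. M x $ i $ j) \<longlongrightarrow> L $ i $ j) F"
  shows "((\<lambda>x. det (M x)) \<longlongrightarrow> det L) F"
  unfolding det_def by (intro tendsto_intros assms)

lemma seq_not_tendsto_subseq:
  fixes X :: "nat \<Rightarrow> 'a::metric_space"
  assumes "\<not> X \<longlonglongrightarrow> L"
  shows "\<exists>e>0. \<exists>r :: nat \<Rightarrow> nat. strict_mono r \<and> (\<forall>n. dist (X (r n)) L \<ge> e)"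
proof -
  obtain e where e: "e > 0" "\<not> (\<forall>\<^sub>F n in sequentially. dist (X n) L < e)"
    using assms by (auto simp: tendsto_iff)
  then have "infinite {n. dist (X n) L \<ge> e}"
    unfolding eventually_cofinite[symmetric] cofinite_eq_sequentially[symmetric]
    by (simp add: eventually_cofinite not_less)
  from infinite_enumerate[OF this] obtain r :: "nat \<Rightarrow> nat"
    where r: "strict_mono r" "\<forall>n. r n \<in> {n. dist (X n) L \<ge> e}"
    by auto
  then have "\<forall>n. dist (X (r n)) L \<ge> e"
    by simp
  with e(1) r(1) show ?thesis
    by (intro exI[of _ e] exI[of _ r] conjI)
qed

text \<open>The roots have limit points along any sequence, by compactness, and any such limit point
  consists of the roots of the limiting polynomial.\<close>

lemma continuous_on_Delta_tilde:
  fixes A :: "real \<Rightarrow> complex^'n^'n"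
  assumes cont: "continuous_on S A" and normal: "\<And>t. t \<in> S \<Longrightarrow> normal_matrix (A t)"
  shows "continuous_on S (\<lambda>t. Delta_tilde k (monic_charpoly (A t)))"
proof (rule ccontr)
  define f where "f t = Delta_tilde k (monic_charpoly (A t))" for t
  assume "\<not> continuous_on S (\<lambda>t. Delta_tilde k (monic_charpoly (A t)))"
  then obtain u :: "nat \<Rightarrow> real" and x where u: "\<And>i. u i \<in> S" "x \<in> S" "u \<longlonglongrightarrow> x" "\<not> (\<lambda>i. f (u i)) \<longlonglongrightarrow> f x"
    by (auto simp: continuous_on_sequentially f_def comp_def)
  then obtain d and r :: "nat \<Rightarrow> nat" where r: "d > 0" "strict_mono r" "\<And>i. dist (f (u (r i))) (f x) \<ge> d"
    using seq_not_tendsto_subseq by metis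
  define w where "w = (\<lambda>i. u (r i))"
  have w: "\<And>i. w i \<in> S" "w \<longlonglongrightarrow> x"
    using u LIMSEQ_subseq_LIMSEQ[OF u(3) r(2)] by (auto simp: w_def comp_def)
  have Aw: "(\<lambda>i. A (w i)) \<longlonglongrightarrow> A x"
    using continuous_on_tendsto_compose[OF cont w(2) u(2)] w(1) by simp
  have "\<forall>i. \<exists>e l. complex_basis e \<and> (\<forall>j. A (w i) *v e j = l j *s e j)"
    using normal_matrix_exists_eigenbasis normal w(1) by blast
  then obtain e l where el: "\<And>i. complex_basis (e i)" "\<And>i j. A (w i) *v e i j = l i j *s e i j"
    by metis
  \<comment> \<open>The eigenvalues are listed in an arbitrary order for each index of the sequence.
    Collected in one vector, they have a common convergent subsequence.\<close>
  define m :: "nat \<Rightarrow> complex^'n" where "m i = (\<chi> j. l i j)" for i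
  have "(\<lambda>i. entry_norm (A (w i))) \<longlonglongrightarrow> entry_norm (A x)"
    unfolding entry_norm_def by (intro tendsto_intros Aw)
  then have "Bseq (\<lambda>i. entry_norm (A (w i)))"
    by (rule convergent_imp_Bseq[OF convergentI])
  then obtain C where C: "\<And>i. entry_norm (A (w i)) \<le> C"
    by (auto simp: Bseq_def abs_le_iff)
  have "norm (m i) \<le> CARD('n) * C" for i
  proof -
    have "norm (m i) \<le> (\<Sum>j\<in>UNIV. norm (m i $ j))"
      by (simp add: norm_vec_def L2_set_le_sum)
    also have "\<dots> \<le> (\<Sum>j\<in>(UNIV :: 'n set). C)"
      using eigenvalue_norm_le_entry_norm[OF el(2) complex_basis_nonzero[OF el(1)]] C
      by (intro sum_mono) (auto simp: m_def intro: order_trans)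
    finally show ?thesis by simp
  qed
  then have "bounded (range m)"
    by (auto simp: bounded_iff)
  then obtain L s where s: "strict_mono s" "(m \<circ> s) \<longlonglongrightarrow> L"
    using bounded_imp_convergent_subsequence by blast
  have mL: "(\<lambda>i. l (s i) j) \<longlonglongrightarrow> L $ j" for j
    using tendsto_vec_nth[OF s(2), of j] by (simp add: m_def comp_def)
  have As: "(\<lambda>i. A (w (s i))) \<longlonglongrightarrow> A x"
    using LIMSEQ_subseq_LIMSEQ[OF Aw s(1)] by (simp add: comp_def)
  obtain js :: "'n list" where js: "distinct js" "set js = UNIV"
    using finite_distinct_list[of "UNIV :: 'n set"] by auto
  have pr: "poly (monic_charpoly B) z = (\<Prod>j\<in>UNIV. z - a j)"
    if "complex_basis b" "\<And>j. B *v b j = a j *s b j" for B :: "complex^'n^'n" and b a z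
    using monic_charpoly_eq_prod[OF that] by (simp add: poly_prod)
  \<comment> \<open>The same sequence has two limits: as a determinant it converges with the
    matrices, as a product of linear factors it converges with the roots.\<close>
  have "poly (monic_charpoly (A x)) z = (\<Prod>j\<in>UNIV. z - L $ j)" for z
  proof (rule LIMSEQ_unique)
    show "(\<lambda>i. poly (monic_charpoly (A (w (s i)))) z) \<longlonglongrightarrow> poly (monic_charpoly (A x)) z"
      unfolding poly_monic_charpoly
    proof (intro tendsto_mult tendsto_const tendsto_det)
      show "(\<lambda>k. (A (w (s k)) - mat z) $ i $ j) \<longlonglongrightarrow> (A x - mat z) $ i $ j" for i j
        using tendsto_vec_nth[OF tendsto_vec_nth[OF As]] by (simp add: tendsto_diff)
    qed
    show "(\<lambda>i. poly (monic_charpoly (A (w (s i)))) z) \<longlonglongrightarrow> (\<Prod>j\<in>UNIV. z - L $ j)"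
      unfolding pr[OF el] by (intro tendsto_intros mL)
  qed
  then have "monic_charpoly (A x) = (\<Prod>j\<in>UNIV. [:- (L $ j), 1:])"
    by (simp add: poly_eq_poly_eq_iff[symmetric] fun_eq_iff poly_prod)
  then have "proots (monic_charpoly (A x)) = image_mset (($) L) (mset_set UNIV)"
    by (simp add: proots_prod sum_unfold_sum_mset)
  also have "\<dots> = mset (map (($) L) js)"
    using js by (metis mset_set_set mset_map)
  finally have fx: "f x = root_discr_list k (map (($) L) js)"
    unfolding f_def by (intro Delta_tilde_eq) simp
  have "(\<lambda>i. root_discr_list k (map (l (s i)) js)) \<longlonglongrightarrow> root_discr_list k (map (($) L) js)"
  proof -
    have *: "(\<lambda>i. map (l (s i)) js ! p) \<longlonglongrightarrow> map (($) L) js ! p" if "p < length js" for p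
      using that mL by simp
    show ?thesis
      unfolding root_discr_list_def length_map case_prod_unfold
      by (intro tendsto_intros *) auto
  qed
  then have "(\<lambda>i. f (w (s i))) \<longlonglongrightarrow> f x"
    by (simp add: f_def Delta_tilde_monic_charpoly[OF el js] fx[unfolded f_def])
  then have "\<forall>\<^sub>F i in sequentially. dist (f (w (s i))) (f x) < d"
    using r(1) by (simp add: tendsto_iff)
  then obtain i where "dist (f (w (s i))) (f x) < d"
    using eventually_happens'[OF sequentially_bot] by blast
  then show False
    using r(3)[of "s i"] by (simp add: w_def)
qed

section \<open>Spectral projections\<close>

lemma det_mat_diff: "det (mat z - B) = poly (monic_charpoly B) z" for B :: "complex^'n^'n"
proof -
  have "mat z - B = mat (- 1) ** (B - mat z)"
    by (simp add: vec_eq_iff matrix_mult_mat_left)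
  then have "det (mat z - B) = det (mat (- 1) :: complex^'n^'n) * det (B - mat z)"
    by (simp add: det_mul)
  also have "det (mat (- 1) :: complex^'n^'n) = (- 1) ^ CARD('n)"
    by (subst det_diagonal) (auto simp: mat_def)
  finally show ?thesis
    by (simp add: poly_monic_charpoly)
qed

lemma eigenvalue_det_zero:
  fixes B :: "complex^'n^'n"
  assumes "B *v x = c *s x" "x \<noteq> 0"
  shows "det (mat c - B) = 0"
proof (rule ccontr)
  assume "det (mat c - B) \<noteq> 0"
  then have "invertible (mat c - B)"
    by (simp add: invertible_det_nz)
  then obtain C where "C ** (mat c - B) = mat 1"
    by (auto simp: invertible_def)
  then have "C *v ((mat c - B) *v x) = x"
    by (simp add: matrix_vector_mul_assoc)
  with assms show False
    by (simp add: matrix_vector_mult_diff_rdistrib mat_vector_mult)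
qed

text \<open>The matrix entries of \<open>(z - B)\<^sup>-\<^sup>1\<close>, by Cramer's rule.\<close>

definition resolvent_entry :: "complex^'n^'n \<Rightarrow> 'n \<Rightarrow> 'n \<Rightarrow> complex \<Rightarrow> complex" where
  "resolvent_entry B i j z =
     det (\<chi> k l. if l = i then axis j 1 $ k else (mat z - B) $ k $ l) / det (mat z - B)"

lemma resolvent_left_inverse:
  assumes "det (mat z - B) \<noteq> 0"
  shows "(\<chi> i j. resolvent_entry B i j z) ** (mat z - B) = mat 1"
proof -
  define X where "X = (\<chi> i j. resolvent_entry B i j z)"
  have "(mat z - B) *v column j X = axis j 1" for j
    by (subst cramer[OF assms])
      (simp add: X_def column_def resolvent_entry_def vec_eq_iff)
  moreover have "((mat z - B) ** X) $ i $ j = ((mat z - B) *v column j X) $ i" for i j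
    by (simp add: matrix_matrix_mult_def matrix_vector_mult_def column_def)
  ultimately have "((mat z - B) ** X) $ i $ j = mat 1 $ i $ j" for i j
    by (simp add: axis_def mat_def)
  then have "(mat z - B) ** X = mat 1"
    by (simp add: vec_eq_iff)
  then show ?thesis
    unfolding X_def by (simp add: matrix_left_right_inverse)
qed

text \<open>On an eigenvector the resolvent is a scalar, which reduces the matrix-valued contour
  integral to a scalar Cauchy integral.\<close>

lemma resolvent_eigenvector:
  assumes "det (mat z - B) \<noteq> 0" "B *v x = c *s x"
  shows "(\<Sum>j\<in>UNIV. resolvent_entry B i j z * x $ j) = x $ i / (z - c)"
proof (cases "x = 0")
  case False
  define X where "X = (\<chi> i j. resolvent_entry B i j z)"
  have "z \<noteq> c"
    using eigenvalue_det_zero[OF assms(2) False] assms(1) by auto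
  have "x = X *v ((mat z - B) *v x)"
    using resolvent_left_inverse[OF assms(1)] by (simp add: X_def matrix_vector_mul_assoc)
  also have "(mat z - B) *v x = (z - c) *s x"
    by (simp add: matrix_vector_mult_diff_rdistrib mat_vector_mult assms(2) vec.scale_left_diff_distrib)
  also have "X *v ((z - c) *s x) = (z - c) *s (X *v x)"
    by (rule vec.scale)
  finally have "x $ i = (z - c) * (X *v x) $ i"
    by (metis vector_smult_component)
  then show ?thesis
    using \<open>z \<noteq> c\<close> by (simp add: matrix_vector_mult_def X_def field_simps)
qed simp

text \<open>The Riesz projection for the disc with center \<open>w\<close> and radius
  \<open>r\<close>, integrated entry by entry.\<close>

definition spectral_projection :: "complex^'n^'n \<Rightarrow> complex \<Rightarrow> real \<Rightarrow> complex^'n^'n" where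
  "spectral_projection B w r =
     (\<chi> i j. contour_integral (circlepath w r) (resolvent_entry B i j) / (2 * of_real pi * \<i>))"

lemma continuous_on_det [continuous_intros]:
  fixes M :: "'a::topological_space \<Rightarrow> complex^'n^'n"
  assumes "\<And>i j. continuous_on S (\<lambda>x. M x $ i $ j)"
  shows "continuous_on S (\<lambda>x. det (M x))"
  unfolding det_def by (intro continuous_intros assms)

lemma continuous_on_mat_nth [continuous_intros]:
  assumes "continuous_on S f"
  shows "continuous_on S (\<lambda>x. mat (f x :: complex) $ i $ j)"
  using assms by (cases "i = j") (auto simp: mat_def)

lemma continuous_on_resolvent_entry:
  assumes "\<And>z. z \<in> S \<Longrightarrow> det (mat z - B) \<noteq> 0"
  shows "continuous_on S (resolvent_entry B i j)"
proof -
  have "continuous_on S (\<lambda>z. (mat z - B) $ k $ l)" for k l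
    by (simp, intro continuous_intros)
  then have "continuous_on S (\<lambda>z. if l = i then axis j 1 $ k else (mat z - B) $ k $ l)" for k l
    by (cases "l = i") auto
  then show ?thesis
    unfolding resolvent_entry_def using assms
    by (intro continuous_on_divide continuous_on_det) (auto intro!: continuous_intros)
qed

lemma contour_integral_circlepath_inverse:
  assumes "0 < r" "c \<notin> sphere w r"
  shows "((\<lambda>z. a / (z - c)) has_contour_integral (if dist w c < r then 2 * of_real pi * \<i> * a else 0)) (circlepath w r)"
proof -
  have c: "c \<notin> path_image (circlepath w r)"
    using assms by simp
  have "((\<lambda>z. 1 / (z - c)) has_contour_integral of_real (2 * pi) * \<i> * winding_number (circlepath w r) c) (circlepath w r)"
    by (rule has_contour_integral_winding_number) (use c in auto)
  then have "((\<lambda>z. a * (1 / (z - c))) has_contour_integral a * (of_real (2 * pi) * \<i> * winding_number (circlepath w r) c)) (circlepath w r)"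
    by (rule has_contour_integral_lmul)
  moreover have "winding_number (circlepath w r) c = (if dist w c < r then 1 else 0)"
  proof (cases "dist w c < r")
    case True
    then show ?thesis
      by (simp add: winding_number_circlepath dist_norm norm_minus_commute)
  next
    case False
    then have "c \<notin> cball w r"
      using assms(2) by auto
    then have "winding_number (circlepath w r) c = 0"
      using assms(1) by (intro winding_number_zero_outside[of _ "cball w r"]) auto
    with False show ?thesis by simp
  qed
  ultimately show ?thesis
    by (auto simp: mult_ac)
qed

text \<open>For normal \<open>B\<close> the eigenvectors span, so this formula determines the
  projection; all its algebraic properties are tested on eigenvectors.\<close>

lemma spectral_projection_eigenvector:
  assumes r: "0 < r" and det: "\<And>z. z \<in> sphere w r \<Longrightarrow> det (mat z - B) \<noteq> 0"
    and x: "B *v x = c *s x"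
  shows "spectral_projection B w r *v x = (if dist w c < r then x else 0)"
proof (cases "x = 0")
  case False
  have c: "c \<notin> sphere w r"
    using eigenvalue_det_zero[OF x False] det by blast
  have int: "resolvent_entry B i j contour_integrable_on circlepath w r" for i j
    using r det by (intro contour_integrable_continuous_circlepath continuous_on_resolvent_entry) auto
  have "(spectral_projection B w r *v x) $ i = (if dist w c < r then x $ i else 0)" for i
  proof -
    have "(\<Sum>j\<in>UNIV. contour_integral (circlepath w r) (resolvent_entry B i j) * x $ j) =
        contour_integral (circlepath w r) (\<lambda>z. \<Sum>j\<in>UNIV. resolvent_entry B i j z * x $ j)"
      by (subst contour_integral_sum) (auto intro!: contour_integrable_rmul int simp: contour_integral_rmul int)
    also have "\<dots> = contour_integral (circlepath w r) (\<lambda>z. x $ i / (z - c))"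
      using det r x by (intro contour_integral_cong) (auto simp: resolvent_eigenvector)
    also have "\<dots> = (if dist w c < r then 2 * of_real pi * \<i> * x $ i else 0)"
      by (rule contour_integral_unique) (rule contour_integral_circlepath_inverse[OF r c])
    finally show ?thesis
      by (auto simp: spectral_projection_def matrix_vector_mult_def sum_divide_distrib[symmetric])
  qed
  then show ?thesis
    by (auto simp: vec_eq_iff)
qed simp

lemma inner_zero_on_span:
  fixes u :: "complex^'n"
  assumes "vec.span (eigenvectors B) = UNIV" "\<And>x. x \<in> eigenvectors B \<Longrightarrow> inner x u = 0"
  shows "u = 0"
proof -
  \<comment> \<open>The quantifier over \<open>c\<close> turns the real orthogonality condition into
    a complex subspace.\<close>
  have "vec.span (eigenvectors B) \<subseteq> {x. \<forall>c. inner (c *s x) u = 0}"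
  proof (rule vec.span_minimal)
    show "eigenvectors B \<subseteq> {x. \<forall>c. inner (c *s x) u = 0}"
    proof (clarify, rule assms(2))
      fix x c assume "x \<in> eigenvectors B"
      then show "c *s x \<in> eigenvectors B"
        by (auto simp: eigenvectors_def vec.scale mult.commute)
    qed
    show "vec.subspace {x. \<forall>c. inner (c *s x) u = 0}"
      by (auto simp: vec.subspace_def vec.scale_right_distrib inner_add_left)
  qed
  then have "inner (1 *s u) u = 0"
    using assms(1) by blast
  then show ?thesis
    by simp
qed

locale normal_spectral_projection =
  fixes B :: "complex^'n^'n" and w :: complex and r :: real
  assumes normal: "normal_matrix B" and r: "0 < r"
    and det: "\<And>z. z \<in> sphere w r \<Longrightarrow> det (mat z - B) \<noteq> 0"
begin

abbreviation "S \<equiv> spectral_projection B w r"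

lemma eig: "B *v x = c *s x \<Longrightarrow> S *v x = (if dist w c < r then x else 0)"
  using spectral_projection_eigenvector[OF r] det by blast

lemmas span_eig = normal_matrix_span_eigenvectors[OF normal]

lemma idem: "S ** S = S"
proof (rule matrix_eq_on_span[OF span_eig])
  fix x assume "x \<in> eigenvectors B"
  then obtain c where "B *v x = c *s x"
    by (auto simp: eigenvectors_def)
  then show "(S ** S) *v x = S *v x"
    using eig[of x c] by (simp add: matrix_vector_mul_assoc[symmetric])
qed

text \<open>Tested on pairs of eigenvectors: for equal eigenvalues \<open>S\<close> acts on both by
  the same real scalar, 0 or 1, and for different eigenvalues the two vectors are
  orthogonal.\<close>

lemma self_adjoint: "conj_transpose S = S"
proof (rule matrix_eq_on_span[OF span_eig])
  fix y assume "y \<in> eigenvectors B"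
  then obtain d where y: "B *v y = d *s y"
    by (auto simp: eigenvectors_def)
  have "conj_transpose S *v y - S *v y = 0"
  proof (rule inner_zero_on_span[OF span_eig])
    fix x assume "x \<in> eigenvectors B"
    then obtain c where x: "B *v x = c *s x"
      by (auto simp: eigenvectors_def)
    have "inner (S *v x) y = inner x (S *v y)"
    proof (cases "c = d")
      case True
      then show ?thesis by (simp add: eig[OF x] eig[OF y])
    next
      case False
      then show ?thesis
        using normal_matrix_eigenvectors_orthogonal[OF normal x y]
        by (simp add: eig[OF x] eig[OF y])
    qed
    then show "inner x (conj_transpose S *v y - S *v y) = 0"
      by (simp add: inner_diff_right inner_matrix_vector)
  qed
  then show "conj_transpose S *v y = S *v y"
    by simp
qed

text \<open>A matrix that commutes with \<open>B\<close> preserves each eigenspace of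
  \<open>B\<close>, and on each of them \<open>S\<close> is 0 or the identity.\<close>

lemma commute:
  assumes "A ** B = B ** A"
  shows "A ** S = S ** A"
proof (rule matrix_eq_on_span[OF span_eig])
  fix x assume "x \<in> eigenvectors B"
  then obtain c where x: "B *v x = c *s x"
    by (auto simp: eigenvectors_def)
  have "B *v (A *v x) = A *v (B *v x)"
    by (simp add: matrix_vector_mul_assoc assms)
  also have "\<dots> = c *s (A *v x)"
    by (simp add: x vec.scale)
  finally have "B *v (A *v x) = c *s (A *v x)" .
  then show "(A ** S) *v x = (S ** A) *v x"
    using eig[OF x] eig[of "A *v x" c] by (simp add: matrix_vector_mul_assoc[symmetric])
qed

text \<open>The eigenvectors kept by \<open>S\<close> belong to nonzero eigenvalues, because the
  disc avoids 0. They lie in the range of \<open>B\<close>, hence are fixed by \<open>P\<close>. The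
  other eigenvectors stay in their eigenspace under \<open>P\<close>, and \<open>S\<close> kills
  that eigenspace.\<close>

lemma absorb:
  assumes "P ** B = B" "B ** P = B" "0 \<notin> ball w r"
  shows "S ** P = S"
proof (rule matrix_eq_on_span[OF span_eig])
  fix x assume "x \<in> eigenvectors B"
  then obtain c where x: "B *v x = c *s x"
    by (auto simp: eigenvectors_def)
  have "B *v (P *v x) = P *v (B *v x)"
    by (simp add: matrix_vector_mul_assoc assms)
  then have Px: "B *v (P *v x) = c *s (P *v x)"
    by (simp add: x vec.scale)
  show "(S ** P) *v x = S *v x"
  proof (cases "dist w c < r")
    case True
    then have "c \<noteq> 0"
      using assms(3) by auto
    have "c *s (P *v x) = P *v (B *v x)"
      by (simp add: x vec.scale)
    also have "\<dots> = c *s x"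
      unfolding matrix_vector_mul_assoc assms(1) by (rule x)
    finally have "P *v x = x"
      using \<open>c \<noteq> 0\<close> by simp
    then show ?thesis
      by (simp add: matrix_vector_mul_assoc[symmetric])
  next
    case False
    then show ?thesis
      using eig[OF x] eig[OF Px] by (simp add: matrix_vector_mul_assoc[symmetric])
  qed
qed

end

text \<open>By compactness the determinant is bounded away from 0 on \<open>K\<close> for the limit
  matrix. Joint continuity then yields a neighborhood of \<open>L\<close>, uniform in
  \<open>z\<close>, on which it changes by at most half of that bound.\<close>

lemma eventually_det_nonzero:
  fixes L :: "complex^'n^'n"
  assumes M: "(M \<longlongrightarrow> L) F" and K: "compact K" "\<And>z. z \<in> K \<Longrightarrow> det (mat z - L) \<noteq> 0"
  shows "\<forall>\<^sub>F t in F. \<forall>z\<in>K. det (mat z - M t) \<noteq> 0"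
proof (cases "K = {}")
  case False
  define D where "D = (\<lambda>p :: (complex^'n^'n) \<times> complex. det (mat (snd p) - fst p))"
  have D: "continuous_on S D" for S
    unfolding D_def by (intro continuous_on_det) (simp, intro continuous_intros)
  have "continuous_on K (\<lambda>z. norm (D (L, z)))"
    unfolding D_def by (intro continuous_on_norm continuous_on_det) (simp, intro continuous_intros)
  then obtain z0 where z0: "z0 \<in> K" "\<And>z. z \<in> K \<Longrightarrow> norm (D (L, z0)) \<le> norm (D (L, z))"
    using continuous_attains_inf[OF K(1) False] by blast
  define e where "e = norm (D (L, z0)) / 2"
  have e: "e > 0"
    using K(2)[OF z0(1)] by (simp add: e_def D_def)
  obtain X where X: "L \<in> X" "open X" "\<forall>B\<in>X \<inter> UNIV. \<forall>z\<in>K. dist (D (B, z)) (D (L, z)) \<le> e"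
    using continuous_on_prod_compactE[OF D[of "UNIV \<times> K"] K(1) UNIV_I e] by blast
  have "D (B, z) \<noteq> 0" if "B \<in> X" "z \<in> K" for B z
  proof
    assume "D (B, z) = 0"
    then have "norm (D (L, z)) \<le> e"
      using X(3) that by (force simp: dist_norm)
    with z0(2)[OF that(2)] e show False
      unfolding e_def by linarith
  qed
  then have "\<forall>z\<in>K. det (mat z - B) \<noteq> 0" if "B \<in> X" for B
    using that by (simp add: D_def)
  with topological_tendstoD[OF M X(2,1)] show ?thesis
    by (rule eventually_mono)
qed simp

section \<open>Simultaneous reduction of a germ of normal matrices\<close>

text \<open>Commutation with \<open>A\<close> makes both the range of \<open>P\<close> and its
  orthogonal complement invariant: the range is a reducing subspace.\<close>

definition orthogonal_reduction :: "complex^'n^'n \<Rightarrow> complex^'n^'n \<Rightarrow> bool" where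
  "orthogonal_reduction A P \<longleftrightarrow> P ** P = P \<and> conj_transpose P = P \<and> A ** P = P ** A"

text \<open>As \<open>P\<close> equals \<open>P ** conj_transpose P\<close>, its trace is the sum of
  the squared absolute values of its entries.\<close>

lemma trace_orthogonal_projection_nonzero:
  assumes "orthogonal_reduction A P" "P \<noteq> 0"
  shows "trace P \<noteq> 0"
proof -
  have P: "P ** conj_transpose P = P"
    using assms(1) by (simp add: orthogonal_reduction_def)
  have "trace P = trace (P ** conj_transpose P)"
    by (simp add: P)
  also have "\<dots> = of_real (\<Sum>i\<in>UNIV. \<Sum>j\<in>UNIV. (norm (P $ i $ j))\<^sup>2)"
    unfolding of_real_sum complex_norm_square by (simp add: trace_def matrix_matrix_mult_def)
  finally have tr: "trace P = of_real (\<Sum>i\<in>UNIV. \<Sum>j\<in>UNIV. (norm (P $ i $ j))\<^sup>2)" .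
  show ?thesis
  proof
    assume "trace P = 0"
    then have "(\<Sum>i\<in>UNIV. \<Sum>j\<in>UNIV. (norm (P $ i $ j))\<^sup>2) = 0"
      using tr by (metis of_real_eq_0_iff)
    then have "P $ i $ j = 0" for i j
      by (subst (asm) sum_nonneg_eq_0_iff) (auto simp: sum_nonneg sum_nonneg_eq_0_iff)
    then show False
      using assms(2) by (simp add: vec_eq_iff)
  qed
qed

lemma orthogonal_reduction_diff:
  assumes "orthogonal_reduction A P" "orthogonal_reduction A Q" "Q ** P = Q"
  shows "orthogonal_reduction A (P - Q)" "P ** Q = Q"
proof -
  have "P ** Q = conj_transpose (Q ** P)"
    using assms(1,2) by (simp add: orthogonal_reduction_def conj_transpose_mult)
  also have "\<dots> = Q"
    unfolding assms(3) using assms(2) by (simp add: orthogonal_reduction_def)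
  finally show "P ** Q = Q" .
  then show "orthogonal_reduction A (P - Q)"
    using assms by (simp add: orthogonal_reduction_def matrix_mult_diff_left matrix_mult_diff_right
        conj_transpose_diff)
qed

text \<open>The measure by which the splitting of blocks terminates. Equal ranges would make
  \<open>Q\<close> act as the identity on the range of \<open>P\<close>, so that
  \<open>Q ** P\<close> would be \<open>P\<close> and not \<open>Q\<close>.\<close>

lemma dim_range_projection_less:
  fixes P Q :: "complex^'n^'n"
  assumes "P ** P = P" "Q ** Q = Q" "Q ** P = Q" "P ** Q = Q" "P \<noteq> Q"
  shows "vec.dim (range ((*v) Q)) < vec.dim (range ((*v) P))"
proof (rule vec.dim_psubset)
  have sub: "vec.subspace (range ((*v) M))" for M :: "complex^'n^'n"
    using vec.subspace_image[OF vec.subspace_UNIV] .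
  have "Q *v x = P *v (Q *v x)" for x
    by (simp add: matrix_vector_mul_assoc assms)
  then have "range ((*v) Q) \<subseteq> range ((*v) P)"
    by blast
  moreover have "range ((*v) Q) \<noteq> range ((*v) P)"
  proof
    assume eq: "range ((*v) Q) = range ((*v) P)"
    have "Q *v (P *v x) = P *v x" for x
    proof -
      obtain y where "P *v x = Q *v y"
        using eq by blast
      then show ?thesis
        by (simp add: matrix_vector_mul_assoc assms)
    qed
    then have "Q ** P = P"
      by (simp add: matrix_eq matrix_vector_mul_assoc)
    with assms show False by simp
  qed
  ultimately show "vec.span (range ((*v) Q)) \<subset> vec.span (range ((*v) P))"
    by (simp add: vec.span_eq_iff[THEN iffD2, OF sub] psubset_eq)
qed

text \<open>Taking adjoints shows that \<open>P\<close> commutes with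
  \<open>conj_transpose C\<close> as well, so the projections can be collected in both
  products.\<close>

lemma normal_matrix_mult_projection:
  assumes "normal_matrix C" "orthogonal_reduction C P"
  shows "normal_matrix (C ** P)"
proof -
  have P: "P ** P = P" "conj_transpose P = P" "C ** P = P ** C"
    using assms(2) by (auto simp: orthogonal_reduction_def)
  have CP: "conj_transpose C ** P = P ** conj_transpose C"
    using arg_cong[OF P(3), of conj_transpose] unfolding conj_transpose_mult P(2) by (rule sym)
  have "(C ** P) ** conj_transpose (C ** P) = C ** (P ** P) ** conj_transpose C"
    by (simp add: conj_transpose_mult P(2) matrix_mul_assoc)
  also have "\<dots> = C ** (P ** conj_transpose C)"
    by (simp add: P(1) matrix_mul_assoc)
  also have "\<dots> = conj_transpose C ** C ** P"
    using assms(1) by (simp add: CP[symmetric] matrix_mul_assoc normal_matrix_def)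
  also have "\<dots> = conj_transpose C ** (P ** P) ** C"
    by (simp add: P(1) matrix_mul_assoc[symmetric]) (simp add: P(3))
  also have "\<dots> = conj_transpose (C ** P) ** (C ** P)"
    by (simp add: conj_transpose_mult P(2) matrix_mul_assoc CP) (simp add: matrix_mul_assoc[symmetric] P(3))
  finally show ?thesis
    by (simp add: normal_matrix_def)
qed

lemma mat_mult_cancel:
  fixes A B :: "complex^'n^'m"
  assumes "mat c ** A = mat c ** B" "c \<noteq> 0"
  shows "A = B"
  using assms by (simp add: matrix_mult_mat_left vec_eq_iff)

lemma mat_mult_left_commute: "A ** (mat c ** B) = mat c ** (A ** B)" for A :: "complex^'n^'m"
  by (metis matrix_mul_assoc matrix_mult_mat_commute)

lemma normal_matrix_scalar_cancel:
  assumes "normal_matrix (mat c ** B)" "c \<noteq> 0"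
  shows "normal_matrix B"
proof -
  have "(mat c ** B) ** conj_transpose (mat c ** B) = mat (c * cnj c) ** (B ** conj_transpose B)"
    "conj_transpose (mat c ** B) ** (mat c ** B) = mat (c * cnj c) ** (conj_transpose B ** B)"
    by (simp_all add: vec_eq_iff matrix_mult_mat_left)
      (simp_all add: matrix_matrix_mult_def sum_distrib_left mult_ac)
  then have "mat (c * cnj c) ** (B ** conj_transpose B) = mat (c * cnj c) ** (conj_transpose B ** B)"
    using assms(1) by (simp add: normal_matrix_def)
  then show ?thesis
    unfolding normal_matrix_def by (rule mat_mult_cancel) (use assms(2) in simp)
qed

lemma trace_mat_mult: "trace (mat c ** A) = c * trace A" for A :: "complex^'n^'n"
  by (simp add: trace_def matrix_mult_mat_left sum_distrib_left)

section \<open>Mean eigenvalue and deviation on a block\<close>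

definition block_mean :: "complex^'n^'n \<Rightarrow> complex^'n^'n \<Rightarrow> complex" where
  "block_mean A P = trace (A ** P) / trace P"

text \<open>The factor \<open>P\<close> continues the deviation by zero to the complement of the
  block, so that all blocks live in the same matrix space and no restriction to a varying subspace
  occurs.\<close>

definition block_deviation :: "complex^'n^'n \<Rightarrow> complex^'n^'n \<Rightarrow> complex^'n^'n" where
  "block_deviation A P = (A - mat (block_mean A P)) ** P"

lemma block_deviation:
  assumes "normal_matrix A" "orthogonal_reduction A P"
  shows "normal_matrix (block_deviation A P)"
    "block_deviation A P ** P = block_deviation A P" "P ** block_deviation A P = block_deviation A P"
    "A ** block_deviation A P = block_deviation A P ** A"
proof -
  define C where "C = A - mat (block_mean A P)"
  have P: "P ** P = P" "A ** P = P ** A"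
    using assms by (auto simp: orthogonal_reduction_def)
  have CP: "C ** P = P ** C"
    by (simp add: C_def matrix_mult_diff_left matrix_mult_diff_right P matrix_mult_mat_commute)
  have "orthogonal_reduction C P"
    using assms CP by (simp add: orthogonal_reduction_def)
  with normal_matrix_diff_mat[OF assms(1)] show "normal_matrix (block_deviation A P)"
    unfolding block_deviation_def C_def by (rule normal_matrix_mult_projection)
  show "block_deviation A P ** P = block_deviation A P"
    by (simp add: block_deviation_def matrix_mul_assoc[symmetric] P)
  show "P ** block_deviation A P = block_deviation A P"
    unfolding block_deviation_def C_def[symmetric]
    by (simp add: CP) (simp add: matrix_mul_assoc P)
  have AC: "A ** C = C ** A"
    by (simp add: C_def matrix_mult_diff_left matrix_mult_diff_right matrix_mult_mat_commute)
  have "A ** (C ** P) = C ** (A ** P)"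
    by (simp add: matrix_mul_assoc AC)
  then show "A ** block_deviation A P = block_deviation A P ** A"
    unfolding block_deviation_def C_def[symmetric] by (simp add: P(2) matrix_mul_assoc)
qed

lemma trace_block_deviation:
  assumes "trace P \<noteq> 0"
  shows "trace (block_deviation A P) = 0"
  using assms
  by (simp add: block_deviation_def matrix_mult_diff_right trace_sub trace_mat_mult block_mean_def)

text \<open>Phrasing disjointness of the spectra on two blocks by eigenvectors fixed by
  \<open>P\<close> and by \<open>Q\<close> lets it pass directly to smaller blocks.\<close>

definition separated :: "complex^'n^'n \<Rightarrow> complex^'n^'n \<Rightarrow> complex^'n^'n \<Rightarrow> bool" where
  "separated A P Q \<longleftrightarrow>
     (\<forall>x y c. P *v x = x \<longrightarrow> Q *v y = y \<longrightarrow> A *v x = c *s x \<longrightarrow> A *v y = c *s y \<longrightarrow> x = 0 \<or> y = 0)"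

text \<open>In contrast to \<open>at t\<^sub>0 within I\<close>, the base point is not removed: for
  \<open>t\<^sub>0 \<in> I\<close> an eventual statement also holds at
  \<open>t\<^sub>0\<close>.\<close>

abbreviation germ_filter :: "real \<Rightarrow> real set \<Rightarrow> real filter" where
  "germ_filter t\<^sub>0 I \<equiv> inf (nhds t\<^sub>0) (principal I)"

lemma eventually_germ_filter:
  "eventually P (germ_filter t\<^sub>0 I) \<longleftrightarrow> (\<exists>d>0. \<forall>t\<in>I \<inter> ball t\<^sub>0 d. P t)"
  by (auto simp: eventually_inf_principal eventually_nhds_metric dist_commute)

lemma eventually_germ_filter_iff:
  assumes "t\<^sub>0 \<in> I"
  shows "eventually P (germ_filter t\<^sub>0 I) \<longleftrightarrow> P t\<^sub>0 \<and> eventually P (at t\<^sub>0 within I)"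
  using assms
  by (auto simp: eventually_inf_principal eventually_at_filter eventually_nhds_metric
      elim: eventually_mono)

text \<open>A local ring of germs, represented by functions: units are the elements that do not
  vanish at \<open>t\<^sub>0\<close>, and \<open>divide\<close> says that an element vanishing there
  is a multiple of \<open>t - t\<^sub>0\<close>. The condition \<open>resolvent\<close> keeps
  spectral projections inside the ring. Conjugation is not among the operations; adjoints enter only
  through continuity. The condition \<open>limit_point\<close> carries identities from
  \<open>t \<noteq> t\<^sub>0\<close> to \<open>t\<^sub>0\<close>.\<close>

locale regular_germs =
  fixes t\<^sub>0 :: real and I :: "real set" and R :: "(real \<Rightarrow> complex) set" and A :: "real \<Rightarrow> complex^'n^'n"
  assumes base: "t\<^sub>0 \<in> I" and limit_point: "t\<^sub>0 islimpt I"
    and germ_cong: "\<And>f g. f \<in> R \<Longrightarrow> \<forall>\<^sub>F t in germ_filter t\<^sub>0 I. f t = g t \<Longrightarrow> g \<in> R"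
    and const [intro]: "\<And>c. (\<lambda>t. c) \<in> R"
    and add [intro]: "\<And>f g. f \<in> R \<Longrightarrow> g \<in> R \<Longrightarrow> (\<lambda>t. f t + g t) \<in> R"
    and mult [intro]: "\<And>f g. f \<in> R \<Longrightarrow> g \<in> R \<Longrightarrow> (\<lambda>t. f t * g t) \<in> R"
    and inverse: "\<And>f. f \<in> R \<Longrightarrow> f t\<^sub>0 \<noteq> 0 \<Longrightarrow> (\<lambda>t. inverse (f t)) \<in> R"
    and divide: "\<And>f. f \<in> R \<Longrightarrow> f t\<^sub>0 = 0 \<Longrightarrow>
      \<exists>g\<in>R. \<forall>\<^sub>F t in germ_filter t\<^sub>0 I. f t = of_real (t - t\<^sub>0) * g t"
    and tendsto: "\<And>f. f \<in> R \<Longrightarrow> (f \<longlongrightarrow> f t\<^sub>0) (germ_filter t\<^sub>0 I)"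
    and resolvent: "\<And>(B :: real \<Rightarrow> complex^'n^'n) w r i j.
      (\<And>i j. (\<lambda>t. B t $ i $ j) \<in> R) \<Longrightarrow> 0 < r \<Longrightarrow>
      (\<And>z. z \<in> sphere w r \<Longrightarrow> det (mat z - B t\<^sub>0) \<noteq> 0) \<Longrightarrow>
      (\<lambda>t. contour_integral (circlepath w r) (resolvent_entry (B t) i j)) \<in> R"
    and A_regular: "\<And>i j. (\<lambda>t. A t $ i $ j) \<in> R"
    and A_normal: "\<forall>\<^sub>F t in germ_filter t\<^sub>0 I. normal_matrix (A t)"
begin

abbreviation "\<G> \<equiv> germ_filter t\<^sub>0 I"

definition regular :: "(real \<Rightarrow> complex^'n^'n) \<Rightarrow> bool" where
  "regular M \<longleftrightarrow> (\<forall>i j. (\<lambda>t. M t $ i $ j) \<in> R)"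

lemma sum_in_R: "(\<And>x. x \<in> X \<Longrightarrow> f x \<in> R) \<Longrightarrow> (\<lambda>t. \<Sum>x\<in>X. f x t) \<in> R"
  by (induction X rule: infinite_finite_induct) auto

lemma diff: "f \<in> R \<Longrightarrow> g \<in> R \<Longrightarrow> (\<lambda>t. f t - g t) \<in> R"
  using add[OF _ mult[OF const[of "- 1"]], of f g] by simp

lemma regular_const [intro]: "regular (\<lambda>t. M)"
  by (auto simp: regular_def)

lemma regular_mult [intro]: "regular M \<Longrightarrow> regular N \<Longrightarrow> regular (\<lambda>t. M t ** N t)"
  by (auto simp: regular_def matrix_matrix_mult_def intro!: sum_in_R)

lemma regular_diff [intro]: "regular M \<Longrightarrow> regular N \<Longrightarrow> regular (\<lambda>t. M t - N t)"
  by (auto simp: regular_def intro!: diff)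

lemma regular_mat [intro]: "f \<in> R \<Longrightarrow> regular (\<lambda>t. mat (f t))"
  unfolding regular_def
proof (intro allI)
  fix i j assume "f \<in> R"
  then show "(\<lambda>t. mat (f t) $ i $ j) \<in> R"
    by (cases "i = j") (auto simp: mat_def)
qed

lemma regular_A [intro]: "regular A"
  using A_regular by (simp add: regular_def)

lemma trace_in_R: "regular M \<Longrightarrow> (\<lambda>t. trace (M t)) \<in> R"
  by (auto simp: regular_def trace_def intro!: sum_in_R)

lemma regular_tendsto: "regular M \<Longrightarrow> (M \<longlongrightarrow> M t\<^sub>0) \<G>"
  using tendsto by (auto simp: regular_def intro!: vec_tendstoI)

lemma eventually_base: "eventually P \<G> \<Longrightarrow> P t\<^sub>0"
  using base by (simp add: eventually_germ_filter_iff)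

lemma regular_nonzero:
  "regular M \<Longrightarrow> M t\<^sub>0 \<noteq> 0 \<Longrightarrow> \<forall>\<^sub>F t in \<G>. M t \<noteq> 0"
  using regular_tendsto tendsto_imp_eventually_ne by blast

lemma at_le_germ: "at t\<^sub>0 within I \<le> \<G>"
  unfolding at_within_def by (intro inf_mono order_refl) auto

lemma eventually_at_germ: "eventually P \<G> \<Longrightarrow> eventually P (at t\<^sub>0 within I)"
  using at_le_germ filter_leD by blast

lemma at_nontrivial: "at t\<^sub>0 within I \<noteq> bot"
  using limit_point by (simp add: trivial_limit_within)

lemma eventually_punctured: "\<forall>\<^sub>F t in \<G>. t \<noteq> t\<^sub>0 \<longrightarrow> P t \<Longrightarrow> \<forall>\<^sub>F t in at t\<^sub>0 within I. P t"
  by (auto dest: eventually_at_germ simp: eventually_at_filter elim: eventually_mono)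

text \<open>Since \<open>t\<^sub>0\<close> is a limit point of \<open>I\<close>, limits along the
  punctured germ are unique, and continuity forces the value 0 at \<open>t\<^sub>0\<close>.\<close>

lemma zero_at_base:
  fixes f :: "real \<Rightarrow> complex^'n^'n"
  assumes "(f \<longlongrightarrow> f t\<^sub>0) \<G>" "\<forall>\<^sub>F t in \<G>. t \<noteq> t\<^sub>0 \<longrightarrow> f t = 0"
  shows "\<forall>\<^sub>F t in \<G>. f t = 0"
proof -
  have ev: "\<forall>\<^sub>F t in at t\<^sub>0 within I. f t = 0"
    using eventually_punctured[OF assms(2)] .
  have "(f \<longlongrightarrow> f t\<^sub>0) (at t\<^sub>0 within I)"
    using assms(1) at_le_germ by (rule tendsto_mono[rotated])
  moreover have "(f \<longlongrightarrow> 0) (at t\<^sub>0 within I)"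
    using ev by (rule tendsto_eventually)
  ultimately have "f t\<^sub>0 = 0"
    using tendsto_unique[OF at_nontrivial] by blast
  with assms(2) show ?thesis
    by (auto elim: eventually_mono)
qed

lemma tendsto_entry: "(M \<longlongrightarrow> L) F \<Longrightarrow> ((\<lambda>t. M t $ i $ j) \<longlongrightarrow> L $ i $ j) F"
  for M :: "real \<Rightarrow> complex^'n^'n"
  by (rule tendsto_vec_nth[OF tendsto_vec_nth])

lemma tendsto_conj_transpose:
  fixes M :: "real \<Rightarrow> complex^'n^'n"
  assumes "(M \<longlongrightarrow> L) F"
  shows "((\<lambda>t. conj_transpose (M t)) \<longlongrightarrow> conj_transpose L) F"
proof (intro vec_tendstoI)
  show "((\<lambda>t. conj_transpose (M t) $ i $ j) \<longlongrightarrow> conj_transpose L $ i $ j) F" for i j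
    unfolding conj_transpose_nth by (rule tendsto_cnj[OF tendsto_entry[OF assms]])
qed

lemma tendsto_matrix_mult:
  fixes M N :: "real \<Rightarrow> complex^'n^'n"
  assumes "(M \<longlongrightarrow> L) F" "(N \<longlongrightarrow> K) F"
  shows "((\<lambda>t. M t ** N t) \<longlongrightarrow> L ** K) F"
proof (intro vec_tendstoI)
  show "((\<lambda>t. (M t ** N t) $ i $ j) \<longlongrightarrow> (L ** K) $ i $ j) F" for i j
    unfolding matrix_matrix_mult_def vec_lambda_beta
    by (intro tendsto_sum tendsto_mult tendsto_entry assms)
qed

text \<open>Each exponent has its own regular quotient; nothing is claimed about how these quotients
  grow with \<open>m\<close>.\<close>

definition flat :: "(real \<Rightarrow> complex^'n^'n) \<Rightarrow> bool" where
  "flat M \<longleftrightarrow> (\<forall>m. \<exists>C. regular C \<and> (\<forall>\<^sub>F t in \<G>. M t = mat (of_real (t - t\<^sub>0) ^ m) ** C t))"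

lemma regular_divide:
  assumes "regular M" "M t\<^sub>0 = 0"
  shows "\<exists>C. regular C \<and> (\<forall>\<^sub>F t in \<G>. M t = mat (of_real (t - t\<^sub>0)) ** C t)"
proof -
  define g where "g i j = (SOME g. g \<in> R \<and> (\<forall>\<^sub>F t in \<G>. M t $ i $ j = of_real (t - t\<^sub>0) * g t))" for i j
  have "\<exists>g. g \<in> R \<and> (\<forall>\<^sub>F t in \<G>. M t $ i $ j = of_real (t - t\<^sub>0) * g t)" for i j
    using assms divide[of "\<lambda>t. M t $ i $ j"] by (auto simp: regular_def)
  from someI_ex[OF this]
  have "g i j \<in> R \<and> (\<forall>\<^sub>F t in \<G>. M t $ i $ j = of_real (t - t\<^sub>0) * g i j t)" for i j
    unfolding g_def .
  then have g: "\<And>i j. g i j \<in> R" "\<And>i j. \<forall>\<^sub>F t in \<G>. M t $ i $ j = of_real (t - t\<^sub>0) * g i j t"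
    by blast+
  have "\<forall>\<^sub>F t in \<G>. \<forall>i j. M t $ i $ j = of_real (t - t\<^sub>0) * g i j t"
    using g(2) by (simp add: eventually_all_finite)
  then have "\<forall>\<^sub>F t in \<G>. M t = mat (of_real (t - t\<^sub>0)) ** (\<chi> i j. g i j t)"
    by (rule eventually_mono) (simp add: vec_eq_iff matrix_mult_mat_left)
  moreover have "regular (\<lambda>t. \<chi> i j. g i j t)"
    using g(1) by (simp add: regular_def)
  ultimately show ?thesis
    by (intro exI[of _ "\<lambda>t. \<chi> i j. g i j t"]) simp
qed

text \<open>Divide by \<open>t - t\<^sub>0\<close> as long as the quotient vanishes at
  \<open>t\<^sub>0\<close>. Either this stops, at a quotient that does not vanish there, or it
  produces a quotient for every exponent.\<close>

lemma flat_or_finite_order: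
  assumes "regular M"
  shows "flat M \<or> (\<exists>m C. regular C \<and> C t\<^sub>0 \<noteq> 0 \<and> (\<forall>\<^sub>F t in \<G>. M t = mat (of_real (t - t\<^sub>0) ^ m) ** C t))"
proof (rule disjCI)
  assume none: "\<not> (\<exists>m C. regular C \<and> C t\<^sub>0 \<noteq> 0 \<and> (\<forall>\<^sub>F t in \<G>. M t = mat (of_real (t - t\<^sub>0) ^ m) ** C t))"
  show "flat M"
    unfolding flat_def
  proof
    fix m show "\<exists>C. regular C \<and> (\<forall>\<^sub>F t in \<G>. M t = mat (of_real (t - t\<^sub>0) ^ m) ** C t)"
    proof (induction m)
      case 0
      then show ?case using assms by (intro exI[of _ M]) simp
    next
      case (Suc m)
      then obtain C where C: "regular C" "\<forall>\<^sub>F t in \<G>. M t = mat (of_real (t - t\<^sub>0) ^ m) ** C t"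
        by blast
      then have "C t\<^sub>0 = 0"
        using none by blast
      then obtain D where D: "regular D" "\<forall>\<^sub>F t in \<G>. C t = mat (of_real (t - t\<^sub>0)) ** D t"
        using regular_divide C(1) by blast
      have "\<forall>\<^sub>F t in \<G>. M t = mat (of_real (t - t\<^sub>0) ^ Suc m) ** D t"
        using C(2) D(2) by eventually_elim (simp add: matrix_mult_mat_left vec_eq_iff)
      with D(1) show ?case by blast
    qed
  qed
qed

lemma block_mean_in_R:
  assumes "regular P" "trace (P t\<^sub>0) \<noteq> 0"
  shows "(\<lambda>t. block_mean (A t) (P t)) \<in> R"
  unfolding block_mean_def divide_inverse
  using assms by (intro mult trace_in_R inverse regular_mult regular_A)

lemma regular_block_deviation:
  assumes "regular P" "trace (P t\<^sub>0) \<noteq> 0"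
  shows "regular (\<lambda>t. block_deviation (A t) (P t))"
  unfolding block_deviation_def
  using assms by (intro regular_mult regular_diff regular_A regular_mat block_mean_in_R)

end

text \<open>On the range of \<open>P\<close> the matrix \<open>A\<close> equals its mean plus
  \<open>u\<close> times \<open>B\<close>. An eigenvector of \<open>A\<close> in the block with
  eigenvalue \<open>c\<close> is therefore an eigenvector of \<open>B\<close> for
  \<open>(c - block_mean A P) / u\<close>, and this number alone decides whether \<open>S\<close>
  keeps or kills it.\<close>

lemma (in normal_spectral_projection) separated:
  assumes P: "orthogonal_reduction A P" "P ** B = B" "B ** P = B" "0 \<notin> ball w r"
    and SA: "orthogonal_reduction A S"
    and B: "block_deviation A P = mat u ** B" "u \<noteq> 0"
  shows "separated A S (P - S)"
  unfolding separated_def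
proof (intro allI impI)
  fix x y c
  assume x: "S *v x = x" and y: "(P - S) *v y = y" and c: "A *v x = c *s x" "A *v y = c *s y"
  have SP: "S ** P = S"
    by (rule absorb[OF P(2,3,4)])
  then have PS: "P ** S = S"
    using orthogonal_reduction_diff[OF P(1) SA] by blast
  have PP: "P ** P = P"
    using P(1) by (simp add: orthogonal_reduction_def)
  have Px: "P *v x = x"
    by (metis PS matrix_vector_mul_assoc x)
  have "P ** (P - S) = P - S"
    by (simp add: matrix_mult_diff_left PP PS)
  then have Py: "P *v y = y"
    by (metis matrix_vector_mul_assoc y)
  have "S ** (P - S) = 0"
    by (simp add: matrix_mult_diff_left SP idem)
  then have "S *v y = 0"
    by (metis matrix_vector_mul_assoc matrix_vector_mult_0 y)
  have *: "B *v v = ((c - block_mean A P) / u) *s v" if v: "P *v v = v" "A *v v = c *s v" for v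
  proof -
    have "u *s (B *v v) = block_deviation A P *v v"
      by (simp add: B matrix_vector_mul_assoc[symmetric] mat_vector_mult)
    also have "\<dots> = (c - block_mean A P) *s v"
      by (simp add: block_deviation_def matrix_vector_mul_assoc[symmetric] v
          matrix_vector_mult_diff_rdistrib mat_vector_mult vec.scale_left_diff_distrib)
    finally have "(1 / u) *s (u *s (B *v v)) = (1 / u) *s ((c - block_mean A P) *s v)"
      by simp
    then show ?thesis
      using B(2) by (simp add: vec.scale_left_diff_distrib diff_divide_distrib)
  qed
  show "x = 0 \<or> y = 0"
    using eig[OF *[OF Px c(1)]] eig[OF *[OF Py c(2)]] x \<open>S *v y = 0\<close>
    by (auto split: if_splits)
qed

lemma separated_mono:
  assumes "separated A P P'" "P ** Q = Q" "P' ** Q' = Q'"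
  shows "separated A Q Q'"
  unfolding separated_def
proof (intro allI impI)
  fix x y c assume *: "Q *v x = x" "Q' *v y = y" "A *v x = c *s x" "A *v y = c *s y"
  have "P *v x = x" "P' *v y = y"
    using *(1,2) assms(2,3) by (metis matrix_vector_mul_assoc)+
  then show "x = 0 \<or> y = 0"
    using assms(1) * by (auto simp: separated_def)
qed

section \<open>Isolating an eigenvalue and splitting a block\<close>

lemma finite_eigenvalues:
  assumes "normal_matrix B"
  shows "finite {z. det (mat z - B) = 0}"
proof -
  obtain e l where "complex_basis e" "\<And>j. B *v e j = l j *s e j"
    using normal_matrix_exists_eigenbasis[OF assms] by blast
  then have "monic_charpoly B = (\<Prod>j\<in>UNIV. [:- l j, 1:])"
    by (rule monic_charpoly_eq_prod)
  then have "monic_charpoly B \<noteq> 0"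
    by simp
  then show ?thesis
    unfolding det_mat_diff by (rule poly_roots_finite)
qed

lemma exists_isolating_radius:
  assumes "normal_matrix B" "c \<noteq> 0"
  shows "\<exists>r>0. (\<forall>z\<in>sphere c r. det (mat z - B) \<noteq> 0) \<and> 0 \<notin> ball c r \<and>
    (\<forall>z\<in>ball c r. det (mat z - B) = 0 \<longrightarrow> z = c)"
proof -
  \<comment> \<open>The number 0 is added to the points to be avoided, so that one radius isolates
    \<open>c\<close> and also keeps the disc away from 0.\<close>
  have "finite (insert 0 {z. det (mat z - B) = 0})"
    using finite_eigenvalues[OF assms(1)] by simp
  from finite_set_avoid[OF this, of c]
  obtain d where d: "d > 0" "\<And>z. z \<in> insert 0 {z. det (mat z - B) = 0} \<Longrightarrow> z \<noteq> c \<Longrightarrow> d \<le> dist c z"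
    by blast
  have "det (mat z - B) \<noteq> 0" if "z \<in> sphere c (d / 2)" for z
    using d(1) d(2)[of z] that by auto
  moreover have "z = c" if "z \<in> ball c (d / 2)" "det (mat z - B) = 0" for z
    using d(1) d(2)[of z] that by force
  moreover have "0 \<notin> ball c (d / 2)"
    using d(1) d(2)[of 0] assms(2) by auto
  ultimately show ?thesis
    using d(1) by (intro exI[of _ "d / 2"]) auto
qed

context regular_germs
begin

lemma regular_spectral_projection:
  assumes "regular C" "0 < r" "\<And>z. z \<in> sphere w r \<Longrightarrow> det (mat z - C t\<^sub>0) \<noteq> 0"
  shows "regular (\<lambda>t. spectral_projection (C t) w r)"
proof -
  have "(\<lambda>t. inverse (2 * of_real pi * \<i>) * contour_integral (circlepath w r) (resolvent_entry (C t) i j)) \<in> R" for i j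
    using assms by (intro mult const resolvent) (auto simp: regular_def)
  moreover have "spectral_projection (C t) w r $ i $ j =
      inverse (2 * of_real pi * \<i>) * contour_integral (circlepath w r) (resolvent_entry (C t) i j)" for t i j
    by (simp only: spectral_projection_def vec_lambda_beta divide_inverse mult.commute)
  ultimately show ?thesis
    by (simp only: regular_def simp_thms)
qed

text \<open>After division by the exact power of \<open>t - t\<^sub>0\<close>, the trace-free part is normal and nonzero at
  \<open>t\<^sub>0\<close>, so it has a nonzero eigenvalue there, which does not exhaust the block.\<close>

lemma reduction_step:
  assumes P: "regular P" "\<forall>\<^sub>F t in \<G>. orthogonal_reduction (A t) (P t)" "P t\<^sub>0 \<noteq> 0"
    and not_flat: "\<not> flat (\<lambda>t. block_deviation (A t) (P t))"
  shows "\<exists>Q. regular Q \<and> (\<forall>\<^sub>F t in \<G>. orthogonal_reduction (A t) (Q t) \<and> Q t ** P t = Q t) \<and>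
    Q t\<^sub>0 \<noteq> 0 \<and> Q t\<^sub>0 \<noteq> P t\<^sub>0 \<and> (\<forall>\<^sub>F t in \<G>. t \<noteq> t\<^sub>0 \<longrightarrow> separated (A t) (Q t) (P t - Q t))"
proof -
  have P0: "orthogonal_reduction (A t\<^sub>0) (P t\<^sub>0)"
    using P(2) by (rule eventually_base)
  have tr0: "trace (P t\<^sub>0) \<noteq> 0"
    using P0 P(3) by (rule trace_orthogonal_projection_nonzero)
  obtain m C where C: "regular C" "C t\<^sub>0 \<noteq> 0"
      "\<forall>\<^sub>F t in \<G>. block_deviation (A t) (P t) = mat (of_real (t - t\<^sub>0) ^ m) ** C t"
    using flat_or_finite_order[OF regular_block_deviation[OF P(1) tr0]] not_flat by blast
  \<comment> \<open>For \<open>t \<noteq> t\<^sub>0\<close> the power of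
    \<open>t - t\<^sub>0\<close> is a nonzero scalar and cancels from every relation for the
    deviation. The facts that follow extend these relations to \<open>t\<^sub>0\<close> by
    continuity.\<close>
  have off: "\<forall>\<^sub>F t in \<G>. t \<noteq> t\<^sub>0 \<longrightarrow> normal_matrix (C t) \<and> C t ** P t = C t \<and> P t ** C t = C t \<and>
      A t ** C t = C t ** A t \<and> trace (C t) = 0"
    using A_normal P(2) C(3) regular_nonzero[OF P(1,3)]
  proof eventually_elim
    case (elim t)
    show ?case
    proof
      assume "t \<noteq> t\<^sub>0"
      define u where "u = complex_of_real (t - t\<^sub>0) ^ m"
      have u: "u \<noteq> 0"
        using \<open>t \<noteq> t\<^sub>0\<close> by (simp add: u_def)
      have D: "block_deviation (A t) (P t) = mat u ** C t"
        using elim(3) by (simp add: u_def)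
      note dev = block_deviation[OF elim(1,2), unfolded D]
      have "normal_matrix (C t)"
        using dev(1) u by (rule normal_matrix_scalar_cancel)
      moreover have "C t ** P t = C t"
        by (rule mat_mult_cancel[OF _ u]) (use dev(2) in \<open>simp add: matrix_mul_assoc\<close>)
      moreover have "P t ** C t = C t"
        by (rule mat_mult_cancel[OF _ u]) (use dev(3) in \<open>simp add: mat_mult_left_commute\<close>)
      moreover have "A t ** C t = C t ** A t"
        by (rule mat_mult_cancel[OF _ u])
          (simp only: mat_mult_left_commute[symmetric] dev(4) matrix_mul_assoc[of _ "C t", symmetric])
      moreover have "u * trace (C t) = 0"
        using trace_block_deviation[OF trace_orthogonal_projection_nonzero[OF elim(2,4)], of "A t"]
        by (simp add: D trace_mat_mult)
      ultimately show "normal_matrix (C t) \<and> C t ** P t = C t \<and> P t ** C t = C t \<and>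
          A t ** C t = C t ** A t \<and> trace (C t) = 0"
        using u by simp
    qed
  qed
  have CP: "\<forall>\<^sub>F t in \<G>. C t ** P t = C t"
    using zero_at_base[OF regular_tendsto[OF regular_diff[OF regular_mult[OF C(1) P(1)] C(1)]]]
      eventually_mono[OF off, of "\<lambda>t. t \<noteq> t\<^sub>0 \<longrightarrow> C t ** P t - C t = 0"] by simp
  have PC: "\<forall>\<^sub>F t in \<G>. P t ** C t = C t"
    using zero_at_base[OF regular_tendsto[OF regular_diff[OF regular_mult[OF P(1) C(1)] C(1)]]]
      eventually_mono[OF off, of "\<lambda>t. t \<noteq> t\<^sub>0 \<longrightarrow> P t ** C t - C t = 0"] by simp
  have AC: "\<forall>\<^sub>F t in \<G>. A t ** C t = C t ** A t"
    using zero_at_base[OF regular_tendsto[OF regular_diff[OF regular_mult[OF regular_A C(1)] regular_mult[OF C(1) regular_A]]]]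
      eventually_mono[OF off, of "\<lambda>t. t \<noteq> t\<^sub>0 \<longrightarrow> A t ** C t - C t ** A t = 0"] by simp
  have mat0: "mat a = (0 :: complex^'n^'n) \<longleftrightarrow> a = 0" for a
    by (auto simp: vec_eq_iff mat_def)
  \<comment> \<open>The trace is embedded as a scalar matrix because \<open>zero_at_base\<close> is
    stated for matrices.\<close>
  have trC: "\<forall>\<^sub>F t in \<G>. trace (C t) = 0"
    using zero_at_base[OF regular_tendsto[OF regular_mat[OF trace_in_R[OF C(1)]]]]
      eventually_mono[OF off, of "\<lambda>t. t \<noteq> t\<^sub>0 \<longrightarrow> mat (trace (C t)) = (0 :: complex^'n^'n)"]
    by (simp add: mat0)
  have "((\<lambda>t. C t ** conj_transpose (C t) - conj_transpose (C t) ** C t) \<longlongrightarrow>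
      C t\<^sub>0 ** conj_transpose (C t\<^sub>0) - conj_transpose (C t\<^sub>0) ** C t\<^sub>0) \<G>"
    by (intro tendsto_diff tendsto_matrix_mult tendsto_conj_transpose regular_tendsto C(1))
  then have "\<forall>\<^sub>F t in \<G>. C t ** conj_transpose (C t) - conj_transpose (C t) ** C t = 0"
    by (rule zero_at_base) (rule eventually_mono[OF off], simp add: normal_matrix_def)
  then have Cn: "\<forall>\<^sub>F t in \<G>. normal_matrix (C t)"
    by (simp add: normal_matrix_def)
  have Cn0: "normal_matrix (C t\<^sub>0)"
    using Cn by (rule eventually_base)
  have "\<exists>x c. C t\<^sub>0 *v x = c *s x \<and> x \<noteq> 0 \<and> c \<noteq> 0"
  proof (rule ccontr)
    assume *: "\<not> ?thesis"
    have "C t\<^sub>0 = 0"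
    proof (rule matrix_eq_on_span[OF normal_matrix_span_eigenvectors[OF Cn0]])
      fix x assume "x \<in> eigenvectors (C t\<^sub>0)"
      then obtain c where "C t\<^sub>0 *v x = c *s x"
        by (auto simp: eigenvectors_def)
      with * show "C t\<^sub>0 *v x = 0 *v x"
        by (cases "x = 0"; cases "c = 0") auto
    qed
    with C(2) show False by simp
  qed
  then obtain x c where x: "C t\<^sub>0 *v x = c *s x" "x \<noteq> 0" "c \<noteq> 0"
    by blast
  obtain r where rad: "r > 0" "\<And>z. z \<in> sphere c r \<Longrightarrow> det (mat z - C t\<^sub>0) \<noteq> 0" "0 \<notin> ball c r"
      "\<And>z. z \<in> ball c r \<Longrightarrow> det (mat z - C t\<^sub>0) = 0 \<Longrightarrow> z = c"
    using exists_isolating_radius[OF Cn0 x(3)] by blast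
  define Q where "Q = (\<lambda>t. spectral_projection (C t) c r)"
  have Q: "regular Q"
    unfolding Q_def using C(1) rad(1,2) by (rule regular_spectral_projection)
  have "\<forall>\<^sub>F t in \<G>. \<forall>z\<in>sphere c r. det (mat z - C t) \<noteq> 0"
    using regular_tendsto[OF C(1)] by (rule eventually_det_nonzero) (use rad(2) in auto)
  with Cn have nsp: "\<forall>\<^sub>F t in \<G>. normal_spectral_projection (C t) c r"
    by eventually_elim (use rad(1) in \<open>auto simp: normal_spectral_projection_def\<close>)
  have QP: "\<forall>\<^sub>F t in \<G>. orthogonal_reduction (A t) (Q t) \<and> Q t ** P t = Q t"
    using nsp CP PC AC
  proof eventually_elim
    case (elim t)
    interpret normal_spectral_projection "C t" c r
      by (rule elim(1))
    show ?case
      using idem self_adjoint commute[OF elim(4)] absorb[OF elim(3,2) rad(3)]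
      by (simp add: orthogonal_reduction_def Q_def)
  qed
  interpret zero: normal_spectral_projection "C t\<^sub>0" c r
    using nsp by (rule eventually_base)
  have "Q t\<^sub>0 *v x = x"
    using zero.eig[OF x(1)] rad(1) by (simp add: Q_def)
  with x(2) have Q0: "Q t\<^sub>0 \<noteq> 0"
    by auto
  \<comment> \<open>The purpose is \<open>Q t\<^sub>0 \<noteq> P t\<^sub>0\<close>: if they were
    equal, \<open>C t\<^sub>0\<close> would be \<open>c\<close> times \<open>P t\<^sub>0\<close>,
    whose trace is not zero.\<close>
  have "C t\<^sub>0 ** Q t\<^sub>0 = mat c ** Q t\<^sub>0"
  proof (rule matrix_eq_on_span[OF zero.span_eig])
    fix y assume "y \<in> eigenvectors (C t\<^sub>0)"
    then obtain d where y: "C t\<^sub>0 *v y = d *s y"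
      by (auto simp: eigenvectors_def)
    show "(C t\<^sub>0 ** Q t\<^sub>0) *v y = (mat c ** Q t\<^sub>0) *v y"
    proof (cases "dist c d < r \<and> y \<noteq> 0")
      case True
      then have "d = c"
        using rad(4)[of d] eigenvalue_det_zero[OF y] by auto
      then show ?thesis
        using True zero.eig[OF y] y by (simp add: Q_def matrix_vector_mul_assoc[symmetric] mat_vector_mult)
    next
      case False
      then show ?thesis
        using zero.eig[OF y] by (auto simp: Q_def matrix_vector_mul_assoc[symmetric])
    qed
  qed
  moreover have "C t\<^sub>0 ** P t\<^sub>0 = C t\<^sub>0" "trace (C t\<^sub>0) = 0"
    using CP trC by (auto dest: eventually_base)
  ultimately have Q1: "Q t\<^sub>0 \<noteq> P t\<^sub>0"
    using x(3) tr0 by (metis mult_eq_0_iff trace_mat_mult)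
  have "\<forall>\<^sub>F t in \<G>. t \<noteq> t\<^sub>0 \<longrightarrow> separated (A t) (Q t) (P t - Q t)"
    using nsp CP PC P(2) QP C(3)
  proof eventually_elim
    case (elim t)
    interpret normal_spectral_projection "C t" c r
      by (rule elim(1))
    show ?case
      using separated[OF elim(4,3,2) rad(3) _ elim(6)] elim(5) by (simp add: Q_def)
  qed
  with Q QP Q0 Q1 show ?thesis
    by blast
qed

definition flat_block :: "(real \<Rightarrow> complex^'n^'n) \<Rightarrow> bool" where
  "flat_block Q \<longleftrightarrow> regular Q \<and> (\<forall>\<^sub>F t in \<G>. orthogonal_reduction (A t) (Q t)) \<and> Q t\<^sub>0 \<noteq> 0 \<and>
     flat (\<lambda>t. block_deviation (A t) (Q t))"

text \<open>Induction on the rank at \<open>t\<^sub>0\<close>: a block that is not flat splits into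
  \<open>Q\<close> and \<open>P - Q\<close>, both of smaller rank there. Subblocks of different
  halves inherit the separation of the halves, so concatenating the two lists keeps the blocks
  pairwise separated; \<open>sorted_wrt\<close> expresses this for a list.\<close>

theorem reduction_to_flat_blocks:
  assumes "regular P" "\<forall>\<^sub>F t in \<G>. orthogonal_reduction (A t) (P t)" "P t\<^sub>0 \<noteq> 0"
  shows "\<exists>Qs. (\<forall>Q\<in>set Qs. flat_block Q \<and> (\<forall>\<^sub>F t in \<G>. Q t ** P t = Q t)) \<and>
    (\<forall>\<^sub>F t in \<G>. (\<Sum>Q\<leftarrow>Qs. Q t) = P t) \<and>
    (\<forall>\<^sub>F t in \<G>. t \<noteq> t\<^sub>0 \<longrightarrow> sorted_wrt (\<lambda>Q Q'. separated (A t) (Q t) (Q' t)) Qs)"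
  using assms
proof (induction "vec.dim (range ((*v) (P t\<^sub>0)))" arbitrary: P rule: less_induct)
  case less
  show ?case
  proof (cases "flat (\<lambda>t. block_deviation (A t) (P t))")
    case True
    have "\<forall>\<^sub>F t in \<G>. P t ** P t = P t"
      using less.prems(2) by eventually_elim (simp add: orthogonal_reduction_def)
    with True less.prems show ?thesis
      by (intro exI[of _ "[P]"]) (simp add: flat_block_def)
  next
    case False
    obtain Q where Q: "regular Q" "\<forall>\<^sub>F t in \<G>. orthogonal_reduction (A t) (Q t) \<and> Q t ** P t = Q t"
        "Q t\<^sub>0 \<noteq> 0" "Q t\<^sub>0 \<noteq> P t\<^sub>0"
        and sep: "\<forall>\<^sub>F t in \<G>. t \<noteq> t\<^sub>0 \<longrightarrow> separated (A t) (Q t) (P t - Q t)"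
      using reduction_step[OF less.prems False] by blast
    have PQ: "\<forall>\<^sub>F t in \<G>. orthogonal_reduction (A t) (P t - Q t) \<and> P t ** Q t = Q t"
      using less.prems(2) Q(2) by eventually_elim (blast intro: orthogonal_reduction_diff)
    have P0: "P t\<^sub>0 ** P t\<^sub>0 = P t\<^sub>0" "Q t\<^sub>0 ** Q t\<^sub>0 = Q t\<^sub>0" "Q t\<^sub>0 ** P t\<^sub>0 = Q t\<^sub>0" "P t\<^sub>0 ** Q t\<^sub>0 = Q t\<^sub>0"
      using eventually_base[OF less.prems(2)] eventually_base[OF Q(2)] eventually_base[OF PQ]
      by (auto simp: orthogonal_reduction_def)
    have "vec.dim (range ((*v) (Q t\<^sub>0))) < vec.dim (range ((*v) (P t\<^sub>0)))"
      using P0 Q(4) by (intro dim_range_projection_less) auto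
    moreover have "\<forall>\<^sub>F t in \<G>. orthogonal_reduction (A t) (Q t)"
      using Q(2) by eventually_elim simp
    ultimately obtain Qs1 where Qs1: "\<And>q. q \<in> set Qs1 \<Longrightarrow> flat_block q \<and> (\<forall>\<^sub>F t in \<G>. q t ** Q t = q t)"
        "\<forall>\<^sub>F t in \<G>. (\<Sum>q\<leftarrow>Qs1. q t) = Q t"
        "\<forall>\<^sub>F t in \<G>. t \<noteq> t\<^sub>0 \<longrightarrow> sorted_wrt (\<lambda>q q'. separated (A t) (q t) (q' t)) Qs1"
      using less.hyps[OF _ Q(1) _ Q(3)] by blast
    have "vec.dim (range ((*v) (P t\<^sub>0 - Q t\<^sub>0))) < vec.dim (range ((*v) (P t\<^sub>0)))"
      using P0 Q(3) by (intro dim_range_projection_less) (auto simp: matrix_mult_diff_left matrix_mult_diff_right)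
    moreover have "\<forall>\<^sub>F t in \<G>. orthogonal_reduction (A t) (P t - Q t)"
      using PQ by eventually_elim simp
    moreover have "P t\<^sub>0 - Q t\<^sub>0 \<noteq> 0"
      using Q(4) by simp
    ultimately obtain Qs2 where Qs2: "\<And>q. q \<in> set Qs2 \<Longrightarrow> flat_block q \<and> (\<forall>\<^sub>F t in \<G>. q t ** (P t - Q t) = q t)"
        "\<forall>\<^sub>F t in \<G>. (\<Sum>q\<leftarrow>Qs2. q t) = P t - Q t"
        "\<forall>\<^sub>F t in \<G>. t \<noteq> t\<^sub>0 \<longrightarrow> sorted_wrt (\<lambda>q q'. separated (A t) (q t) (q' t)) Qs2"
      using less.hyps[of "\<lambda>t. P t - Q t"] regular_diff[OF less.prems(1) Q(1)] by blast
    have sub1: "\<forall>\<^sub>F t in \<G>. q t ** P t = q t \<and> Q t ** q t = q t" if "q \<in> set Qs1" for q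
    proof -
      have "\<forall>\<^sub>F t in \<G>. q t ** Q t = q t" "\<forall>\<^sub>F t in \<G>. orthogonal_reduction (A t) (q t)"
        using Qs1(1)[OF that] by (auto simp: flat_block_def)
      then show ?thesis
        using Q(2)
      proof eventually_elim
        case (elim t)
        then have "q t ** P t = q t ** (Q t ** P t)"
          by (metis matrix_mul_assoc)
        with elim show ?case
          using orthogonal_reduction_diff(2)[of "A t" "Q t" "q t"] by simp
      qed
    qed
    have sub2: "\<forall>\<^sub>F t in \<G>. q t ** P t = q t \<and> (P t - Q t) ** q t = q t" if "q \<in> set Qs2" for q
    proof -
      have "\<forall>\<^sub>F t in \<G>. q t ** (P t - Q t) = q t" "\<forall>\<^sub>F t in \<G>. orthogonal_reduction (A t) (q t)"
        using Qs2(1)[OF that] by (auto simp: flat_block_def)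
      then show ?thesis
        using Q(2) PQ less.prems(2)
      proof eventually_elim
        case (elim t)
        have "(P t - Q t) ** P t = P t - Q t"
          using elim by (simp add: matrix_mult_diff_right orthogonal_reduction_def)
        then have "q t ** P t = q t ** (P t - Q t)"
          by (metis elim(1) matrix_mul_assoc)
        with elim show ?case
          using orthogonal_reduction_diff(2)[of "A t" "P t - Q t" "q t"] by simp
      qed
    qed
    have "\<forall>\<^sub>F t in \<G>. \<forall>q\<in>set Qs1. q t ** P t = q t \<and> Q t ** q t = q t"
      "\<forall>\<^sub>F t in \<G>. \<forall>q\<in>set Qs2. q t ** P t = q t \<and> (P t - Q t) ** q t = q t"
      using sub1 sub2 by (auto intro!: eventually_ball_finite)
    then have "\<forall>\<^sub>F t in \<G>. t \<noteq> t\<^sub>0 \<longrightarrow> sorted_wrt (\<lambda>q q'. separated (A t) (q t) (q' t)) (Qs1 @ Qs2)"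
      using Qs1(3) Qs2(3) sep
    proof eventually_elim
      case (elim t)
      then show ?case
        by (auto simp: sorted_wrt_append intro: separated_mono)
    qed
    moreover have "\<forall>\<^sub>F t in \<G>. (\<Sum>q\<leftarrow>Qs1 @ Qs2. q t) = P t"
      using Qs1(2) Qs2(2) by eventually_elim simp
    moreover have "flat_block q \<and> (\<forall>\<^sub>F t in \<G>. q t ** P t = q t)" if "q \<in> set (Qs1 @ Qs2)" for q
      using that Qs1(1) Qs2(1) sub1[of q] sub2[of q] by (auto simp: eventually_conj_iff)
    ultimately show ?thesis
      by (intro exI[of _ "Qs1 @ Qs2"]) blast
  qed
qed

end

section \<open>Generic germs\<close>

lemma sum_list_matrix_vector_in_subspace:
  fixes Qs :: "(complex^'n^'n) list"
  assumes "vec.subspace V" "\<And>Q. Q \<in> set Qs \<Longrightarrow> Q *v x \<in> V"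
  shows "sum_list Qs *v x \<in> V"
  using assms(2)
  by (induction Qs) (auto simp: matrix_vector_mult_add_rdistrib vec.subspace_0 vec.subspace_add assms(1))

text \<open>An eigenvector is the sum of its projections to the blocks, and each projection is again
  an eigenvector, because the blocks commute with \<open>A\<close>.\<close>

lemma span_block_eigenvectors:
  fixes A :: "complex^'n^'n"
  assumes A: "normal_matrix A" and Qs: "\<And>Q. Q \<in> set Qs \<Longrightarrow> orthogonal_reduction A Q" "sum_list Qs = mat 1"
  shows "vec.span {x. \<exists>c. A *v x = c *s x \<and> (\<exists>i<length Qs. Qs ! i *v x = x)} = UNIV" (is "vec.span ?S = UNIV")
proof -
  have "x \<in> vec.span ?S" if x: "x \<in> eigenvectors A" for x
  proof -
    obtain c where c: "A *v x = c *s x"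
      using x by (auto simp: eigenvectors_def)
    have "Q *v x \<in> vec.span ?S" if Q: "Q \<in> set Qs" for Q
    proof (rule vec.span_base)
      have "Q ** Q = Q" "A ** Q = Q ** A"
        using Qs(1)[OF Q] by (auto simp: orthogonal_reduction_def)
      then have "Q *v (Q *v x) = Q *v x" "A *v (Q *v x) = c *s (Q *v x)"
        using c by (auto simp: matrix_vector_mul_assoc) (simp add: matrix_vector_mul_assoc[symmetric] vec.scale)
      moreover obtain i where "i < length Qs" "Qs ! i = Q"
        using Q by (auto simp: in_set_conv_nth)
      ultimately show "Q *v x \<in> ?S"
        by auto
    qed
    then have "sum_list Qs *v x \<in> vec.span ?S"
      by (intro sum_list_matrix_vector_in_subspace) auto
    then show ?thesis
      by (simp add: Qs(2))
  qed
  then have "vec.span (eigenvectors A) \<subseteq> vec.span ?S"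
    by (intro vec.span_minimal) auto
  then show ?thesis
    using normal_matrix_span_eigenvectors[OF A] by auto
qed

lemma adapted_eigenbasis:
  fixes A :: "complex^'n^'n"
  assumes "normal_matrix A" "\<And>Q. Q \<in> set Qs \<Longrightarrow> orthogonal_reduction A Q" "sum_list Qs = mat 1"
  shows "\<exists>e l b. complex_basis e \<and>
    (\<forall>j. A *v e j = l j *s e j \<and> b j < length Qs \<and> Qs ! b j *v e j = e j)"
proof -
  obtain e where e: "complex_basis e" "range e \<subseteq> {x. \<exists>c. A *v x = c *s x \<and> (\<exists>i<length Qs. Qs ! i *v x = x)}"
    using complex_basis_in_spanning_set[OF span_block_eigenvectors[OF assms]] by blast
  then have "\<forall>j. \<exists>c i. A *v e j = c *s e j \<and> i < length Qs \<and> Qs ! i *v e j = e j"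
    by blast
  then obtain l b where "\<forall>j. A *v e j = l j *s e j \<and> b j < length Qs \<and> Qs ! b j *v e j = e j"
    by metis
  with e(1) show ?thesis by blast
qed

text \<open>In this way flatness of the deviation, a statement on matrices, becomes closeness of all
  eigenvalues of the block to one common value.\<close>

lemma block_eigenvalue_near_mean:
  assumes "A *v x = c *s x" "Q *v x = x" "x \<noteq> 0"
  shows "norm (c - block_mean A Q) \<le> entry_norm (block_deviation A Q)"
proof (rule eigenvalue_norm_le_entry_norm)
  show "block_deviation A Q *v x = (c - block_mean A Q) *s x"
    using assms by (simp add: block_deviation_def matrix_vector_mul_assoc[symmetric]
        matrix_vector_mult_diff_rdistrib mat_vector_mult vec.scale_left_diff_distrib)
qed (rule assms)

lemma eigenvalue_in_range:
  assumes "complex_basis e" "\<And>j. A *v e j = l j *s e j" "A *v x = c *s x" "x \<noteq> 0"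
  shows "c \<in> range l"
proof -
  have "poly (monic_charpoly A) c = 0"
    using eigenvalue_det_zero[OF assms(3,4)] by (simp add: det_mat_diff)
  then show ?thesis
    by (auto simp: monic_charpoly_eq_prod[OF assms(1,2)] poly_prod)
qed

text \<open>Every block carries an eigenvalue, since it is nonzero, and separated blocks carry
  different ones. The block with nonzero deviation contributes an additional one.\<close>

lemma card_eigenvalues_gt_blocks:
  fixes A :: "complex^'n^'n"
  assumes A: "normal_matrix A"
    and Qs: "\<And>Q. Q \<in> set Qs \<Longrightarrow> orthogonal_reduction A Q \<and> Q \<noteq> 0"
    and sep: "sorted_wrt (separated A) Qs"
    and nonscalar: "Q \<in> set Qs" "block_deviation A Q \<noteq> 0"
    and e: "complex_basis e" "\<And>j. A *v e j = l j *s e j"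
  shows "length Qs < card (range l)"
proof -
  define b where "b = length Qs"
  define has where "has i c \<longleftrightarrow> (\<exists>x. x \<noteq> 0 \<and> A *v x = c *s x \<and> Qs ! i *v x = x)" for i c
  have blockI: "has i c" if "i < b" "A *v v = c *s v" "Qs ! i *v v \<noteq> 0" for i v c
  proof -
    have Qi: "Qs ! i ** Qs ! i = Qs ! i" "A ** Qs ! i = Qs ! i ** A"
      using Qs[of "Qs ! i"] that(1) by (auto simp: orthogonal_reduction_def b_def)
    have "A *v (Qs ! i *v v) = Qs ! i *v (A *v v)"
      by (simp add: matrix_vector_mul_assoc Qi)
    also have "\<dots> = c *s (Qs ! i *v v)"
      by (simp add: that vec.scale)
    finally show ?thesis
      using that(3) Qi(1) unfolding has_def
      by (intro exI[of _ "Qs ! i *v v"]) (simp add: matrix_vector_mul_assoc)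
  qed
  have "\<exists>c. has i c" if i: "i < b" for i
  proof (rule ccontr)
    assume none: "\<nexists>c. has i c"
    have "Qs ! i = 0"
    proof (rule matrix_eq_on_span[OF normal_matrix_span_eigenvectors[OF A]])
      fix x assume "x \<in> eigenvectors A"
      then show "Qs ! i *v x = 0 *v x"
        using blockI[OF i] none by (auto simp: eigenvectors_def)
    qed
    then show False
      using Qs[OF nth_mem[of i Qs]] i by (simp add: b_def)
  qed
  then obtain c where c: "\<And>i. i < b \<Longrightarrow> has i (c i)"
    by metis
  have distinct: "a \<noteq> a'" if "has i a" "has i' a'" "i < i'" "i' < b" for i i' a a'
  proof
    assume "a = a'"
    have "separated A (Qs ! i) (Qs ! i')"
      using sorted_wrt_nth_less[OF sep that(3)] that(4) by (simp add: b_def)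
    with that \<open>a = a'\<close> show False
      unfolding separated_def has_def by blast
  qed
  obtain k where k: "k < b" "Qs ! k = Q"
    using nonscalar(1) by (auto simp: in_set_conv_nth b_def)
  \<comment> \<open>If \<open>c k\<close> were the only eigenvalue on the block, \<open>A\<close>
    would act there as this scalar; the mean would be \<open>c k\<close> and the deviation
    zero.\<close>
  have "\<exists>a. has k a \<and> a \<noteq> c k"
  proof (rule ccontr)
    assume only: "\<not> ?thesis"
    have AQ: "A ** Q = mat (c k) ** Q"
    proof (rule matrix_eq_on_span[OF normal_matrix_span_eigenvectors[OF A]])
      fix x assume "x \<in> eigenvectors A"
      then obtain d where d: "A *v x = d *s x"
        by (auto simp: eigenvectors_def)
      have "A ** Q = Q ** A"
        using Qs[OF nonscalar(1)] by (simp add: orthogonal_reduction_def)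
      then have *: "(A ** Q) *v x = d *s (Q *v x)"
        by (simp add: matrix_vector_mul_assoc[symmetric] d vec.scale)
      show "(A ** Q) *v x = (mat (c k) ** Q) *v x"
      proof (cases "Q *v x = 0")
        case True
        then show ?thesis
          using * by (simp add: matrix_vector_mul_assoc[symmetric])
      next
        case False
        then have "d = c k"
          using blockI[OF k(1) d] only k(2) by auto
        then show ?thesis
          using * by (simp add: matrix_vector_mul_assoc[symmetric] mat_vector_mult)
      qed
    qed
    have "trace Q \<noteq> 0"
      using Qs[OF nonscalar(1)] trace_orthogonal_projection_nonzero by blast
    then have "block_mean A Q = c k"
      by (simp add: block_mean_def AQ trace_mat_mult)
    then have "block_deviation A Q = 0"
      by (simp add: block_deviation_def matrix_mult_diff_right AQ)
    with nonscalar(2) show False by simp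
  qed
  then obtain a where a: "has k a" "a \<noteq> c k"
    by blast
  have "inj_on c {..<b}"
    using distinct c by (intro inj_onI) (metis lessThan_iff linorder_neqE_nat)
  moreover have "a \<notin> c ` {..<b}"
  proof
    assume "a \<in> c ` {..<b}"
    then obtain i where i: "i < b" "a = c i"
      by auto
    with a have "i \<noteq> k" by auto
    then show False
      using distinct[OF c[OF i(1)] a(1)] distinct[OF a(1) c[OF i(1)]] i k(1) by (metis linorder_neqE_nat)
  qed
  ultimately have "card (insert a (c ` {..<b})) = Suc b"
    by (simp add: card_image)
  moreover have "has i d \<Longrightarrow> d \<in> range l" for i d
    using eigenvalue_in_range[OF e] by (auto simp: has_def)
  then have "insert a (c ` {..<b}) \<subseteq> range l"
    using a c by blast
  then have "card (insert a (c ` {..<b})) \<le> card (range l)"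
    by (intro card_mono) auto
  ultimately show ?thesis
    by (simp add: b_def)
qed

text \<open>If there are more roots than blocks, two of them lie in the same block, so they are close.\<close>

lemma Delta_tilde_norm_le:
  fixes A :: "complex^'n^'n"
  assumes A: "normal_matrix A" and Qs: "\<And>Q. Q \<in> set Qs \<Longrightarrow> orthogonal_reduction A Q" "sum_list Qs = mat 1"
    and k: "length Qs < k" and K: "K \<ge> 1" "entry_norm A \<le> K"
  shows "norm (Delta_tilde k (monic_charpoly A)) \<le>
    2 ^ CARD('n) * ((2 * K)\<^sup>2) ^ (CARD('n))\<^sup>2 *
      (2 * (\<Sum>i<length Qs. entry_norm (block_deviation A (Qs ! i))))\<^sup>2"
proof -
  obtain e l b where e: "complex_basis e" "\<And>j. A *v e j = l j *s e j"
    and b: "\<And>j. b j < length Qs" "\<And>j. Qs ! b j *v e j = e j"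
    using adapted_eigenbasis[OF A Qs] by metis
  obtain js :: "'n list" where js: "distinct js" "set js = UNIV"
    using finite_distinct_list[of "UNIV :: 'n set"] by auto
  then have len: "length js = CARD('n)"
    by (metis distinct_card)
  define d where "d = (\<Sum>i<length Qs. entry_norm (block_deviation A (Qs ! i)))"
  have near: "norm (l j - block_mean A (Qs ! b j)) \<le> d" for j
  proof -
    have "norm (l j - block_mean A (Qs ! b j)) \<le> entry_norm (block_deviation A (Qs ! b j))"
      using e b complex_basis_nonzero[OF e(1)] by (intro block_eigenvalue_near_mean) auto
    also have "\<dots> \<le> d"
      unfolding d_def using b(1) by (intro member_le_sum) (auto simp: entry_norm_nonneg)
    finally show ?thesis .
  qed
  have "norm (root_discr_list k (map l js)) \<le>
      2 ^ length (map l js) * ((2 * K)\<^sup>2) ^ (length (map l js))\<^sup>2 * (2 * d)\<^sup>2"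
  proof (rule root_discr_list_norm_le[OF K(1)])
    fix i assume "i < length (map l js)"
    then show "norm (map l js ! i) \<le> K"
      using eigenvalue_norm_le_entry_norm[OF e(2) complex_basis_nonzero[OF e(1)]] K(2)
      by (auto intro: order_trans)
  next
    fix S assume S: "S \<subseteq> {..<length (map l js)}" "card S = k"
    have "\<not> inj_on (\<lambda>p. b (js ! p)) S"
    proof
      assume "inj_on (\<lambda>p. b (js ! p)) S"
      then have "card S \<le> card {..<length Qs}"
        using b(1) by (intro card_inj_on_le) auto
      with S(2) k show False by simp
    qed
    then obtain p q where pq: "p \<in> S" "q \<in> S" "p < q" "b (js ! p) = b (js ! q)"
      by (auto simp: inj_on_def) (metis linorder_neqE_nat)
    \<comment> \<open>Both eigenvalues lie within \<open>d\<close> of the mean of the block they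
      share.\<close>
    have "norm (l (js ! p) - l (js ! q)) \<le> 2 * d"
      using near[of "js ! p"] near[of "js ! q"] pq(4)
        norm_triangle_ineq4[of "l (js ! p) - block_mean A (Qs ! b (js ! p))" "l (js ! q) - block_mean A (Qs ! b (js ! q))"]
      by simp
    moreover have "p < length js" "q < length js"
      using pq S by auto
    ultimately show "\<exists>p\<in>S. \<exists>q\<in>S. p < q \<and> norm (map l js ! p - map l js ! q) \<le> 2 * d"
      using pq by (intro bexI[of _ p] bexI[of _ q]) auto
  qed
  then show ?thesis
    unfolding Delta_tilde_monic_charpoly[OF e js] length_map len d_def .
qed

lemma infinitely_flatI:
  fixes f :: "real \<Rightarrow> complex"
  assumes f: "continuous_on I f" and t0: "t\<^sub>0 \<in> I"
    and bound: "\<And>m. \<exists>C. \<forall>\<^sub>F t in germ_filter t\<^sub>0 I. norm (f t) \<le> C * \<bar>t - t\<^sub>0\<bar> ^ m"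
  shows "infinitely_flat I t\<^sub>0 f"
proof -
  have ex: "\<exists>\<delta>>0. \<exists>g. continuous_on (I \<inter> ball t\<^sub>0 \<delta>) g \<and>
      (\<forall>t\<in>I \<inter> ball t\<^sub>0 \<delta>. f t = of_real (t - t\<^sub>0) ^ p * g t)" for p
  proof -
    \<comment> \<open>The bound is used with one power more than \<open>p\<close>: then the quotient
      by the \<open>p\<close>-th power tends to 0 and is continuous with the value 0 at
      \<open>t\<^sub>0\<close>.\<close>
    obtain C where C: "\<forall>\<^sub>F t in germ_filter t\<^sub>0 I. norm (f t) \<le> C * \<bar>t - t\<^sub>0\<bar> ^ Suc p"
      using bound by blast
    obtain d where d: "d > 0" "\<And>t. t \<in> I \<inter> ball t\<^sub>0 d \<Longrightarrow> norm (f t) \<le> C * \<bar>t - t\<^sub>0\<bar> ^ Suc p"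
      using C by (auto simp: eventually_germ_filter)
    define g where "g t = (if t = t\<^sub>0 then 0 else f t / of_real (t - t\<^sub>0) ^ p)" for t
    have ft0: "f t\<^sub>0 = 0"
      using d(2)[of t\<^sub>0] t0 d(1) by simp
    have g_le: "norm (g t) \<le> C * \<bar>t - t\<^sub>0\<bar>" if "t \<in> I \<inter> ball t\<^sub>0 d" for t
    proof (cases "t = t\<^sub>0")
      case False
      have "norm (g t) = norm (f t) / \<bar>t - t\<^sub>0\<bar> ^ p"
        using False by (simp add: g_def norm_divide norm_power flip: of_real_diff)
      also have "\<dots> \<le> C * \<bar>t - t\<^sub>0\<bar> ^ Suc p / \<bar>t - t\<^sub>0\<bar> ^ p"
        using d(2)[OF that] by (intro divide_right_mono) auto
      finally show ?thesis
        using False by simp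
    qed (simp add: g_def)
    have "continuous (at t within I \<inter> ball t\<^sub>0 d) g" if t: "t \<in> I \<inter> ball t\<^sub>0 d" for t
    proof (cases "t = t\<^sub>0")
      case True
      have "(g \<longlongrightarrow> 0) (at t\<^sub>0 within I \<inter> ball t\<^sub>0 d)"
      proof (rule Lim_null_comparison)
        show "\<forall>\<^sub>F t in at t\<^sub>0 within I \<inter> ball t\<^sub>0 d. norm (g t) \<le> C * \<bar>t - t\<^sub>0\<bar>"
          using g_le by (auto simp: eventually_at_filter)
        show "((\<lambda>t. C * \<bar>t - t\<^sub>0\<bar>) \<longlongrightarrow> 0) (at t\<^sub>0 within I \<inter> ball t\<^sub>0 d)"
          by (auto intro!: tendsto_eq_intros)
      qed
      then show ?thesis
        by (simp add: True continuous_within g_def)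
    next
      case False
      have "continuous (at t within I \<inter> ball t\<^sub>0 d) (\<lambda>t. f t / of_real (t - t\<^sub>0) ^ p)"
        using t False continuous_on_subset[OF f, of "I \<inter> ball t\<^sub>0 d"]
        by (intro continuous_intros) (auto simp: continuous_on_eq_continuous_within)
      moreover have "\<forall>\<^sub>F s in at t within I \<inter> ball t\<^sub>0 d. f s / of_real (s - t\<^sub>0) ^ p = g s"
        unfolding eventually_at_filter using t1_space_nhds[OF False]
        by (rule eventually_mono) (simp add: g_def)
      ultimately show ?thesis
        using False by (auto simp: continuous_within g_def elim: Lim_transform_eventually)
    qed
    then have "continuous_on (I \<inter> ball t\<^sub>0 d) g"
      by (simp add: continuous_on_eq_continuous_within)
    moreover have "f t = of_real (t - t\<^sub>0) ^ p * g t" for t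
      using ft0 by (auto simp: g_def)
    ultimately show ?thesis
      using d(1) by blast
  qed
  define X where "X = {enat p | p. \<exists>\<delta>>0. \<exists>g. continuous_on (I \<inter> ball t\<^sub>0 \<delta>) g \<and>
      (\<forall>t\<in>I \<inter> ball t\<^sub>0 \<delta>. f t = of_real (t - t\<^sub>0) ^ p * g t)}"
  have X: "enat p \<in> X" for p
    using ex[of p] unfolding X_def by blast
  have "Sup X = \<infinity>"
  proof (rule ccontr)
    assume "Sup X \<noteq> \<infinity>"
    then obtain n where "Sup X = enat n"
      by auto
    with Sup_upper[OF X[of "Suc n"]] show False
      by simp
  qed
  then show ?thesis
    by (simp add: infinitely_flat_def vanishing_order_def X_def)
qed

locale generic_germ = regular_germs t\<^sub>0 I R A
  for t\<^sub>0 :: real and I :: "real set" and R and A :: "real \<Rightarrow> complex^'n^'n" +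
  assumes A_cont: "continuous_on I A" and A_normal_on: "\<And>t. t \<in> I \<Longrightarrow> normal_matrix (A t)"
    and generic: "generic_matrix_curve I A"
begin

lemma flat_bound:
  assumes "flat M"
  shows "\<exists>C. \<forall>\<^sub>F t in \<G>. entry_norm (M t) \<le> C * \<bar>t - t\<^sub>0\<bar> ^ m"
proof -
  obtain D where D: "regular D" "\<forall>\<^sub>F t in \<G>. M t = mat (of_real (t - t\<^sub>0) ^ m) ** D t"
    using assms by (auto simp: flat_def)
  have "((\<lambda>t. entry_norm (D t)) \<longlongrightarrow> entry_norm (D t\<^sub>0)) \<G>"
    unfolding entry_norm_def by (intro tendsto_sum tendsto_norm tendsto_entry regular_tendsto D)
  then have "\<forall>\<^sub>F t in \<G>. entry_norm (D t) < entry_norm (D t\<^sub>0) + 1"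
    by (rule order_tendstoD) simp
  with D(2) have "\<forall>\<^sub>F t in \<G>. entry_norm (M t) \<le> (entry_norm (D t\<^sub>0) + 1) * \<bar>t - t\<^sub>0\<bar> ^ m"
  proof eventually_elim
    case (elim t)
    have "entry_norm (M t) = \<bar>t - t\<^sub>0\<bar> ^ m * entry_norm (D t)"
      unfolding elim(1)
      by (simp add: entry_norm_def matrix_mult_mat_left norm_mult norm_power sum_distrib_left flip: of_real_diff)
    also have "\<dots> \<le> \<bar>t - t\<^sub>0\<bar> ^ m * (entry_norm (D t\<^sub>0) + 1)"
      using elim(2) by (intro mult_left_mono) auto
    finally show ?case
      by (simp add: mult.commute)
  qed
  then show ?thesis by blast
qed

text \<open>The induction descends from the dimension. Once all later discriminants have zero germ,
  the \<open>k\<close>-th one is subject to the genericity condition, which rules out that it is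
  infinitely flat with a nonzero germ.\<close>

lemma Delta_germ_zero:
  assumes flat: "\<And>k. b < k \<Longrightarrow> infinitely_flat I t\<^sub>0 (\<lambda>t. Delta_tilde k (monic_charpoly (A t)))"
    and k: "b < k" "k \<le> CARD('n)"
  shows "\<forall>\<^sub>F t in \<G>. Delta_tilde k (monic_charpoly (A t)) = 0"
  using k
proof (induction "CARD('n) - k" arbitrary: k rule: less_induct)
  case less
  define Z where "Z k \<longleftrightarrow> germ_zero I t\<^sub>0 (\<lambda>t. Delta_tilde k (monic_charpoly (A t)))" for k
  have Z: "Z k \<longleftrightarrow> (\<forall>\<^sub>F t in \<G>. Delta_tilde k (monic_charpoly (A t)) = 0)" for k
    by (simp add: Z_def germ_zero_def eventually_germ_filter)
  have "\<forall>j\<in>{k<..CARD('n)}. Z j"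
  proof
    fix j assume "j \<in> {k<..CARD('n)}"
    then show "Z j"
      unfolding Z using less.prems by (intro less.hyps) auto
  qed
  moreover have "k \<in> {1..CARD('n)}"
    using less.prems by auto
  ultimately have "\<not> Z k \<longrightarrow> \<not> infinitely_flat I t\<^sub>0 (\<lambda>t. Delta_tilde k (monic_charpoly (A t)))"
    using generic base unfolding generic_matrix_curve_def generic_poly_curve_def Z_def by blast
  then have "Z k"
    using flat less.prems by blast
  then show ?case
    by (simp add: Z)
qed

text \<open>Indices of the same block share literally the same eigenvalue function, and those of
  different blocks have eigenvalues that differ off \<open>t\<^sub>0\<close>. This dichotomy, the
  last clause, is what gluing rests on.\<close>

theorem local_eigenbasis:
  "\<exists>(ev :: 'n \<Rightarrow> real \<Rightarrow> complex) (v :: 'n \<Rightarrow> real \<Rightarrow> complex^'n).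
    (\<forall>j. ev j \<in> R \<and> (\<forall>i. (\<lambda>t. v j t $ i) \<in> R)) \<and>
    (\<forall>\<^sub>F t in \<G>. complex_basis (\<lambda>j. v j t) \<and> (\<forall>j. A t *v v j t = ev j t *s v j t)) \<and>
    (\<forall>i j. ev i = ev j \<or> (\<forall>\<^sub>F t in \<G>. t \<noteq> t\<^sub>0 \<longrightarrow> ev i t \<noteq> ev j t))"
proof -
  have "(mat 1 :: complex^'n^'n) \<noteq> 0"
    by (auto simp: vec_eq_iff mat_def)
  moreover have "orthogonal_reduction (A t) (mat 1)" for t
    by (simp add: orthogonal_reduction_def conj_transpose_mat)
  ultimately obtain Qs where Qs: "\<And>Q. Q \<in> set Qs \<Longrightarrow> flat_block Q"
      "\<forall>\<^sub>F t in \<G>. (\<Sum>Q\<leftarrow>Qs. Q t) = mat 1"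
      "\<forall>\<^sub>F t in \<G>. t \<noteq> t\<^sub>0 \<longrightarrow> sorted_wrt (\<lambda>Q Q'. separated (A t) (Q t) (Q' t)) Qs"
    using reduction_to_flat_blocks[of "\<lambda>t. mat 1"] by auto
  define b where "b = length Qs"
  define dev where "dev i t = block_deviation (A t) ((Qs ! i) t)" for i t
  have block: "flat_block (Qs ! i)" if "i < b" for i
    using Qs(1) that by (simp add: b_def)
  have red: "\<forall>\<^sub>F t in \<G>. \<forall>Q\<in>set Qs. orthogonal_reduction (A t) (Q t) \<and> Q t \<noteq> 0"
    using Qs(1) by (auto simp: flat_block_def eventually_conj_iff intro!: eventually_ball_finite regular_nonzero)
  define P where "P t = map (\<lambda>Q. Q t) Qs" for t
  have P: "length (P t) = b" "i < b \<Longrightarrow> P t ! i = (Qs ! i) t" for t i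
    by (auto simp: P_def b_def)
  have normalE: "\<forall>\<^sub>F t in \<G>. normal_matrix (A t)"
    using A_normal_on by (auto simp: eventually_inf_principal)
  have PE: "\<forall>\<^sub>F t in \<G>. (\<forall>Q\<in>set (P t). orthogonal_reduction (A t) Q \<and> Q \<noteq> 0) \<and> sum_list (P t) = mat 1 \<and>
      (t \<noteq> t\<^sub>0 \<longrightarrow> sorted_wrt (separated (A t)) (P t))"
    using red Qs(2,3) by eventually_elim (auto simp: P_def sorted_wrt_map)
  define d where "d t = (\<Sum>i<b. entry_norm (dev i t))" for t
  have d_bound: "\<exists>C. \<forall>\<^sub>F t in \<G>. d t \<le> C * \<bar>t - t\<^sub>0\<bar> ^ m" for m
  proof -
    have "\<forall>i\<in>{..<b}. \<exists>C. \<forall>\<^sub>F t in \<G>. entry_norm (dev i t) \<le> C * \<bar>t - t\<^sub>0\<bar> ^ m"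
      using block flat_bound by (auto simp: flat_block_def dev_def)
    then obtain C where "\<forall>i\<in>{..<b}. \<forall>\<^sub>F t in \<G>. entry_norm (dev i t) \<le> C i * \<bar>t - t\<^sub>0\<bar> ^ m"
      by metis
    then have "\<forall>\<^sub>F t in \<G>. \<forall>i\<in>{..<b}. entry_norm (dev i t) \<le> C i * \<bar>t - t\<^sub>0\<bar> ^ m"
      by (intro eventually_ball_finite) auto
    then have "\<forall>\<^sub>F t in \<G>. d t \<le> (\<Sum>i<b. C i) * \<bar>t - t\<^sub>0\<bar> ^ m"
      by (rule eventually_mono) (auto simp: d_def sum_distrib_right intro!: sum_mono)
    then show ?thesis by blast
  qed
  have flat: "infinitely_flat I t\<^sub>0 (\<lambda>t. Delta_tilde k (monic_charpoly (A t)))" if k: "b < k" for k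
  proof (rule infinitely_flatI)
    show "continuous_on I (\<lambda>t. Delta_tilde k (monic_charpoly (A t)))"
      using A_cont A_normal_on by (rule continuous_on_Delta_tilde)
    fix m
    define K where "K = entry_norm (A t\<^sub>0) + 1"
    define N where "N = 2 ^ CARD('n) * ((2 * K)\<^sup>2) ^ (CARD('n))\<^sup>2"
    have K: "K \<ge> 1"
      using entry_norm_nonneg[of "A t\<^sub>0"] by (simp add: K_def)
    have "((\<lambda>t. entry_norm (A t)) \<longlongrightarrow> entry_norm (A t\<^sub>0)) \<G>"
      unfolding entry_norm_def by (intro tendsto_sum tendsto_norm tendsto_entry regular_tendsto regular_A)
    then have KE: "\<forall>\<^sub>F t in \<G>. entry_norm (A t) < K"
      by (rule order_tendstoD) (simp add: K_def)
    obtain C where C: "\<forall>\<^sub>F t in \<G>. d t \<le> C * \<bar>t - t\<^sub>0\<bar> ^ m"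
      using d_bound by blast
    \<comment> \<open>The estimate of the discriminant is quadratic in \<open>d\<close>. One factor
      is bounded with exponent 0, so the other one, with exponent \<open>m\<close>,
      suffices.\<close>
    obtain C' where C': "\<forall>\<^sub>F t in \<G>. d t \<le> C' * \<bar>t - t\<^sub>0\<bar> ^ 0"
      using d_bound by blast
    have "\<forall>\<^sub>F t in \<G>. norm (Delta_tilde k (monic_charpoly (A t))) \<le> (N * 4 * C' * C) * \<bar>t - t\<^sub>0\<bar> ^ m"
      using normalE PE KE C C'
    proof eventually_elim
      case (elim t)
      have dd: "(\<Sum>i<length (P t). entry_norm (block_deviation (A t) (P t ! i))) = d t"
        unfolding d_def P(1) by (intro sum.cong) (auto simp: P dev_def)
      have d0: "d t \<ge> 0"
        by (auto simp: d_def intro: sum_nonneg entry_norm_nonneg)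
      have "norm (Delta_tilde k (monic_charpoly (A t))) \<le> N * (2 * d t)\<^sup>2"
        using Delta_tilde_norm_le[of "A t" "P t" k K] elim k K unfolding dd N_def by (auto simp: P)
      also have "(2 * d t)\<^sup>2 = 4 * (d t * d t)"
        by (simp add: power2_eq_square)
      also have "N * (4 * (d t * d t)) \<le> N * (4 * (C' * (C * \<bar>t - t\<^sub>0\<bar> ^ m)))"
        using elim(4,5) d0 by (intro mult_left_mono mult_mono) (auto simp: N_def)
      finally show ?case
        by (simp only: mult.assoc)
    qed
    then show "\<exists>C. \<forall>\<^sub>F t in \<G>. norm (Delta_tilde k (monic_charpoly (A t))) \<le> C * \<bar>t - t\<^sub>0\<bar> ^ m"
      by blast
  qed (rule base)
  have "\<forall>\<^sub>F t in \<G>. \<forall>k\<in>{b<..CARD('n)}. Delta_tilde k (monic_charpoly (A t)) = 0"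
    using Delta_germ_zero[OF flat] by (intro eventually_ball_finite) auto
  \<comment> \<open>A nonscalar block would give more than \<open>b\<close> distinct eigenvalues at
    \<open>t\<close>, while the discriminant indexed by their exact number does not vanish.\<close>
  with normalE PE have "\<forall>\<^sub>F t in \<G>. t \<noteq> t\<^sub>0 \<longrightarrow> (\<forall>Q\<in>set (P t). block_deviation (A t) Q = 0)"
  proof eventually_elim
    case (elim t)
    show ?case
    proof (intro impI ballI, rule ccontr)
      fix Q assume t: "t \<noteq> t\<^sub>0" and Q: "Q \<in> set (P t)" "block_deviation (A t) Q \<noteq> 0"
      obtain e l where e: "complex_basis e" "\<And>j. A t *v e j = l j *s e j"
        using normal_matrix_exists_eigenbasis[OF elim(1)] by blast
      obtain js :: "'n list" where js: "distinct js" "set js = UNIV"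
        using finite_distinct_list[of "UNIV :: 'n set"] by auto
      have "b < card (range l)"
        using card_eigenvalues_gt_blocks[OF elim(1) _ _ Q e] elim(2) t by (simp add: P)
      moreover have "card (range l) \<le> CARD('n)"
        by (rule card_image_le) simp
      moreover have "Delta_tilde (card (range l)) (monic_charpoly (A t)) \<noteq> 0"
        using root_discr_list_card_nonzero[of "map l js"]
        by (simp add: Delta_tilde_monic_charpoly[OF e js] js)
      ultimately show False
        using elim(3) by auto
    qed
  qed
  then have off: "\<forall>\<^sub>F t in \<G>. t \<noteq> t\<^sub>0 \<longrightarrow> dev i t = 0" if "i < b" for i
    by (rule eventually_mono) (use that in \<open>auto simp: P_def dev_def b_def\<close>)
  have tr: "trace ((Qs ! i) t\<^sub>0) \<noteq> 0" "regular (Qs ! i)" if "i < b" for i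
    using block[OF that] trace_orthogonal_projection_nonzero
    by (auto simp: flat_block_def dest!: eventually_base)
  \<comment> \<open>The count of eigenvalues says nothing at \<open>t\<^sub>0\<close>, where blocks
    may share an eigenvalue; the deviations vanish there by continuity.\<close>
  have "\<forall>\<^sub>F t in \<G>. \<forall>i\<in>{..<b}. dev i t = 0"
  proof (rule eventually_ball_finite[OF finite_lessThan], rule ballI)
    fix i assume "i \<in> {..<b}"
    then have "i < b" by simp
    then show "\<forall>\<^sub>F t in \<G>. dev i t = 0"
      using zero_at_base[OF regular_tendsto[OF regular_block_deviation[OF tr(2,1)]]] off[of i]
      unfolding dev_def by blast
  qed
  then have scalar: "\<forall>\<^sub>F t in \<G>. \<forall>i\<in>{..<b}. A t ** (Qs ! i) t = mat (block_mean (A t) ((Qs ! i) t)) ** (Qs ! i) t"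
    by (rule eventually_mono) (simp add: dev_def block_deviation_def matrix_mult_diff_right)
  \<comment> \<open>Separation of the blocks may fail at \<open>t\<^sub>0\<close>, but an adapted
    eigenbasis requires only that the projections reduce \<open>A\<close> and add up to the
    identity.\<close>
  have "\<exists>e l c. complex_basis e \<and>
      (\<forall>j. A t\<^sub>0 *v e j = l j *s e j \<and> c j < length (P t\<^sub>0) \<and> P t\<^sub>0 ! c j *v e j = e j)"
    using eventually_base[OF PE] by (intro adapted_eigenbasis eventually_base[OF normalE]) auto
  then obtain e c where ec: "complex_basis e" "\<And>j. c j < length (P t\<^sub>0)" "\<And>j. P t\<^sub>0 ! c j *v e j = e j"
    by blast
  then have e: "complex_basis e" "\<And>j. c j < b" "\<And>j. (Qs ! c j) t\<^sub>0 *v e j = e j"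
    by (auto simp: P)
  define ev where "ev j = (\<lambda>t. block_mean (A t) ((Qs ! c j) t))" for j
  define v where "v j = (\<lambda>t. (Qs ! c j) t *v e j)" for j
  have evR: "ev j \<in> R" for j
    unfolding ev_def using tr[OF e(2)] by (intro block_mean_in_R)
  have vR: "(\<lambda>t. v j t $ i) \<in> R" for i j
    using tr(2)[OF e(2)[of j]] unfolding v_def matrix_vector_mult_def
    by (auto simp: regular_def intro!: sum_in_R)
  have "((\<lambda>t. det (\<chi> i j. v j t $ i)) \<longlongrightarrow> det (\<chi> i j. v j t\<^sub>0 $ i)) \<G>"
    by (rule tendsto_det) (simp add: tendsto[OF vR])
  moreover have "det (\<chi> i j. v j t\<^sub>0 $ i) \<noteq> 0"
    using e(1) by (simp add: v_def e(3) complex_basis_iff_det[symmetric])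
  ultimately have basis: "\<forall>\<^sub>F t in \<G>. complex_basis (\<lambda>j. v j t)"
    unfolding complex_basis_iff_det by (rule tendsto_imp_eventually_ne)
  have eigen: "\<forall>\<^sub>F t in \<G>. \<forall>j. A t *v v j t = ev j t *s v j t"
    using scalar
  proof eventually_elim
    case (elim t)
    show ?case
    proof
      fix j
      have "A t ** (Qs ! c j) t = mat (ev j t) ** (Qs ! c j) t"
        using elim e(2) by (simp add: ev_def)
      then show "A t *v v j t = ev j t *s v j t"
        unfolding v_def matrix_vector_mul_assoc by (simp add: matrix_vector_mul_assoc[symmetric] mat_vector_mult)
    qed
  qed
  have "ev i = ev j \<or> (\<forall>\<^sub>F t in \<G>. t \<noteq> t\<^sub>0 \<longrightarrow> ev i t \<noteq> ev j t)" for i j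
  proof (cases "c i = c j")
    case True
    then show ?thesis
      by (simp add: ev_def)
  next
    case False
    have "\<forall>\<^sub>F t in \<G>. t \<noteq> t\<^sub>0 \<longrightarrow> ev i t \<noteq> ev j t"
      using basis eigen PE
    proof eventually_elim
      case (elim t)
      have ne: "v i t \<noteq> 0" "v j t \<noteq> 0"
        using complex_basis_nonzero[OF elim(1)] by blast+
      have fixed: "P t ! c j *v v j t = v j t" for j
        using elim(3) e(2)[of j]
        by (simp add: v_def P matrix_vector_mul_assoc orthogonal_reduction_def)
          (metis P(1,2) nth_mem)
      show ?case
      proof (intro impI notI)
        assume t: "t \<noteq> t\<^sub>0" and eq: "ev i t = ev j t"
        have s: "sorted_wrt (separated (A t)) (P t)"
          using elim(3) t by blast
        have "separated (A t) (P t ! c i) (P t ! c j) \<or> separated (A t) (P t ! c j) (P t ! c i)"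
          using sorted_wrt_nth_less[OF s, of "c i" "c j"] sorted_wrt_nth_less[OF s, of "c j" "c i"] False e(2)
          by (auto simp: P neq_iff)
        then show False
          using fixed[of i] fixed[of j] elim(2) ne eq unfolding separated_def by metis
      qed
    qed
    then show ?thesis ..
  qed
  moreover have "\<forall>\<^sub>F t in \<G>. complex_basis (\<lambda>j. v j t) \<and> (\<forall>j. A t *v v j t = ev j t *s v j t)"
    using basis eigen by eventually_elim blast
  ultimately show ?thesis
    using evR vR by (intro exI[of _ ev] exI[of _ v]) blast
qed

end

section \<open>Smooth functions on intervals\<close>

lemma smooth_on_derivative:
  assumes "smooth_on S f"
  shows "\<exists>f'. smooth_on S f' \<and> (\<forall>t\<in>S. (f has_vector_derivative f' t) (at t within S))"
proof -
  obtain F where F: "\<And>t. t \<in> S \<Longrightarrow> F 0 t = f t"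
      "\<And>k t. t \<in> S \<Longrightarrow> (F k has_vector_derivative F (Suc k) t) (at t within S)"
    using assms by (auto simp: smooth_on_def)
  have "smooth_on S (F 1)"
    unfolding smooth_on_def using F(2) by (intro exI[of _ "\<lambda>k. F (Suc k)"]) auto
  moreover have "(f has_vector_derivative F 1 t) (at t within S)" if "t \<in> S" for t
    by (rule has_vector_derivative_transform[OF that, of f "F 0"]) (use F that in auto)
  ultimately show ?thesis by blast
qed

text \<open>Smoothness is the greatest class of functions closed under differentiation.\<close>

lemma smooth_on_coinduct:
  assumes "f \<in> X"
    and X: "\<And>g. g \<in> X \<Longrightarrow> \<exists>g'\<in>X. \<forall>t\<in>S. (g has_vector_derivative g' t) (at t within S)"
  shows "smooth_on S f"
proof -
  obtain D where D: "\<And>g. g \<in> X \<Longrightarrow> D g \<in> X \<and> (\<forall>t\<in>S. (g has_vector_derivative D g t) (at t within S))"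
    using X by metis
  have "(D ^^ k) f \<in> X" for k
    by (induction k) (use assms(1) D in auto)
  then show ?thesis
    unfolding smooth_on_def using D by (intro exI[of _ "\<lambda>k. (D ^^ k) f"]) auto
qed

lemma smooth_on_subset:
  assumes "smooth_on S f" "T \<subseteq> S"
  shows "smooth_on T f"
proof -
  obtain F where F: "\<And>t. t \<in> S \<Longrightarrow> F 0 t = f t"
      "\<And>k t. t \<in> S \<Longrightarrow> (F k has_vector_derivative F (Suc k) t) (at t within S)"
    using assms(1) by (auto simp: smooth_on_def)
  have "\<And>k t. t \<in> T \<Longrightarrow> (F k has_vector_derivative F (Suc k) t) (at t within T)"
    using F(2) assms(2) by (blast intro: has_vector_derivative_within_subset)
  then show ?thesis
    unfolding smooth_on_def using F(1) assms(2) by (intro exI[of _ F]) blast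
qed

lemma smooth_on_cong: "smooth_on S f \<Longrightarrow> (\<And>t. t \<in> S \<Longrightarrow> f t = g t) \<Longrightarrow> smooth_on S g"
  by (auto simp: smooth_on_def)

lemma smooth_on_const: "smooth_on S (\<lambda>t. c)"
  unfolding smooth_on_def by (intro exI[of _ "\<lambda>k t. if k = 0 then c else 0"]) auto

lemma smooth_on_imp_continuous_on:
  assumes "smooth_on S f"
  shows "continuous_on S f"
proof -
  obtain f' where "\<And>t. t \<in> S \<Longrightarrow> (f has_vector_derivative f' t) (at t within S)"
    using smooth_on_derivative[OF assms] by blast
  then show ?thesis
    unfolding continuous_on_eq_continuous_within by (blast intro: has_vector_derivative_continuous)
qed

lemma smooth_on_bounded_linear:
  assumes "bounded_linear L" "smooth_on S f"
  shows "smooth_on S (\<lambda>t. L (f t))"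
proof -
  obtain F where F: "\<And>t. t \<in> S \<Longrightarrow> F 0 t = f t"
      "\<And>k t. t \<in> S \<Longrightarrow> (F k has_vector_derivative F (Suc k) t) (at t within S)"
    using assms(2) by (auto simp: smooth_on_def)
  then show ?thesis
    unfolding smooth_on_def
    by (intro exI[of _ "\<lambda>k t. L (F k t)"]) (auto intro: bounded_linear.has_vector_derivative[OF assms(1)])
qed

lemma smooth_on_sum:
  assumes "finite X" "\<And>x. x \<in> X \<Longrightarrow> smooth_on S (f x)"
  shows "smooth_on S (\<lambda>t. \<Sum>x\<in>X. f x t)"
proof -
  have "\<forall>x\<in>X. \<exists>F. (\<forall>t\<in>S. F 0 t = f x t) \<and> (\<forall>k. \<forall>t\<in>S. (F k has_vector_derivative F (Suc k) t) (at t within S))"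
    using assms(2) by (simp add: smooth_on_def)
  from bchoice[OF this] obtain F where F: "\<And>x t. x \<in> X \<Longrightarrow> t \<in> S \<Longrightarrow> F x 0 t = f x t"
      "\<And>x k t. x \<in> X \<Longrightarrow> t \<in> S \<Longrightarrow> (F x k has_vector_derivative F x (Suc k) t) (at t within S)"
    by blast
  then show ?thesis
    unfolding smooth_on_def
    by (intro exI[of _ "\<lambda>k t. \<Sum>x\<in>X. F x k t"]) (auto intro!: has_vector_derivative_sum)
qed

section \<open>Smooth dependence of integrals on a parameter\<close>

lemma has_vector_derivative_inverse:
  fixes f :: "real \<Rightarrow> complex"
  assumes "(f has_vector_derivative f') (at t within S)" "f t \<noteq> 0"
  shows "((\<lambda>t. inverse (f t)) has_vector_derivative (- 1) * (f' * (inverse (f t) * inverse (f t)))) (at t within S)"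
  using Deriv.has_derivative_inverse[OF assms(2) assms(1)[unfolded has_vector_derivative_def]]
  by (simp add: has_vector_derivative_def mult_ac)

text \<open>Repeated differentiation under the integral sign: as \<open>X\<close> is closed under
  the derivative in the parameter, so is the class of the integrals of its members, and coinduction
  applies to that class.\<close>

lemma smooth_on_integral:
  fixes X :: "(real \<times> real \<Rightarrow> complex) set"
  assumes S: "convex S" and g: "g \<in> X"
    and cont: "\<And>h. h \<in> X \<Longrightarrow> continuous_on (S \<times> cbox a b) h"
    and deriv: "\<And>h. h \<in> X \<Longrightarrow> \<exists>h'\<in>X. \<forall>t\<in>S. \<forall>u\<in>cbox a b.
      ((\<lambda>t. h (t, u)) has_vector_derivative h' (t, u)) (at t within S)"
  shows "smooth_on S (\<lambda>t. integral (cbox a b) (\<lambda>u. g (t, u)))"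
proof (rule smooth_on_coinduct)
  define Y where "Y = (\<lambda>h t. integral (cbox a b) (\<lambda>u. h (t, u))) ` X"
  show "(\<lambda>t. integral (cbox a b) (\<lambda>u. g (t, u))) \<in> Y"
    using g by (auto simp: Y_def)
  fix k assume "k \<in> Y"
  then obtain h where h: "h \<in> X" "k = (\<lambda>t. integral (cbox a b) (\<lambda>u. h (t, u)))"
    by (auto simp: Y_def)
  obtain h' where h': "h' \<in> X" "\<And>t u. t \<in> S \<Longrightarrow> u \<in> cbox a b \<Longrightarrow>
      ((\<lambda>t. h (t, u)) has_vector_derivative h' (t, u)) (at t within S)"
    using deriv[OF h(1)] by blast
  have "(k has_vector_derivative integral (cbox a b) (\<lambda>u. h' (t, u))) (at t within S)" if t: "t \<in> S" for t
    unfolding h(2)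
  proof (rule leibniz_rule_vector_derivative[OF h'(2) _ _ t S])
    fix s assume "s \<in> S"
    then have "continuous_on (cbox a b) (\<lambda>u. h (s, u))"
      by (intro continuous_on_compose2[OF cont[OF h(1)]] continuous_intros) auto
    then show "(\<lambda>u. h (s, u)) integrable_on cbox a b"
      by (rule integrable_continuous)
  next
    show "continuous_on (S \<times> cbox a b) (\<lambda>(t, u). h' (t, u))"
      using cont[OF h'(1)] by (simp add: case_prod_unfold)
  qed auto
  then show "\<exists>k'\<in>Y. \<forall>t\<in>S. (k has_vector_derivative k' t) (at t within S)"
    using h'(1) unfolding Y_def
    by (intro bexI[of _ "\<lambda>t. integral (cbox a b) (\<lambda>u. h' (t, u))"]) auto
qed

text \<open>Smoothness in \<open>t\<close> together with joint continuity of all derivatives is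
  awkward to carry around for a general function of two variables. The resolvent integrand is built
  by ring operations and one inverse from functions of \<open>t\<close> or of \<open>u\<close>
  alone, and the class so generated is closed under differentiation in \<open>t\<close>, by
  induction on the generation.\<close>

inductive_set parametric_algebra :: "real set \<Rightarrow> real set \<Rightarrow> (real \<times> real \<Rightarrow> complex) set" for S K where
  smooth: "smooth_on S f \<Longrightarrow> (\<lambda>p. f (fst p)) \<in> parametric_algebra S K"
| continuous: "continuous_on K c \<Longrightarrow> (\<lambda>p. c (snd p)) \<in> parametric_algebra S K"
| add: "f \<in> parametric_algebra S K \<Longrightarrow> g \<in> parametric_algebra S K \<Longrightarrow> (\<lambda>p. f p + g p) \<in> parametric_algebra S K"
| mult: "f \<in> parametric_algebra S K \<Longrightarrow> g \<in> parametric_algebra S K \<Longrightarrow> (\<lambda>p. f p * g p) \<in> parametric_algebra S K"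
| inverse: "f \<in> parametric_algebra S K \<Longrightarrow> (\<And>p. p \<in> S \<times> K \<Longrightarrow> f p \<noteq> 0) \<Longrightarrow>
    (\<lambda>p. inverse (f p)) \<in> parametric_algebra S K"

lemma continuous_on_parametric_algebra:
  "g \<in> parametric_algebra S K \<Longrightarrow> continuous_on (S \<times> K) g"
proof (induction rule: parametric_algebra.induct)
  case (smooth f)
  show ?case
    by (rule continuous_on_compose2[OF smooth_on_imp_continuous_on[OF smooth] continuous_on_fst[OF continuous_on_id]]) auto
next
  case (continuous c)
  show ?case
    by (rule continuous_on_compose2[OF continuous continuous_on_snd[OF continuous_on_id]]) auto
qed (auto intro: continuous_on_add continuous_on_mult continuous_on_inverse)

lemma parametric_algebra_derivative:
  "g \<in> parametric_algebra S K \<Longrightarrow> \<exists>g'\<in>parametric_algebra S K. \<forall>t\<in>S. \<forall>u\<in>K.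
    ((\<lambda>t. g (t, u)) has_vector_derivative g' (t, u)) (at t within S)"
proof (induction rule: parametric_algebra.induct)
  case (smooth f)
  obtain f' where "smooth_on S f'" "\<forall>t\<in>S. (f has_vector_derivative f' t) (at t within S)"
    using smooth_on_derivative[OF smooth] by blast
  then show ?case
    by (intro bexI[of _ "\<lambda>p. f' (fst p)"]) (auto intro: parametric_algebra.smooth)
next
  case (continuous c)
  show ?case
    by (intro bexI[of _ "\<lambda>p. 0"]) (auto intro: parametric_algebra.continuous)
next
  case (add f g)
  then obtain f' g' where f': "f' \<in> parametric_algebra S K" "\<And>t u. t \<in> S \<Longrightarrow> u \<in> K \<Longrightarrow>
        ((\<lambda>t. f (t, u)) has_vector_derivative f' (t, u)) (at t within S)"
    and g': "g' \<in> parametric_algebra S K" "\<And>t u. t \<in> S \<Longrightarrow> u \<in> K \<Longrightarrow>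
        ((\<lambda>t. g (t, u)) has_vector_derivative g' (t, u)) (at t within S)"
    by blast
  then show ?case
    by (intro bexI[of _ "\<lambda>p. f' p + g' p"]) (auto intro: has_vector_derivative_add parametric_algebra.add)
next
  case (mult f g)
  then obtain f' g' where f': "f' \<in> parametric_algebra S K" "\<And>t u. t \<in> S \<Longrightarrow> u \<in> K \<Longrightarrow>
        ((\<lambda>t. f (t, u)) has_vector_derivative f' (t, u)) (at t within S)"
    and g': "g' \<in> parametric_algebra S K" "\<And>t u. t \<in> S \<Longrightarrow> u \<in> K \<Longrightarrow>
        ((\<lambda>t. g (t, u)) has_vector_derivative g' (t, u)) (at t within S)"
    by blast
  have "(\<lambda>p. f p * g' p + f' p * g p) \<in> parametric_algebra S K"
    using mult f' g' by (intro parametric_algebra.add parametric_algebra.mult)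
  moreover have "((\<lambda>t. f (t, u) * g (t, u)) has_vector_derivative
      f (t, u) * g' (t, u) + f' (t, u) * g (t, u)) (at t within S)"
    if "t \<in> S" "u \<in> K" for t u
    using that by (intro has_vector_derivative_mult f'(2) g'(2))
  ultimately show ?case
    by (intro bexI[of _ "\<lambda>p. f p * g' p + f' p * g p"]) blast+
next
  case (inverse f)
  then obtain f' where f': "f' \<in> parametric_algebra S K" "\<And>t u. t \<in> S \<Longrightarrow> u \<in> K \<Longrightarrow>
        ((\<lambda>t. f (t, u)) has_vector_derivative f' (t, u)) (at t within S)"
    by blast
  have "(\<lambda>p. (- 1) * (f' p * (inverse (f p) * inverse (f p)))) \<in> parametric_algebra S K"
    using inverse f'
    by (intro parametric_algebra.mult parametric_algebra.inverse parametric_algebra.smooth[OF smooth_on_const])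
  moreover have "((\<lambda>t. inverse (f (t, u))) has_vector_derivative
      (- 1) * (f' (t, u) * (inverse (f (t, u)) * inverse (f (t, u))))) (at t within S)"
    if "t \<in> S" "u \<in> K" for t u
    using that by (intro has_vector_derivative_inverse f'(2) inverse(2)) auto
  ultimately show ?case
    by (intro bexI[of _ "\<lambda>p. (- 1) * (f' p * (inverse (f p) * inverse (f p)))"]) blast+
qed

lemma smooth_on_parametric_algebra:
  assumes "g \<in> parametric_algebra S {u}"
  shows "smooth_on S (\<lambda>t. g (t, u))"
proof (rule smooth_on_coinduct)
  show "(\<lambda>t. g (t, u)) \<in> (\<lambda>g t. g (t, u)) ` parametric_algebra S {u}"
    using assms by blast
  fix h assume "h \<in> (\<lambda>g t. g (t, u)) ` parametric_algebra S {u}"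
  then obtain g where g: "g \<in> parametric_algebra S {u}" "h = (\<lambda>t. g (t, u))"
    by blast
  then show "\<exists>h'\<in>(\<lambda>g t. g (t, u)) ` parametric_algebra S {u}. \<forall>t\<in>S. (h has_vector_derivative h' t) (at t within S)"
    using parametric_algebra_derivative[OF g(1)] by auto
qed

text \<open>Sums, products and inverses lie in the parametric algebra over a single point
  \<open>u\<close>. Its closure under differentiation replaces explicit formulas for higher
  derivatives.\<close>

lemma smooth_on_algebra:
  fixes f g :: "real \<Rightarrow> complex"
  assumes f: "smooth_on S f"
  shows smooth_on_add: "smooth_on S g \<Longrightarrow> smooth_on S (\<lambda>t. f t + g t)"
    and smooth_on_mult: "smooth_on S g \<Longrightarrow> smooth_on S (\<lambda>t. f t * g t)"
    and smooth_on_inverse: "(\<And>t. t \<in> S \<Longrightarrow> f t \<noteq> 0) \<Longrightarrow> smooth_on S (\<lambda>t. inverse (f t))"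
proof -
  note gen = parametric_algebra.smooth[of S _ "{0}"]
  show "smooth_on S (\<lambda>t. f t + g t)" "smooth_on S (\<lambda>t. f t * g t)" if g: "smooth_on S g"
    using smooth_on_parametric_algebra[OF parametric_algebra.add[OF gen[OF f] gen[OF g]]]
      smooth_on_parametric_algebra[OF parametric_algebra.mult[OF gen[OF f] gen[OF g]]] by simp_all
  show "smooth_on S (\<lambda>t. inverse (f t))" if "\<And>t. t \<in> S \<Longrightarrow> f t \<noteq> 0"
    using smooth_on_parametric_algebra[OF parametric_algebra.inverse[OF gen[OF f]]] that by auto
qed

text \<open>The function class is left abstract so that the same argument serves the parametric
  algebra of smooth functions and the holomorphic families.\<close>

lemma det_in_algebra:
  fixes X :: "('a \<Rightarrow> complex) set" and M :: "'a \<Rightarrow> complex^'n^'n"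
  assumes const: "\<And>c. (\<lambda>x. c) \<in> X"
    and add: "\<And>f g. f \<in> X \<Longrightarrow> g \<in> X \<Longrightarrow> (\<lambda>x. f x + g x) \<in> X"
    and mult: "\<And>f g. f \<in> X \<Longrightarrow> g \<in> X \<Longrightarrow> (\<lambda>x. f x * g x) \<in> X"
    and M: "\<And>i j. (\<lambda>x. M x $ i $ j) \<in> X"
  shows "(\<lambda>x. det (M x)) \<in> X"
proof -
  have prod: "(\<lambda>x. \<Prod>i\<in>T. h i x) \<in> X" if "\<And>i. h i \<in> X" for T :: "'n set" and h
    by (induction T rule: infinite_finite_induct) (simp_all add: const mult that)
  have sum: "(\<lambda>x. \<Sum>i\<in>T. h i x) \<in> X" if "\<And>i. h i \<in> X" for T :: "('n \<Rightarrow> 'n) set" and h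
    by (induction T rule: infinite_finite_induct) (simp_all add: const add that)
  show ?thesis
    unfolding det_def by (intro sum mult const prod M)
qed

text \<open>Division is written as multiplication by an inverse, so that the integrand lies in every algebra
  of functions that contains the matrix entries and the inverse determinant.\<close>

definition circle_integrand :: "complex \<Rightarrow> real \<Rightarrow> complex^'n^'n \<Rightarrow> 'n \<Rightarrow> 'n \<Rightarrow> real \<Rightarrow> complex" where
  "circle_integrand w r B i j u =
     det (\<chi> k l. if l = i then axis j 1 $ k else (mat (circlepath w r u) - B) $ k $ l) *
     inverse (det (mat (circlepath w r u) - B)) * vector_derivative (circlepath w r) (at u)"

lemma contour_integral_resolvent_entry:
  "contour_integral (circlepath w r) (resolvent_entry B i j) = integral (cbox 0 1) (circle_integrand w r B i j)"
  unfolding contour_integral_integral circle_integrand_def resolvent_entry_def divide_inverse by simp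

text \<open>Inversion is asked for the one determinant that occurs: both classes of interest admit
  inverses only of functions without zeros, and this is known from the absence of eigenvalues on the
  circle.\<close>

lemma circle_integrand_in_algebra:
  fixes X :: "('a \<Rightarrow> complex) set" and B :: "'a \<Rightarrow> complex^'n^'n"
  assumes const: "\<And>c. (\<lambda>x. c) \<in> X"
    and add: "\<And>f g. f \<in> X \<Longrightarrow> g \<in> X \<Longrightarrow> (\<lambda>x. f x + g x) \<in> X"
    and mult: "\<And>f g. f \<in> X \<Longrightarrow> g \<in> X \<Longrightarrow> (\<lambda>x. f x * g x) \<in> X"
    and B: "\<And>i j. (\<lambda>x. B x $ i $ j) \<in> X"
    and u: "(\<lambda>x. circlepath w r (u x)) \<in> X" "(\<lambda>x. vector_derivative (circlepath w r) (at (u x))) \<in> X"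
    and inv: "(\<lambda>x. det (mat (circlepath w r (u x)) - B x)) \<in> X \<Longrightarrow>
      (\<lambda>x. inverse (det (mat (circlepath w r (u x)) - B x))) \<in> X"
  shows "(\<lambda>x. circle_integrand w r (B x) i j (u x)) \<in> X"
proof -
  have entry: "(\<lambda>x. (mat (circlepath w r (u x)) - B x) $ k $ l) \<in> X" for k l
  proof -
    have "(\<lambda>x. (mat (circlepath w r (u x)) :: complex^'n^'n) $ k $ l) \<in> X"
      using u(1) const by (cases "k = l") (auto simp: mat_def)
    then show ?thesis
      using add[OF _ mult[OF const[of "- 1"] B]] by simp
  qed
  have entry': "(\<lambda>x. (if l = i then axis j 1 $ k else (mat (circlepath w r (u x)) - B x) $ k $ l)) \<in> X" for k l
    using entry const by (cases "l = i") auto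
  have "(\<lambda>x. det (mat (circlepath w r (u x)) - B x)) \<in> X"
    by (rule det_in_algebra) (simp_all only: const add mult entry)
  moreover have "(\<lambda>x. det (\<chi> k l. if l = i then axis j 1 $ k else (mat (circlepath w r (u x)) - B x) $ k $ l)) \<in> X"
    by (rule det_in_algebra) (simp_all only: vec_lambda_beta const add mult entry')
  ultimately show ?thesis
    unfolding circle_integrand_def by (intro mult inv u(2))
qed

lemma continuous_on_circlepath_derivative:
  "continuous_on K (\<lambda>u. vector_derivative (circlepath w r) (at u))"
  unfolding vector_derivative_circlepath by (intro continuous_intros)

lemma continuous_on_circlepath: "continuous_on K (circlepath w r)"
  unfolding circlepath by (intro continuous_intros)

lemma smooth_on_resolvent_integral:
  fixes B :: "real \<Rightarrow> complex^'n^'n"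
  assumes S: "convex S" and B: "\<And>i j. smooth_on S (\<lambda>t. B t $ i $ j)"
    and det: "\<And>t z. t \<in> S \<Longrightarrow> z \<in> sphere w r \<Longrightarrow> det (mat z - B t) \<noteq> 0" and r: "0 < r"
  shows "smooth_on S (\<lambda>t. contour_integral (circlepath w r) (resolvent_entry (B t) i j))"
proof -
  define K where "K = (cbox 0 1 :: real set)"
  have "(\<lambda>p. circle_integrand w r (B (fst p)) i j (snd p)) \<in> parametric_algebra S K"
  proof (rule circle_integrand_in_algebra)
    show "(\<lambda>x. inverse (det (mat (circlepath w r (snd x)) - B (fst x)))) \<in> parametric_algebra S K"
      if "(\<lambda>x. det (mat (circlepath w r (snd x)) - B (fst x))) \<in> parametric_algebra S K"
    proof (rule parametric_algebra.inverse[OF that])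
      fix p assume "p \<in> S \<times> K"
      moreover have "circlepath w r u \<in> sphere w r" if "u \<in> K" for u
        using that r path_image_circlepath_nonneg[of r w] by (force simp: path_image_def K_def)
      ultimately show "det (mat (circlepath w r (snd p)) - B (fst p)) \<noteq> 0"
        using det by auto
    qed
  qed (auto intro: parametric_algebra.intros smooth_on_const B
      parametric_algebra.smooth[OF B] parametric_algebra.continuous
      parametric_algebra.smooth[OF smooth_on_const] continuous_on_circlepath continuous_on_circlepath_derivative)
  then have "smooth_on S (\<lambda>t. integral (cbox 0 1) (\<lambda>u. (\<lambda>p. circle_integrand w r (B (fst p)) i j (snd p)) (t, u)))"
    unfolding K_def
    by (rule smooth_on_integral[OF S])
      (auto intro: continuous_on_parametric_algebra parametric_algebra_derivative)
  then show ?thesis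
    by (simp add: contour_integral_resolvent_entry)
qed

text \<open>Hadamard's lemma: the quotient is \<open>\<integral>\<^sub>0\<^sup>1 f' (t\<^sub>0 + u (t - t\<^sub>0)) du\<close>.\<close>

lemma smooth_on_divide:
  fixes f :: "real \<Rightarrow> complex"
  assumes S: "convex S" "t\<^sub>0 \<in> S" and f: "smooth_on S f" "f t\<^sub>0 = 0"
  shows "\<exists>g. smooth_on S g \<and> (\<forall>t\<in>S. f t = of_real (t - t\<^sub>0) * g t)"
proof -
  obtain F where F: "\<And>t. t \<in> S \<Longrightarrow> F 0 t = f t"
      "\<And>k t. t \<in> S \<Longrightarrow> (F k has_vector_derivative F (Suc k) t) (at t within S)"
    using f by (auto simp: smooth_on_def)
  define p where "p t u = t\<^sub>0 + u * (t - t\<^sub>0)" for t u :: real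
  have pS: "p t u \<in> S" if "t \<in> S" "u \<in> {0..1}" for t u
  proof -
    have "(1 - u) *\<^sub>R t\<^sub>0 + u *\<^sub>R t \<in> S"
      using S that by (intro convexD_alt) auto
    then show ?thesis
      by (simp add: p_def algebra_simps)
  qed
  \<comment> \<open>Differentiation in \<open>t\<close> raises both indices of \<open>H\<close> by
    one, so the family of all \<open>H (j, k)\<close> is closed under it.\<close>
  define H where "H = (\<lambda>(j, k) (t, u). of_real u ^ j * F k (p t u))"
  define X where "X = range H"
  have contF: "continuous_on S (F k)" for k
    using F(2) has_vector_derivative_continuous by (force simp: continuous_on_eq_continuous_within)
  define g where "g t = integral (cbox 0 1) (\<lambda>u. H (0, 1) (t, u))" for t
  have "smooth_on S g"
    unfolding g_def
  proof (rule smooth_on_integral[OF S(1), of "H (0, 1)" X])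
    fix h assume "h \<in> X"
    then obtain j k where h: "h = H (j, k)"
      by (auto simp: X_def)
    show "continuous_on (S \<times> cbox 0 1) h"
      unfolding h H_def case_prod_unfold
      by (intro continuous_intros continuous_on_compose2[OF contF])
        (auto simp: p_def[symmetric] intro: pS, auto simp: p_def intro!: continuous_intros)
    have "((\<lambda>t. h (t, u)) has_vector_derivative H (Suc j, Suc k) (t, u)) (at t within S)"
      if t: "t \<in> S" and u: "u \<in> cbox 0 1" for t u
    proof -
      have "((\<lambda>t. p t u) has_vector_derivative u) (at t within S)"
        unfolding p_def by (auto intro!: derivative_eq_intros simp: has_real_derivative_iff_has_vector_derivative[symmetric])
      moreover have "(F k has_vector_derivative F (Suc k) (p t u)) (at (p t u) within (\<lambda>t. p t u) ` S)"
        by (rule has_vector_derivative_within_subset[OF F(2)]) (use pS t u in auto)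
      ultimately have "((F k \<circ> (\<lambda>t. p t u)) has_vector_derivative u *\<^sub>R F (Suc k) (p t u)) (at t within S)"
        by (rule vector_diff_chain_within)
      then have "((\<lambda>t. of_real u ^ j * F k (p t u)) has_vector_derivative of_real u ^ j * (u *\<^sub>R F (Suc k) (p t u))) (at t within S)"
        unfolding comp_def by (rule has_vector_derivative_mult_right)
      then show ?thesis
        by (simp add: h H_def scaleR_conv_of_real mult_ac)
    qed
    then show "\<exists>h'\<in>X. \<forall>t\<in>S. \<forall>u\<in>cbox 0 1. ((\<lambda>t. h (t, u)) has_vector_derivative h' (t, u)) (at t within S)"
      by (intro bexI[of _ "H (Suc j, Suc k)"]) (auto simp: X_def)
  qed (auto simp: X_def)
  moreover have "f t = of_real (t - t\<^sub>0) * g t" if t: "t \<in> S" for t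
  proof -
    have "((\<lambda>u. F 0 (p t u)) has_vector_derivative (t - t\<^sub>0) *\<^sub>R F 1 (p t u)) (at u within {0..1})"
      if u: "u \<in> {0..1}" for u
    proof -
      have "((\<lambda>u. p t u) has_vector_derivative (t - t\<^sub>0)) (at u within {0..1})"
        unfolding p_def by (auto intro!: derivative_eq_intros simp: has_real_derivative_iff_has_vector_derivative[symmetric])
      moreover have "(F 0 has_vector_derivative F (Suc 0) (p t u)) (at (p t u) within (\<lambda>u. p t u) ` {0..1})"
        by (rule has_vector_derivative_within_subset[OF F(2)]) (use pS t u in auto)
      ultimately show ?thesis
        using vector_diff_chain_within by (fastforce simp: comp_def)
    qed
    then have "((\<lambda>u. (t - t\<^sub>0) *\<^sub>R F 1 (p t u)) has_integral F 0 (p t 1) - F 0 (p t 0)) {0..1}"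
      by (intro fundamental_theorem_of_calculus) auto
    then have "integral {0..1} (\<lambda>u. (t - t\<^sub>0) *\<^sub>R F 1 (p t u)) = F 0 (p t 1) - F 0 (p t 0)"
      by (rule integral_unique)
    then have "(t - t\<^sub>0) *\<^sub>R integral {0..1} (\<lambda>u. F 1 (p t u)) = F 0 (p t 1) - F 0 (p t 0)"
      by (simp only: integral_cmul)
    also have "F 0 (p t 1) - F 0 (p t 0) = f t"
      using F(1)[OF t] F(1)[OF S(2)] f(2) by (simp add: p_def)
    finally show ?thesis
      by (simp add: g_def H_def scaleR_conv_of_real)
  qed
  ultimately show ?thesis by blast
qed

section \<open>Smooth and real analytic germs\<close>

lemma eventually_ball_radius:
  fixes x :: "'a::metric_space"
  shows "eventually P (nhds x) \<longleftrightarrow> (\<forall>\<^sub>F d in at_right 0. \<forall>y\<in>ball x d. P y)"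
proof
  assume "eventually P (nhds x)"
  then obtain e where "e > 0" "\<And>y. dist y x < e \<Longrightarrow> P y"
    by (auto simp: eventually_nhds_metric)
  then show "\<forall>\<^sub>F d in at_right 0. \<forall>y\<in>ball x d. P y"
    unfolding eventually_at_right_field by (intro exI[of _ e]) (auto simp: dist_commute)
next
  assume "\<forall>\<^sub>F d in at_right 0. \<forall>y\<in>ball x d. P y"
  then have "\<forall>\<^sub>F d in at_right 0. 0 < d \<and> (\<forall>y\<in>ball x d. P y)"
    using eventually_at_right_less[of "0 :: real"] by eventually_elim simp
  then obtain d where "0 < d" "\<forall>y\<in>ball x d. P y"
    using eventually_happens' trivial_limit_at_right_real by blast
  then show "eventually P (nhds x)"
    unfolding eventually_nhds_metric by (intro exI[of _ d]) (auto simp: dist_commute)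
qed

lemma eventually_germ_radius:
  "eventually P (germ_filter t\<^sub>0 I) \<longleftrightarrow> (\<forall>\<^sub>F d in at_right 0. \<forall>t\<in>I \<inter> ball t\<^sub>0 d. P t)"
  by (auto simp: eventually_inf_principal eventually_ball_radius elim: eventually_mono)

lemma obtain_radius:
  assumes "\<forall>\<^sub>F d in at_right (0::real). P d"
  obtains d where "d > 0" "P d"
proof -
  have "\<forall>\<^sub>F d in at_right (0::real). 0 < d \<and> P d"
    using assms eventually_at_right_less[of "0 :: real"] by eventually_elim simp
  then show ?thesis
    using eventually_happens' trivial_limit_at_right_real that by blast
qed

text \<open>By restriction, one radius would be the same as all small radii. Written with a filter
  on radii, finitely many germs acquire a common radius by \<open>eventually_elim\<close>.\<close>

definition smooth_germs :: "real \<Rightarrow> real set \<Rightarrow> (real \<Rightarrow> complex) set" where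
  "smooth_germs t\<^sub>0 I = {f. \<forall>\<^sub>F d in at_right 0. smooth_on (I \<inter> ball t\<^sub>0 d) f}"

lemma smooth_germsI:
  assumes "d > 0" "smooth_on (I \<inter> ball t\<^sub>0 d) f"
  shows "f \<in> smooth_germs t\<^sub>0 I"
  unfolding smooth_germs_def eventually_at_right_field
  using assms by (auto intro!: exI[of _ d] intro: smooth_on_subset)

lemma smooth_germs_tendsto:
  assumes "f \<in> smooth_germs t\<^sub>0 I" "t\<^sub>0 \<in> I"
  shows "(f \<longlongrightarrow> f t\<^sub>0) (germ_filter t\<^sub>0 I)"
proof -
  obtain d where d: "d > 0" "smooth_on (I \<inter> ball t\<^sub>0 d) f"
    using assms(1) obtain_radius unfolding smooth_germs_def by blast
  show ?thesis
  proof (rule tendstoI)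
    fix e :: real assume "e > 0"
    then obtain d' where d': "d' > 0" "\<And>t. t \<in> I \<inter> ball t\<^sub>0 d \<Longrightarrow> dist t t\<^sub>0 < d' \<Longrightarrow> dist (f t) (f t\<^sub>0) < e"
      using smooth_on_imp_continuous_on[OF d(2)] assms(2) d(1) unfolding continuous_on_iff
      by (metis IntI centre_in_ball)
    then show "\<forall>\<^sub>F t in germ_filter t\<^sub>0 I. dist (f t) (f t\<^sub>0) < e"
      unfolding eventually_germ_filter using d(1)
      by (intro exI[of _ "min d d'"]) (auto simp: dist_commute)
  qed
qed

lemma smooth_regular_germs:
  fixes A :: "real \<Rightarrow> complex^'n^'n"
  assumes I: "is_interval I" "t\<^sub>0 \<in> I" "t\<^sub>0 islimpt I"
    and A: "smooth_on I A" "\<And>t. t \<in> I \<Longrightarrow> normal_matrix (A t)"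
  shows "regular_germs t\<^sub>0 I (smooth_germs t\<^sub>0 I) A"
proof
  have conv: "convex (I \<inter> ball t\<^sub>0 d)" for d
    using I(1) by (simp add: is_interval_convex_1 convex_Int)
  show "t\<^sub>0 \<in> I" "t\<^sub>0 islimpt I" by fact+
  show "g \<in> smooth_germs t\<^sub>0 I" if "f \<in> smooth_germs t\<^sub>0 I" "\<forall>\<^sub>F t in germ_filter t\<^sub>0 I. f t = g t" for f g
    using that unfolding smooth_germs_def eventually_germ_radius mem_Collect_eq
    by eventually_elim (auto intro: smooth_on_cong)
  show "(\<lambda>t. c) \<in> smooth_germs t\<^sub>0 I" for c
    by (simp add: smooth_germs_def smooth_on_const)
  show "(\<lambda>t. f t + g t) \<in> smooth_germs t\<^sub>0 I" if "f \<in> smooth_germs t\<^sub>0 I" "g \<in> smooth_germs t\<^sub>0 I" for f g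
    using that unfolding smooth_germs_def mem_Collect_eq by eventually_elim (rule smooth_on_add)
  show "(\<lambda>t. f t * g t) \<in> smooth_germs t\<^sub>0 I" if "f \<in> smooth_germs t\<^sub>0 I" "g \<in> smooth_germs t\<^sub>0 I" for f g
    using that unfolding smooth_germs_def mem_Collect_eq by eventually_elim (rule smooth_on_mult)
  show "(f \<longlongrightarrow> f t\<^sub>0) (germ_filter t\<^sub>0 I)" if "f \<in> smooth_germs t\<^sub>0 I" for f
    using that I(2) by (rule smooth_germs_tendsto)
  show "(\<lambda>t. inverse (f t)) \<in> smooth_germs t\<^sub>0 I" if f: "f \<in> smooth_germs t\<^sub>0 I" "f t\<^sub>0 \<noteq> 0" for f
  proof -
    have "\<forall>\<^sub>F t in germ_filter t\<^sub>0 I. f t \<noteq> 0"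
      using smooth_germs_tendsto[OF f(1) I(2)] f(2) by (rule tendsto_imp_eventually_ne)
    with f(1) show ?thesis
      unfolding smooth_germs_def eventually_germ_radius mem_Collect_eq
      by eventually_elim (auto intro: smooth_on_inverse)
  qed
  show "\<exists>g\<in>smooth_germs t\<^sub>0 I. \<forall>\<^sub>F t in germ_filter t\<^sub>0 I. f t = of_real (t - t\<^sub>0) * g t"
    if f: "f \<in> smooth_germs t\<^sub>0 I" "f t\<^sub>0 = 0" for f
  proof -
    obtain d where d: "d > 0" "smooth_on (I \<inter> ball t\<^sub>0 d) f"
      using f(1) obtain_radius unfolding smooth_germs_def by blast
    then obtain g where "smooth_on (I \<inter> ball t\<^sub>0 d) g" "\<forall>t\<in>I \<inter> ball t\<^sub>0 d. f t = of_real (t - t\<^sub>0) * g t"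
      using smooth_on_divide[OF conv _ d(2) f(2)] I(2) by auto
    then show ?thesis
      using d(1) by (intro bexI[of _ g]) (auto simp: eventually_germ_filter intro: smooth_germsI)
  qed
  show "(\<lambda>t. contour_integral (circlepath w r) (resolvent_entry (B t) i j)) \<in> smooth_germs t\<^sub>0 I"
    if B: "\<And>i j. (\<lambda>t. B t $ i $ j) \<in> smooth_germs t\<^sub>0 I" and r: "0 < r"
      and det: "\<And>z. z \<in> sphere w r \<Longrightarrow> det (mat z - B t\<^sub>0) \<noteq> 0"
    for B :: "real \<Rightarrow> complex^'n^'n" and w r i j
  proof -
    have "(B \<longlongrightarrow> B t\<^sub>0) (germ_filter t\<^sub>0 I)"
      by (intro vec_tendstoI smooth_germs_tendsto B I)
    then have "\<forall>\<^sub>F t in germ_filter t\<^sub>0 I. \<forall>z\<in>sphere w r. det (mat z - B t) \<noteq> 0"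
      by (rule eventually_det_nonzero) (use det in auto)
    then have 1: "\<forall>\<^sub>F d in at_right 0. \<forall>t\<in>I \<inter> ball t\<^sub>0 d. \<forall>z\<in>sphere w r. det (mat z - B t) \<noteq> 0"
      by (simp only: eventually_germ_radius)
    have "\<forall>\<^sub>F d in at_right 0. \<forall>i j. smooth_on (I \<inter> ball t\<^sub>0 d) (\<lambda>t. B t $ i $ j)"
      using B by (simp add: smooth_germs_def eventually_all_finite)
    with 1 show ?thesis
      unfolding smooth_germs_def mem_Collect_eq
    proof eventually_elim
      case (elim d)
      then show ?case
        by (intro smooth_on_resolvent_integral conv r) auto
    qed
  qed
  show "(\<lambda>t. A t $ i $ j) \<in> smooth_germs t\<^sub>0 I" for i j
  proof (rule smooth_germsI[of 1])
    have "bounded_linear (\<lambda>M :: complex^'n^'n. M $ i $ j)"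
      by (rule bounded_linear_compose[OF bounded_linear_vec_nth bounded_linear_vec_nth])
    then have "smooth_on I (\<lambda>t. A t $ i $ j)"
      using A(1) by (rule smooth_on_bounded_linear)
    then show "smooth_on (I \<inter> ball t\<^sub>0 1) (\<lambda>t. A t $ i $ j)"
      by (rule smooth_on_subset) simp
  qed simp
  show "\<forall>\<^sub>F t in germ_filter t\<^sub>0 I. normal_matrix (A t)"
    using A(2) by (auto simp: eventually_inf_principal)
qed

lemma smooth_on_vec:
  fixes v :: "real \<Rightarrow> complex^'n"
  assumes "\<And>i. smooth_on S (\<lambda>t. v t $ i)"
  shows "smooth_on S v"
proof -
  have "bounded_linear (\<lambda>c. c *s x)" for x :: "complex^'n"
    by (rule bounded_linearI') (simp_all add: vec_eq_iff distrib_right)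
  then have "smooth_on S (\<lambda>t. (v t $ i) *s axis i 1)" for i
    using assms by (rule smooth_on_bounded_linear)
  then have "smooth_on S (\<lambda>t. \<Sum>i\<in>UNIV. (v t $ i) *s axis i 1)"
    by (intro smooth_on_sum) simp_all
  then show ?thesis
    by (simp only: basis_expansion)
qed

text \<open>Real analyticity is recast as the existence of a holomorphic extension to a complex
  disc. There the quotient by \<open>t - t\<^sub>0\<close> has a removable singularity, and
  integrals with a holomorphic parameter are holomorphic.\<close>

definition analytic_germs :: "real \<Rightarrow> real set \<Rightarrow> (real \<Rightarrow> complex) set" where
  "analytic_germs t\<^sub>0 I = {f. \<exists>g. \<forall>\<^sub>F d in at_right 0. g holomorphic_on ball (of_real t\<^sub>0) d \<and>
     (\<forall>t\<in>I \<inter> ball t\<^sub>0 d. f t = g (of_real t))}"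

lemma analytic_germsI:
  assumes "d > 0" "g holomorphic_on ball (of_real t\<^sub>0) d" "\<And>t. t \<in> I \<inter> ball t\<^sub>0 d \<Longrightarrow> f t = g (of_real t)"
  shows "f \<in> analytic_germs t\<^sub>0 I"
proof -
  have "g holomorphic_on ball (of_real t\<^sub>0) e \<and> (\<forall>t\<in>I \<inter> ball t\<^sub>0 e. f t = g (of_real t))" if "e < d" for e
  proof
    show "g holomorphic_on ball (of_real t\<^sub>0) e"
      using assms(2) by (rule holomorphic_on_subset) (use that in auto)
    show "\<forall>t\<in>I \<inter> ball t\<^sub>0 e. f t = g (of_real t)"
      using assms(3) that by simp
  qed
  then have "\<forall>\<^sub>F d in at_right 0. g holomorphic_on ball (of_real t\<^sub>0) d \<and> (\<forall>t\<in>I \<inter> ball t\<^sub>0 d. f t = g (of_real t))"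
    unfolding eventually_at_right_field using assms(1) by (intro exI[of _ d]) simp
  then show ?thesis
    unfolding analytic_germs_def by (intro CollectI exI[of _ g])
qed

lemma analytic_germsE:
  assumes "f \<in> analytic_germs t\<^sub>0 I"
  obtains d g where "d > 0" "g holomorphic_on ball (of_real t\<^sub>0) d" "\<And>t. t \<in> I \<inter> ball t\<^sub>0 d \<Longrightarrow> f t = g (of_real t)"
proof -
  obtain g where "\<forall>\<^sub>F d in at_right 0. g holomorphic_on ball (of_real t\<^sub>0) d \<and> (\<forall>t\<in>I \<inter> ball t\<^sub>0 d. f t = g (of_real t))"
    using assms by (auto simp: analytic_germs_def)
  from obtain_radius[OF this] obtain d where
      "d > 0" "g holomorphic_on ball (of_real t\<^sub>0) d" "\<forall>t\<in>I \<inter> ball t\<^sub>0 d. f t = g (of_real t)"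
    by blast
  then show ?thesis
    by (intro that[of d g]) blast+
qed

lemma isCont_holomorphic_center:
  assumes "g holomorphic_on ball c d" "d > 0"
  shows "isCont g c"
  using holomorphic_on_imp_continuous_on[OF assms(1)] assms(2)
  by (simp add: continuous_on_eq_continuous_at)

lemma analytic_germs_tendsto:
  assumes "f \<in> analytic_germs t\<^sub>0 I" "t\<^sub>0 \<in> I"
  shows "(f \<longlongrightarrow> f t\<^sub>0) (germ_filter t\<^sub>0 I)"
proof -
  obtain d g where d: "d > 0" "g holomorphic_on ball (of_real t\<^sub>0) d" "\<And>t. t \<in> I \<inter> ball t\<^sub>0 d \<Longrightarrow> f t = g (of_real t)"
    using analytic_germsE[OF assms(1)] by blast
  have "isCont g (of_real t\<^sub>0)"
    using d(2,1) by (rule isCont_holomorphic_center)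
  moreover have "((\<lambda>t. of_real t) \<longlongrightarrow> (of_real t\<^sub>0 :: complex)) (germ_filter t\<^sub>0 I)"
    by (intro tendsto_of_real tendsto_mono[OF inf_le1] filterlim_ident)
  ultimately have "((\<lambda>t. g (of_real t)) \<longlongrightarrow> g (of_real t\<^sub>0)) (germ_filter t\<^sub>0 I)"
    by (rule isCont_tendsto_compose)
  moreover have "\<forall>\<^sub>F t in germ_filter t\<^sub>0 I. g (of_real t) = f t"
    unfolding eventually_germ_filter using d by (intro exI[of _ d]) auto
  moreover have "g (of_real t\<^sub>0) = f t\<^sub>0"
    using d assms(2) by simp
  ultimately show ?thesis
    by (auto intro: Lim_transform_eventually)
qed

text \<open>Joint continuity of the function and of its derivative in the parameter, as required for
  differentiation under the integral sign.\<close>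

definition holomorphic_family :: "complex set \<Rightarrow> real set \<Rightarrow> (complex \<times> real \<Rightarrow> complex) set" where
  "holomorphic_family U K = {h. \<exists>h'. continuous_on (U \<times> K) h \<and> continuous_on (U \<times> K) h' \<and>
     (\<forall>z\<in>U. \<forall>u\<in>K. ((\<lambda>z. h (z, u)) has_field_derivative h' (z, u)) (at z within U))}"

lemma holomorphic_familyI:
  assumes "continuous_on (U \<times> K) h" "continuous_on (U \<times> K) h'"
    "\<And>z u. z \<in> U \<Longrightarrow> u \<in> K \<Longrightarrow> ((\<lambda>z. h (z, u)) has_field_derivative h' (z, u)) (at z within U)"
  shows "h \<in> holomorphic_family U K"
  unfolding holomorphic_family_def using assms by blast

lemma holomorphic_familyE:
  assumes "h \<in> holomorphic_family U K"
  obtains h' where "continuous_on (U \<times> K) h" "continuous_on (U \<times> K) h'"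
    "\<And>z u. z \<in> U \<Longrightarrow> u \<in> K \<Longrightarrow> ((\<lambda>z. h (z, u)) has_field_derivative h' (z, u)) (at z within U)"
  using assms unfolding holomorphic_family_def by blast

lemma holomorphic_family_add:
  assumes "f \<in> holomorphic_family U K" "g \<in> holomorphic_family U K"
  shows "(\<lambda>p. f p + g p) \<in> holomorphic_family U K"
proof -
  obtain f' where f: "continuous_on (U \<times> K) f" "continuous_on (U \<times> K) f'"
    "\<And>z u. z \<in> U \<Longrightarrow> u \<in> K \<Longrightarrow> ((\<lambda>z. f (z, u)) has_field_derivative f' (z, u)) (at z within U)"
    using holomorphic_familyE[OF assms(1)] by blast
  obtain g' where g: "continuous_on (U \<times> K) g" "continuous_on (U \<times> K) g'"
    "\<And>z u. z \<in> U \<Longrightarrow> u \<in> K \<Longrightarrow> ((\<lambda>z. g (z, u)) has_field_derivative g' (z, u)) (at z within U)"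
    using holomorphic_familyE[OF assms(2)] by blast
  show ?thesis
    by (rule holomorphic_familyI[of _ _ _ "\<lambda>p. f' p + g' p"])
      (intro continuous_on_add f g, intro continuous_on_add f g, intro DERIV_add f g)
qed

lemma holomorphic_family_mult:
  assumes "f \<in> holomorphic_family U K" "g \<in> holomorphic_family U K"
  shows "(\<lambda>p. f p * g p) \<in> holomorphic_family U K"
proof -
  obtain f' where f: "continuous_on (U \<times> K) f" "continuous_on (U \<times> K) f'"
    "\<And>z u. z \<in> U \<Longrightarrow> u \<in> K \<Longrightarrow> ((\<lambda>z. f (z, u)) has_field_derivative f' (z, u)) (at z within U)"
    using holomorphic_familyE[OF assms(1)] by blast
  obtain g' where g: "continuous_on (U \<times> K) g" "continuous_on (U \<times> K) g'"
    "\<And>z u. z \<in> U \<Longrightarrow> u \<in> K \<Longrightarrow> ((\<lambda>z. g (z, u)) has_field_derivative g' (z, u)) (at z within U)"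
    using holomorphic_familyE[OF assms(2)] by blast
  show ?thesis
  proof (rule holomorphic_familyI[of _ _ _ "\<lambda>p. f' p * g p + g' p * f p"])
    show "((\<lambda>z. f (z, u) * g (z, u)) has_field_derivative f' (z, u) * g (z, u) + g' (z, u) * f (z, u)) (at z within U)"
      if "z \<in> U" "u \<in> K" for z u
      using DERIV_mult[OF f(3)[OF that] g(3)[OF that]] .
  qed (intro continuous_on_add continuous_on_mult f g)+
qed

lemma holomorphic_family_inverse:
  assumes "f \<in> holomorphic_family U K" "\<And>p. p \<in> U \<times> K \<Longrightarrow> f p \<noteq> 0"
  shows "(\<lambda>p. inverse (f p)) \<in> holomorphic_family U K"
proof -
  obtain f' where f: "continuous_on (U \<times> K) f" "continuous_on (U \<times> K) f'"
    "\<And>z u. z \<in> U \<Longrightarrow> u \<in> K \<Longrightarrow> ((\<lambda>z. f (z, u)) has_field_derivative f' (z, u)) (at z within U)"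
    using holomorphic_familyE[OF assms(1)] by blast
  show ?thesis
  proof (rule holomorphic_familyI[of _ _ _ "\<lambda>p. - (inverse (f p) * f' p * inverse (f p))"])
    show "((\<lambda>z. inverse (f (z, u))) has_field_derivative - (inverse (f (z, u)) * f' (z, u) * inverse (f (z, u)))) (at z within U)"
      if "z \<in> U" "u \<in> K" for z u
      using DERIV_inverse'[OF f(3)[OF that]] assms(2)[of "(z, u)"] that by simp
  qed (use assms(2) in \<open>intro continuous_on_minus continuous_on_mult continuous_on_inverse f; blast\<close>)+
qed

lemma holomorphic_family_fst:
  assumes "g holomorphic_on U" "open U"
  shows "(\<lambda>p. g (fst p)) \<in> holomorphic_family U K"
proof (rule holomorphic_familyI[of _ _ _ "\<lambda>p. deriv g (fst p)"])
  show "continuous_on (U \<times> K) (\<lambda>p. g (fst p))"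
    by (rule continuous_on_compose2[OF holomorphic_on_imp_continuous_on[OF assms(1)] continuous_on_fst[OF continuous_on_id]]) auto
  show "continuous_on (U \<times> K) (\<lambda>p. deriv g (fst p))"
    by (rule continuous_on_compose2[OF holomorphic_on_imp_continuous_on[OF holomorphic_deriv[OF assms]]
          continuous_on_fst[OF continuous_on_id]]) auto
  show "((\<lambda>z. g (fst (z, u))) has_field_derivative deriv g (fst (z, u))) (at z within U)" if "z \<in> U" for z and u :: real
    using holomorphic_derivI[OF assms that] by simp
qed

lemma holomorphic_family_snd:
  assumes "continuous_on K c"
  shows "(\<lambda>p. c (snd p)) \<in> holomorphic_family U K"
proof (rule holomorphic_familyI[of _ _ _ "\<lambda>p. 0"])
  show "continuous_on (U \<times> K) (\<lambda>p. c (snd p))"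
    by (rule continuous_on_compose2[OF assms continuous_on_snd[OF continuous_on_id]]) auto
qed auto

lemma holomorphic_on_resolvent_integral:
  fixes B :: "complex \<Rightarrow> complex^'n^'n"
  assumes U: "convex U" "open U" and B: "\<And>i j. (\<lambda>t. B t $ i $ j) holomorphic_on U"
    and det: "\<And>t z. t \<in> U \<Longrightarrow> z \<in> sphere w r \<Longrightarrow> det (mat z - B t) \<noteq> 0" and r: "0 < r"
  shows "(\<lambda>t. contour_integral (circlepath w r) (resolvent_entry (B t) i j)) holomorphic_on U"
proof -
  define K where "K = (cbox 0 1 :: real set)"
  define h where "h = (\<lambda>p :: complex \<times> real. circle_integrand w r (B (fst p)) i j (snd p))"
  have "h \<in> holomorphic_family U K"
    unfolding h_def
  proof (rule circle_integrand_in_algebra)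
    show "(\<lambda>x. inverse (det (mat (circlepath w r (snd x)) - B (fst x)))) \<in> holomorphic_family U K"
      if "(\<lambda>x. det (mat (circlepath w r (snd x)) - B (fst x))) \<in> holomorphic_family U K"
    proof (rule holomorphic_family_inverse[OF that])
      fix p assume "p \<in> U \<times> K"
      moreover have "circlepath w r u \<in> sphere w r" if "u \<in> K" for u
        using that r path_image_circlepath_nonneg[of r w] by (force simp: path_image_def K_def)
      ultimately show "det (mat (circlepath w r (snd p)) - B (fst p)) \<noteq> 0"
        using det by auto
    qed
  qed (simp_all add: holomorphic_family_add holomorphic_family_mult holomorphic_family_fst[OF B U(2)]
      holomorphic_family_snd[OF continuous_on_const] holomorphic_family_snd continuous_on_circlepath
      holomorphic_family_snd[OF continuous_on_circlepath_derivative])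
  then obtain h' where h: "continuous_on (U \<times> K) h" "continuous_on (U \<times> K) h'"
    "\<And>z u. z \<in> U \<Longrightarrow> u \<in> K \<Longrightarrow> ((\<lambda>z. h (z, u)) has_field_derivative h' (z, u)) (at z within U)"
    using holomorphic_familyE by blast
  have "(\<lambda>t. integral (cbox 0 1) (\<lambda>u. h (t, u))) holomorphic_on U"
  proof (rule leibniz_rule_holomorphic[of _ _ _ _ "\<lambda>z u. h' (z, u)"])
    show "((\<lambda>x. h (x, t)) has_field_derivative h' (x, t)) (at x within U)" if "x \<in> U" "t \<in> cbox 0 1" for x t
      using h(3) that by (simp add: K_def)
    show "(\<lambda>u. h (z, u)) integrable_on cbox 0 1" if "z \<in> U" for z
    proof (rule integrable_continuous)
      show "continuous_on (cbox 0 1) (\<lambda>u. h (z, u))"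
        using that unfolding K_def[symmetric]
        by (intro continuous_on_compose2[OF h(1)] continuous_on_Pair continuous_on_const continuous_on_id) auto
    qed
    show "continuous_on (U \<times> cbox 0 1) (\<lambda>(z, u). h' (z, u))"
      using h(2) by (simp add: K_def case_prod_unfold)
  qed (rule U)
  then show ?thesis
    by (simp add: contour_integral_resolvent_entry h_def)
qed

text \<open>Convergence is known only at points of \<open>I\<close>. A point
  \<open>t1 \<noteq> t\<^sub>0\<close> of \<open>I\<close>, which exists because
  \<open>t\<^sub>0\<close> is a limit point, forces convergence on the complex disc whose radius is
  the distance from \<open>t\<^sub>0\<close> to \<open>t1\<close>.\<close>

lemma real_analytic_germs:
  fixes f :: "real \<Rightarrow> complex"
  assumes "t\<^sub>0 islimpt I" "r > 0" "\<And>t. t \<in> I \<inter> ball t\<^sub>0 r \<Longrightarrow> (\<lambda>k. (t - t\<^sub>0) ^ k *\<^sub>R a k) sums f t"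
  shows "f \<in> analytic_germs t\<^sub>0 I"
proof -
  obtain t1 where t1: "t1 \<in> I" "t1 \<noteq> t\<^sub>0" "dist t1 t\<^sub>0 < r"
    using assms(1,2) by (auto simp: islimpt_approachable)
  define d where "d = dist t1 t\<^sub>0"
  define g where "g z = (\<Sum>k. a k * (z - of_real t\<^sub>0) ^ k)" for z
  have eq: "(t - t\<^sub>0) ^ k *\<^sub>R a k = a k * (of_real t - of_real t\<^sub>0) ^ k" for t k
    by (simp add: scaleR_conv_of_real)
  have "summable (\<lambda>k. a k * (of_real t1 - of_real t\<^sub>0) ^ k)"
    using assms(3)[of t1] t1 unfolding eq by (auto simp: dist_commute sums_iff)
  moreover have "norm (z - of_real t\<^sub>0) < norm (of_real t1 - of_real t\<^sub>0 :: complex)" if "z \<in> ball (of_real t\<^sub>0) d" for z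
    using that by (simp add: d_def dist_norm norm_minus_commute flip: of_real_diff)
  ultimately have "summable (\<lambda>k. a k * (z - of_real t\<^sub>0) ^ k)" if "z \<in> ball (of_real t\<^sub>0) d" for z
    using powser_inside that by blast
  then have g: "(\<lambda>k. a k * (z - of_real t\<^sub>0) ^ k) sums g z" if "z \<in> ball (of_real t\<^sub>0) d" for z
    unfolding g_def using that by (intro summable_sums)
  show ?thesis
  proof (rule analytic_germsI)
    show "d > 0"
      using t1(2) by (simp add: d_def)
    show "g holomorphic_on ball (of_real t\<^sub>0) d"
      using g by (rule power_series_holomorphic)
    fix t assume t: "t \<in> I \<inter> ball t\<^sub>0 d"
    then have "(\<lambda>k. (t - t\<^sub>0) ^ k *\<^sub>R a k) sums f t"
      using assms(3) t1(3) by (simp add: d_def)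
    moreover have "(\<lambda>k. (t - t\<^sub>0) ^ k *\<^sub>R a k) sums g (of_real t)"
      unfolding eq using t by (intro g) (simp add: dist_of_real)
    ultimately show "f t = g (of_real t)"
      by (rule sums_unique2)
  qed
qed

lemma analytic_regular_germs:
  fixes A :: "real \<Rightarrow> complex^'n^'n"
  assumes I: "t\<^sub>0 \<in> I" "t\<^sub>0 islimpt I"
    and A: "real_analytic_on I A" "\<And>t. t \<in> I \<Longrightarrow> normal_matrix (A t)"
  shows "regular_germs t\<^sub>0 I (analytic_germs t\<^sub>0 I) A"
proof
  show "t\<^sub>0 \<in> I" "t\<^sub>0 islimpt I" by fact+
  show "g \<in> analytic_germs t\<^sub>0 I" if f: "f \<in> analytic_germs t\<^sub>0 I" and eq: "\<forall>\<^sub>F t in germ_filter t\<^sub>0 I. f t = g t" for f g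
  proof -
    obtain h where "\<forall>\<^sub>F d in at_right 0. h holomorphic_on ball (of_real t\<^sub>0) d \<and> (\<forall>t\<in>I \<inter> ball t\<^sub>0 d. f t = h (of_real t))"
      using f by (auto simp: analytic_germs_def)
    with eq have "\<forall>\<^sub>F d in at_right 0. h holomorphic_on ball (of_real t\<^sub>0) d \<and> (\<forall>t\<in>I \<inter> ball t\<^sub>0 d. g t = h (of_real t))"
      unfolding eventually_germ_radius by eventually_elim simp
    then show ?thesis
      by (auto simp: analytic_germs_def)
  qed
  show "(\<lambda>t. c) \<in> analytic_germs t\<^sub>0 I" for c
    by (rule analytic_germsI[of 1 "\<lambda>z. c"]) auto
  show "(\<lambda>t. f t + g t) \<in> analytic_germs t\<^sub>0 I" "(\<lambda>t. f t * g t) \<in> analytic_germs t\<^sub>0 I"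
    if fg: "f \<in> analytic_germs t\<^sub>0 I" "g \<in> analytic_germs t\<^sub>0 I" for f g
  proof -
    obtain h where h: "\<forall>\<^sub>F d in at_right 0. h holomorphic_on ball (of_real t\<^sub>0) d \<and> (\<forall>t\<in>I \<inter> ball t\<^sub>0 d. f t = h (of_real t))"
      using fg(1) by (auto simp: analytic_germs_def)
    obtain k where k: "\<forall>\<^sub>F d in at_right 0. k holomorphic_on ball (of_real t\<^sub>0) d \<and> (\<forall>t\<in>I \<inter> ball t\<^sub>0 d. g t = k (of_real t))"
      using fg(2) by (auto simp: analytic_germs_def)
    from h k have "\<forall>\<^sub>F d in at_right 0. (\<lambda>z. h z + k z) holomorphic_on ball (of_real t\<^sub>0) d \<and>
        (\<forall>t\<in>I \<inter> ball t\<^sub>0 d. f t + g t = h (of_real t) + k (of_real t))"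
      by eventually_elim (auto intro: holomorphic_on_add)
    then show "(\<lambda>t. f t + g t) \<in> analytic_germs t\<^sub>0 I"
      unfolding analytic_germs_def by (intro CollectI exI[of _ "\<lambda>z. h z + k z"])
    from h k have "\<forall>\<^sub>F d in at_right 0. (\<lambda>z. h z * k z) holomorphic_on ball (of_real t\<^sub>0) d \<and>
        (\<forall>t\<in>I \<inter> ball t\<^sub>0 d. f t * g t = h (of_real t) * k (of_real t))"
      by eventually_elim (auto intro: holomorphic_on_mult)
    then show "(\<lambda>t. f t * g t) \<in> analytic_germs t\<^sub>0 I"
      unfolding analytic_germs_def by (intro CollectI exI[of _ "\<lambda>z. h z * k z"])
  qed
  show "(f \<longlongrightarrow> f t\<^sub>0) (germ_filter t\<^sub>0 I)" if "f \<in> analytic_germs t\<^sub>0 I" for f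
    using that I(1) by (rule analytic_germs_tendsto)
  show "(\<lambda>t. inverse (f t)) \<in> analytic_germs t\<^sub>0 I" if f: "f \<in> analytic_germs t\<^sub>0 I" "f t\<^sub>0 \<noteq> 0" for f
  proof -
    obtain d g where d: "d > 0" "g holomorphic_on ball (of_real t\<^sub>0) d" "\<And>t. t \<in> I \<inter> ball t\<^sub>0 d \<Longrightarrow> f t = g (of_real t)"
      using analytic_germsE[OF f(1)] by blast
    have "g (of_real t\<^sub>0) \<noteq> 0"
      using d I(1) f(2) by simp
    moreover have "continuous (at (of_real t\<^sub>0)) g"
      using d(2,1) by (rule isCont_holomorphic_center)
    ultimately obtain e where e: "e > 0" "\<And>z. dist (of_real t\<^sub>0) z < e \<Longrightarrow> g z \<noteq> 0"
      using continuous_at_avoid by blast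
    show ?thesis
    proof (rule analytic_germsI[of "min d e"])
      show "(\<lambda>z. inverse (g z)) holomorphic_on ball (of_real t\<^sub>0) (min d e)"
        using e(2) by (intro holomorphic_on_inverse holomorphic_on_subset[OF d(2)]) auto
    qed (use d e in auto)
  qed
  show "\<exists>g\<in>analytic_germs t\<^sub>0 I. \<forall>\<^sub>F t in germ_filter t\<^sub>0 I. f t = of_real (t - t\<^sub>0) * g t"
    if f: "f \<in> analytic_germs t\<^sub>0 I" "f t\<^sub>0 = 0" for f
  proof -
    obtain d g where d: "d > 0" "g holomorphic_on ball (of_real t\<^sub>0) d" "\<And>t. t \<in> I \<inter> ball t\<^sub>0 d \<Longrightarrow> f t = g (of_real t)"
      using analytic_germsE[OF f(1)] by blast
    have g0: "g (of_real t\<^sub>0) = 0"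
      using d I(1) f(2) by simp
    define q where "q z = (if z = of_real t\<^sub>0 then deriv g (of_real t\<^sub>0) else (g z - g (of_real t\<^sub>0)) / (z - of_real t\<^sub>0))" for z
    have "q holomorphic_on ball (of_real t\<^sub>0) d"
      unfolding q_def by (rule pole_lemma_open[OF d(2) open_ball])
    then have "(\<lambda>t. q (of_real t)) \<in> analytic_germs t\<^sub>0 I"
      using d(1) by (intro analytic_germsI[of d q]) auto
    moreover have "f t = of_real (t - t\<^sub>0) * q (of_real t)" if "t \<in> I \<inter> ball t\<^sub>0 d" for t
      using d(3)[OF that] g0 by (simp add: q_def)
    ultimately show ?thesis
      using d(1) by (intro bexI[of _ "\<lambda>t. q (of_real t)"]) (auto simp: eventually_germ_filter)
  qed
  show "(\<lambda>t. contour_integral (circlepath w r) (resolvent_entry (B t) i j)) \<in> analytic_germs t\<^sub>0 I"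
    if B: "\<And>i j. (\<lambda>t. B t $ i $ j) \<in> analytic_germs t\<^sub>0 I" and r: "0 < r"
      and det: "\<And>z. z \<in> sphere w r \<Longrightarrow> det (mat z - B t\<^sub>0) \<noteq> 0"
    for B :: "real \<Rightarrow> complex^'n^'n" and w r i j
  proof -
    \<comment> \<open>One holomorphic extension is fixed for each entry. Together they form a matrix
      \<open>C\<close> of holomorphic functions that agrees with \<open>B\<close> on
      \<open>I\<close>, and the resolvent integral of \<open>C\<close> is the extension
      sought.\<close>
    define good where "good i j g \<longleftrightarrow> (\<forall>\<^sub>F d in at_right 0. g holomorphic_on ball (of_real t\<^sub>0) d \<and>
        (\<forall>t\<in>I \<inter> ball t\<^sub>0 d. B t $ i $ j = g (of_real t)))" for i j and g :: "complex \<Rightarrow> complex"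
    have "\<exists>g. good i j g" for i j
      using B[of i j] by (auto simp: analytic_germs_def good_def)
    then have good: "good i j (SOME g. good i j g)" for i j
      using someI_ex[of "good i j"] by blast
    define C where "C z = (\<chi> i j. (SOME g. good i j g) z)" for z
    have "\<forall>\<^sub>F d in at_right 0. \<forall>i j. (\<lambda>z. C z $ i $ j) holomorphic_on ball (of_real t\<^sub>0) d \<and>
        (\<forall>t\<in>I \<inter> ball t\<^sub>0 d. B t $ i $ j = C (of_real t) $ i $ j)"
      using good unfolding good_def C_def by (simp add: eventually_all_finite)
    then have hol: "\<forall>\<^sub>F d in at_right 0. (\<forall>i j. (\<lambda>z. C z $ i $ j) holomorphic_on ball (of_real t\<^sub>0) d) \<and>
        (\<forall>t\<in>I \<inter> ball t\<^sub>0 d. B t = C (of_real t))"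
      by eventually_elim (simp add: vec_eq_iff)
    obtain d where "d > 0" and "(\<forall>i j. (\<lambda>z. C z $ i $ j) holomorphic_on ball (of_real t\<^sub>0) d) \<and>
        (\<forall>t\<in>I \<inter> ball t\<^sub>0 d. B t = C (of_real t))"
      by (rule obtain_radius[OF hol])
    then have d: "d > 0" "\<And>i j. (\<lambda>z. C z $ i $ j) holomorphic_on ball (of_real t\<^sub>0) d" "\<forall>t\<in>I \<inter> ball t\<^sub>0 d. B t = C (of_real t)"
      by auto
    have C0: "C (of_real t\<^sub>0) = B t\<^sub>0"
      using d(1,3) I(1) by simp
    have "isCont (\<lambda>z. C z $ i $ j) (of_real t\<^sub>0)" for i j
      using d(2)[of i j] d(1) by (rule isCont_holomorphic_center)
    then have "((\<lambda>z. C z $ i $ j) \<longlongrightarrow> C (of_real t\<^sub>0) $ i $ j) (nhds (of_real t\<^sub>0))" for i j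
      by (simp only: tendsto_nhds_iff isCont_def)
    then have "(C \<longlongrightarrow> C (of_real t\<^sub>0)) (nhds (of_real t\<^sub>0))"
      by (intro vec_tendstoI)
    then have "\<forall>\<^sub>F z in nhds (of_real t\<^sub>0). \<forall>y\<in>sphere w r. det (mat y - C z) \<noteq> 0"
      by (rule eventually_det_nonzero) (use det in \<open>auto simp: C0\<close>)
    then have "\<forall>\<^sub>F d in at_right 0. \<forall>z\<in>ball (of_real t\<^sub>0) d. \<forall>y\<in>sphere w r. det (mat y - C z) \<noteq> 0"
      by (simp only: eventually_ball_radius)
    with hol have "\<forall>\<^sub>F d in at_right 0. (\<lambda>z. contour_integral (circlepath w r) (resolvent_entry (C z) i j)) holomorphic_on ball (of_real t\<^sub>0) d \<and>
        (\<forall>t\<in>I \<inter> ball t\<^sub>0 d. contour_integral (circlepath w r) (resolvent_entry (B t) i j) =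
           contour_integral (circlepath w r) (resolvent_entry (C (of_real t)) i j))"
    proof eventually_elim
      case (elim d)
      then show ?case
        by (intro conjI holomorphic_on_resolvent_integral r convex_ball open_ball) auto
    qed
    then show ?thesis
      unfolding analytic_germs_def
      by (intro CollectI exI[of _ "\<lambda>z. contour_integral (circlepath w r) (resolvent_entry (C z) i j)"])
  qed
  show "(\<lambda>t. A t $ i $ j) \<in> analytic_germs t\<^sub>0 I" for i j
  proof -
    obtain r a where r: "r > 0" "\<forall>t\<in>I \<inter> ball t\<^sub>0 r. (\<lambda>k. (t - t\<^sub>0) ^ k *\<^sub>R a k) sums A t"
      using A(1) I(1) by (auto simp: real_analytic_on_def)
    have "bounded_linear (\<lambda>M :: complex^'n^'n. M $ i $ j)"
      by (rule bounded_linear_compose[OF bounded_linear_vec_nth bounded_linear_vec_nth])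
    then have "(\<lambda>k. ((t - t\<^sub>0) ^ k *\<^sub>R a k) $ i $ j) sums (A t $ i $ j)" if "t \<in> I \<inter> ball t\<^sub>0 r" for t
      using r(2)[rule_format, OF that] by (rule bounded_linear.sums)
    then have "(\<lambda>k. (t - t\<^sub>0) ^ k *\<^sub>R (a k $ i $ j)) sums (A t $ i $ j)" if "t \<in> I \<inter> ball t\<^sub>0 r" for t
      using that by simp
    then show ?thesis
      by (rule real_analytic_germs[OF I(2) r(1)])
  qed
  show "\<forall>\<^sub>F t in germ_filter t\<^sub>0 I. normal_matrix (A t)"
    using A(2) by (auto simp: eventually_inf_principal)
qed

text \<open>The germ is taken at one point only, but analyticity asks for a power series at every
  point \<open>t1\<close> of the interval. The Taylor series of the extensions at \<open>t1\<close>
  converge on the largest disc around \<open>t1\<close> inside the given one.\<close>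

lemma real_analytic_on_vec:
  fixes v :: "real \<Rightarrow> complex^'n"
  assumes "\<And>i. g i holomorphic_on ball (of_real t\<^sub>0) d"
    and "\<And>t i. t \<in> I \<inter> ball t\<^sub>0 d \<Longrightarrow> v t $ i = g i (of_real t)"
  shows "real_analytic_on (I \<inter> ball t\<^sub>0 d) v"
  unfolding real_analytic_on_def
proof
  fix t1 assume t1: "t1 \<in> I \<inter> ball t\<^sub>0 d"
  define r where "r = d - dist t\<^sub>0 t1"
  have sub: "ball (of_real t1) r \<subseteq> ball (of_real t\<^sub>0 :: complex) d"
    unfolding r_def
  proof
    fix z :: complex assume "z \<in> ball (of_real t1) (d - dist t\<^sub>0 t1)"
    then show "z \<in> ball (of_real t\<^sub>0) d"
      using dist_triangle[of "of_real t\<^sub>0" z "of_real t1"] by (simp add: dist_of_real)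
  qed
  define a :: "nat \<Rightarrow> complex^'n" where "a k = (\<chi> i. (deriv ^^ k) (g i) (of_real t1) / fact k)" for k
  have "(\<lambda>k. (t - t1) ^ k *\<^sub>R a k) sums v t" if t: "t \<in> I \<inter> ball t\<^sub>0 d \<inter> ball t1 r" for t
  proof -
    have "(\<lambda>k. ((t - t1) ^ k *\<^sub>R a k) $ i) sums v t $ i" for i
    proof -
      have "(\<lambda>k. (deriv ^^ k) (g i) (of_real t1) / fact k * (of_real t - of_real t1) ^ k) sums g i (of_real t)"
        by (rule holomorphic_power_series[OF holomorphic_on_subset[OF assms(1) sub]])
          (use t in \<open>simp add: dist_of_real\<close>)
      moreover have "((t - t1) ^ k *\<^sub>R a k) $ i =
          (deriv ^^ k) (g i) (of_real t1) / fact k * (of_real t - of_real t1) ^ k" for k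
        unfolding vector_scaleR_component a_def vec_lambda_beta by (simp add: scaleR_conv_of_real)
      ultimately show ?thesis
        using assms(2)[of t i] t by simp
    qed
    then show ?thesis
      unfolding sums_def by (intro vec_tendstoI) simp
  qed
  moreover have "r > 0"
    using t1 by (simp add: r_def)
  ultimately show "\<exists>r>0. \<exists>a. \<forall>t\<in>I \<inter> ball t\<^sub>0 d \<inter> ball t1 r. (\<lambda>k. (t - t1) ^ k *\<^sub>R a k) sums v t"
    by blast
qed

lemma real_analytic_on_complex:
  fixes f :: "real \<Rightarrow> complex"
  assumes "g holomorphic_on ball (of_real t\<^sub>0) d" "\<And>t. t \<in> I \<inter> ball t\<^sub>0 d \<Longrightarrow> f t = g (of_real t)"
  shows "real_analytic_on (I \<inter> ball t\<^sub>0 d) f"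
proof -
  \<comment> \<open>The scalar case is the vector case in dimension one.\<close>
  have v: "real_analytic_on (I \<inter> ball t\<^sub>0 d) (\<lambda>t. (\<chi> i. f t) :: complex^1)"
    using assms by (intro real_analytic_on_vec[of "\<lambda>i. g"]) auto
  show ?thesis
    unfolding real_analytic_on_def
  proof
    fix t1 assume "t1 \<in> I \<inter> ball t\<^sub>0 d"
    then obtain r a where r: "r > 0" "\<forall>t\<in>I \<inter> ball t\<^sub>0 d \<inter> ball t1 r.
        (\<lambda>k. (t - t1) ^ k *\<^sub>R a k) sums ((\<chi> i. f t) :: complex^1)"
      using v unfolding real_analytic_on_def by blast
    then have "(\<lambda>k. (t - t1) ^ k *\<^sub>R (a k $ 1)) sums f t" if "t \<in> I \<inter> ball t\<^sub>0 d \<inter> ball t1 r" for t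
      using bounded_linear.sums[OF bounded_linear_vec_nth[of 1], of "\<lambda>k. (t - t1) ^ k *\<^sub>R a k" "\<chi> i. f t"] that by simp
    with r(1) show "\<exists>r>0. \<exists>a. \<forall>t\<in>I \<inter> ball t\<^sub>0 d \<inter> ball t1 r. (\<lambda>k. (t - t1) ^ k *\<^sub>R a k) sums f t"
      by (intro exI[of _ r] conjI exI[of _ "\<lambda>k. a k $ 1"]) auto
  qed
qed

definition eigen_system :: "complex^'n^'n \<Rightarrow> ('n \<Rightarrow> complex) \<Rightarrow> ('n \<Rightarrow> complex^'n) \<Rightarrow> bool" where
  "eigen_system M l e \<longleftrightarrow> complex_basis e \<and> (\<forall>j. M *v e j = l j *s e j)"

lemma generic_germI:
  assumes "regular_germs t\<^sub>0 I R A" "smooth_on I A" "\<And>t. t \<in> I \<Longrightarrow> normal_matrix (A t)" "generic_matrix_curve I A"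
  shows "generic_germ t\<^sub>0 I R A"
  using assms by (intro generic_germ.intro generic_germ_axioms.intro smooth_on_imp_continuous_on) auto

theorem smooth_chart:
  fixes A :: "real \<Rightarrow> complex^'n^'n"
  assumes I: "is_interval I" "t\<^sub>0 \<in> I" "t\<^sub>0 islimpt I"
    and A: "smooth_on I A" "\<And>t. t \<in> I \<Longrightarrow> normal_matrix (A t)" "generic_matrix_curve I A"
  shows "\<exists>d>0. \<exists>(ev :: 'n \<Rightarrow> real \<Rightarrow> complex) (v :: 'n \<Rightarrow> real \<Rightarrow> complex^'n).
    (\<forall>j. smooth_on (I \<inter> ball t\<^sub>0 d) (ev j) \<and> smooth_on (I \<inter> ball t\<^sub>0 d) (v j)) \<and>
    (\<forall>t\<in>I \<inter> ball t\<^sub>0 d. eigen_system (A t) (\<lambda>j. ev j t) (\<lambda>j. v j t)) \<and>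
    (\<forall>i j. ev i = ev j \<or> (\<forall>t\<in>I \<inter> ball t\<^sub>0 d. t \<noteq> t\<^sub>0 \<longrightarrow> ev i t \<noteq> ev j t))"
proof -
  interpret generic_germ t\<^sub>0 I "smooth_germs t\<^sub>0 I" A
    by (intro generic_germI smooth_regular_germs I A)
  obtain ev :: "'n \<Rightarrow> real \<Rightarrow> complex" and v :: "'n \<Rightarrow> real \<Rightarrow> complex^'n"
    where reg: "\<And>j. ev j \<in> smooth_germs t\<^sub>0 I" "\<And>i j. (\<lambda>t. v j t $ i) \<in> smooth_germs t\<^sub>0 I"
      and eig: "\<forall>\<^sub>F t in \<G>. eigen_system (A t) (\<lambda>j. ev j t) (\<lambda>j. v j t)"
      and sep: "\<And>i j. ev i = ev j \<or> (\<forall>\<^sub>F t in \<G>. t \<noteq> t\<^sub>0 \<longrightarrow> ev i t \<noteq> ev j t)"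
    using local_eigenbasis unfolding eigen_system_def by blast
  have "\<forall>\<^sub>F d in at_right 0. \<forall>j. smooth_on (I \<inter> ball t\<^sub>0 d) (ev j)"
    using reg(1) by (simp add: smooth_germs_def eventually_all_finite)
  moreover have "\<forall>\<^sub>F d in at_right 0. \<forall>i j. smooth_on (I \<inter> ball t\<^sub>0 d) (\<lambda>t. v j t $ i)"
    using reg(2) by (simp add: smooth_germs_def eventually_all_finite)
  moreover have "\<forall>\<^sub>F d in at_right 0. ev i = ev j \<or> (\<forall>t\<in>I \<inter> ball t\<^sub>0 d. t \<noteq> t\<^sub>0 \<longrightarrow> ev i t \<noteq> ev j t)" for i j
    using sep[of i j] unfolding eventually_germ_radius by (auto elim: eventually_mono)
  then have "\<forall>\<^sub>F d in at_right 0. \<forall>i j. ev i = ev j \<or> (\<forall>t\<in>I \<inter> ball t\<^sub>0 d. t \<noteq> t\<^sub>0 \<longrightarrow> ev i t \<noteq> ev j t)"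
    by (intro eventually_all_finite)
  ultimately have "\<forall>\<^sub>F d in at_right 0. (\<forall>j. smooth_on (I \<inter> ball t\<^sub>0 d) (ev j) \<and> smooth_on (I \<inter> ball t\<^sub>0 d) (v j)) \<and>
    (\<forall>t\<in>I \<inter> ball t\<^sub>0 d. eigen_system (A t) (\<lambda>j. ev j t) (\<lambda>j. v j t)) \<and>
    (\<forall>i j. ev i = ev j \<or> (\<forall>t\<in>I \<inter> ball t\<^sub>0 d. t \<noteq> t\<^sub>0 \<longrightarrow> ev i t \<noteq> ev j t))"
    using eig unfolding eventually_germ_radius
    by eventually_elim (blast intro: smooth_on_vec)
  from obtain_radius[OF this] show ?thesis
    by metis
qed

theorem analytic_chart:
  fixes A :: "real \<Rightarrow> complex^'n^'n"
  assumes I: "t\<^sub>0 \<in> I" "t\<^sub>0 islimpt I"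
    and A: "real_analytic_on I A" "smooth_on I A" "\<And>t. t \<in> I \<Longrightarrow> normal_matrix (A t)" "generic_matrix_curve I A"
  shows "\<exists>d>0. \<exists>(ev :: 'n \<Rightarrow> real \<Rightarrow> complex) (v :: 'n \<Rightarrow> real \<Rightarrow> complex^'n).
    (\<forall>j. real_analytic_on (I \<inter> ball t\<^sub>0 d) (ev j) \<and> real_analytic_on (I \<inter> ball t\<^sub>0 d) (v j)) \<and>
    (\<forall>t\<in>I \<inter> ball t\<^sub>0 d. eigen_system (A t) (\<lambda>j. ev j t) (\<lambda>j. v j t))"
proof -
  interpret generic_germ t\<^sub>0 I "analytic_germs t\<^sub>0 I" A
    by (intro generic_germI analytic_regular_germs I A)
  obtain ev :: "'n \<Rightarrow> real \<Rightarrow> complex" and v :: "'n \<Rightarrow> real \<Rightarrow> complex^'n"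
    where reg: "\<And>j. ev j \<in> analytic_germs t\<^sub>0 I" "\<And>i j. (\<lambda>t. v j t $ i) \<in> analytic_germs t\<^sub>0 I"
      and eig: "\<forall>\<^sub>F t in \<G>. eigen_system (A t) (\<lambda>j. ev j t) (\<lambda>j. v j t)"
    using local_eigenbasis unfolding eigen_system_def by blast
  have "\<forall>j. \<exists>g. \<forall>\<^sub>F d in at_right 0. g holomorphic_on ball (of_real t\<^sub>0) d \<and>
      (\<forall>t\<in>I \<inter> ball t\<^sub>0 d. ev j t = g (of_real t))"
    using reg(1) by (auto simp: analytic_germs_def)
  from choice[OF this] obtain g where g: "\<And>j. \<forall>\<^sub>F d in at_right 0. g j holomorphic_on ball (of_real t\<^sub>0) d \<and>
      (\<forall>t\<in>I \<inter> ball t\<^sub>0 d. ev j t = g j (of_real t))"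
    by blast
  have "\<forall>p. \<exists>h. \<forall>\<^sub>F d in at_right 0. h holomorphic_on ball (of_real t\<^sub>0) d \<and>
      (\<forall>t\<in>I \<inter> ball t\<^sub>0 d. v (fst p) t $ snd p = h (of_real t))"
    using reg(2) by (auto simp: analytic_germs_def)
  from choice[OF this] obtain h where h: "\<And>p. \<forall>\<^sub>F d in at_right 0. h p holomorphic_on ball (of_real t\<^sub>0) d \<and>
      (\<forall>t\<in>I \<inter> ball t\<^sub>0 d. v (fst p) t $ snd p = h p (of_real t))"
    by blast
  have "\<forall>\<^sub>F d in at_right 0. \<forall>j. g j holomorphic_on ball (of_real t\<^sub>0) d \<and> (\<forall>t\<in>I \<inter> ball t\<^sub>0 d. ev j t = g j (of_real t))"
    using g by (intro eventually_all_finite)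
  moreover have "\<forall>\<^sub>F d in at_right 0. \<forall>p. h p holomorphic_on ball (of_real t\<^sub>0) d \<and> (\<forall>t\<in>I \<inter> ball t\<^sub>0 d. v (fst p) t $ snd p = h p (of_real t))"
    using h by (intro eventually_all_finite)
  ultimately have "\<forall>\<^sub>F d in at_right 0.
    (\<forall>j. real_analytic_on (I \<inter> ball t\<^sub>0 d) (ev j) \<and> real_analytic_on (I \<inter> ball t\<^sub>0 d) (v j)) \<and>
    (\<forall>t\<in>I \<inter> ball t\<^sub>0 d. eigen_system (A t) (\<lambda>j. ev j t) (\<lambda>j. v j t))"
    using eig unfolding eventually_germ_radius
  proof eventually_elim
    case (elim d)
    have "real_analytic_on (I \<inter> ball t\<^sub>0 d) (ev j)" for j
      using elim(1) by (intro real_analytic_on_complex[of "g j"]) auto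
    moreover have "real_analytic_on (I \<inter> ball t\<^sub>0 d) (v j)" for j
    proof (rule real_analytic_on_vec[of "\<lambda>i. h (j, i)"])
      fix i
      show "h (j, i) holomorphic_on ball (of_real t\<^sub>0) d"
        using elim(2) by blast
      show "v j t $ i = h (j, i) (of_real t)" if "t \<in> I \<inter> ball t\<^sub>0 d" for t
        using elim(2)[rule_format, of "(j, i)"] that by simp
    qed
    ultimately show ?case
      using elim(3) by blast
  qed
  from obtain_radius[OF this] show ?thesis
    by metis
qed

section \<open>Gluing local parameterizations\<close>

subsection \<open>Lipschitz curves\<close>

text \<open>A convenient class between smooth and absolutely continuous curves: smooth curves are
  locally Lipschitz, and a continuous join of two Lipschitz pieces is Lipschitz although smoothness
  is lost at the joint.\<close>

definition lipschitz_curve :: "real set \<Rightarrow> (real \<Rightarrow> 'a::real_normed_vector) \<Rightarrow> bool" where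
  "lipschitz_curve S f \<longleftrightarrow> (\<exists>L\<ge>0. \<forall>s\<in>S. \<forall>t\<in>S. norm (f s - f t) \<le> L * \<bar>s - t\<bar>)"

lemma lipschitz_curveI:
  "L \<ge> 0 \<Longrightarrow> (\<And>s t. s \<in> S \<Longrightarrow> t \<in> S \<Longrightarrow> norm (f s - f t) \<le> L * \<bar>s - t\<bar>) \<Longrightarrow> lipschitz_curve S f"
  unfolding lipschitz_curve_def by blast

lemma lipschitz_curve_subset: "lipschitz_curve S f \<Longrightarrow> T \<subseteq> S \<Longrightarrow> lipschitz_curve T f"
  unfolding lipschitz_curve_def by (meson subsetD)

lemma lipschitz_curve_cong: "lipschitz_curve S f \<Longrightarrow> (\<And>t. t \<in> S \<Longrightarrow> f t = g t) \<Longrightarrow> lipschitz_curve S g"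
  unfolding lipschitz_curve_def by auto

lemma lipschitz_curve_bounded_linear:
  assumes "bounded_linear h" "lipschitz_curve S f"
  shows "lipschitz_curve S (\<lambda>t. h (f t))"
proof -
  obtain K where K: "K \<ge> 0" "\<And>x. norm (h x) \<le> norm x * K"
    using bounded_linear.nonneg_bounded[OF assms(1)] by blast
  obtain L where L: "L \<ge> 0" "\<And>s t. s \<in> S \<Longrightarrow> t \<in> S \<Longrightarrow> norm (f s - f t) \<le> L * \<bar>s - t\<bar>"
    using assms(2) by (auto simp: lipschitz_curve_def)
  show ?thesis
  proof (rule lipschitz_curveI[of "L * K"])
    fix s t assume "s \<in> S" "t \<in> S"
    have "norm (h (f s) - h (f t)) \<le> norm (f s - f t) * K"
      using K(2)[of "f s - f t"] by (simp add: linear_diff[OF bounded_linear.linear[OF assms(1)]])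
    also have "\<dots> \<le> (L * \<bar>s - t\<bar>) * K"
      using L(2)[OF \<open>s \<in> S\<close> \<open>t \<in> S\<close>] K(1) by (rule mult_right_mono)
    finally show "norm (h (f s) - h (f t)) \<le> L * K * \<bar>s - t\<bar>"
      by (simp add: mult_ac)
  qed (use K L in simp)
qed

lemma lipschitz_curve_sum:
  assumes "finite X" "\<And>x. x \<in> X \<Longrightarrow> lipschitz_curve S (f x)"
  shows "lipschitz_curve S (\<lambda>t. \<Sum>x\<in>X. f x t)"
proof -
  have "\<forall>x\<in>X. \<exists>L\<ge>0. \<forall>s\<in>S. \<forall>t\<in>S. norm (f x s - f x t) \<le> L * \<bar>s - t\<bar>"
    using assms(2) by (simp add: lipschitz_curve_def)
  from bchoice[OF this] obtain L where L: "\<And>x. x \<in> X \<Longrightarrow> L x \<ge> 0"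
      "\<And>x s t. x \<in> X \<Longrightarrow> s \<in> S \<Longrightarrow> t \<in> S \<Longrightarrow> norm (f x s - f x t) \<le> L x * \<bar>s - t\<bar>"
    by blast
  show ?thesis
  proof (rule lipschitz_curveI[of "sum L X"])
    fix s t assume st: "s \<in> S" "t \<in> S"
    have "norm ((\<Sum>x\<in>X. f x s) - (\<Sum>x\<in>X. f x t)) \<le> (\<Sum>x\<in>X. L x * \<bar>s - t\<bar>)"
      unfolding sum_subtractf[symmetric] using L(2) st by (intro sum_norm_le)
    then show "norm ((\<Sum>x\<in>X. f x s) - (\<Sum>x\<in>X. f x t)) \<le> sum L X * \<bar>s - t\<bar>"
      by (simp add: sum_distrib_right)
  qed (use L(1) in \<open>simp add: sum_nonneg\<close>)
qed

text \<open>Points on opposite sides of \<open>c\<close> are compared through \<open>c\<close>,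
  where the two curves agree; the constant \<open>L + M\<close> serves both pieces.\<close>

lemma lipschitz_curve_join:
  assumes f: "lipschitz_curve (S \<inter> {..c}) f" and g: "lipschitz_curve (S \<inter> {c..}) g"
    and c: "c \<in> S" "f c = g c"
  shows "lipschitz_curve S (\<lambda>t. if t \<le> c then f t else g t)"
proof -
  obtain L where L: "L \<ge> 0" "\<And>s t. s \<in> S \<inter> {..c} \<Longrightarrow> t \<in> S \<inter> {..c} \<Longrightarrow> norm (f s - f t) \<le> L * \<bar>s - t\<bar>"
    using f by (auto simp: lipschitz_curve_def)
  obtain M where M: "M \<ge> 0" "\<And>s t. s \<in> S \<inter> {c..} \<Longrightarrow> t \<in> S \<inter> {c..} \<Longrightarrow> norm (g s - g t) \<le> M * \<bar>s - t\<bar>"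
    using g by (auto simp: lipschitz_curve_def)
  define h where "h t = (if t \<le> c then f t else g t)" for t
  have LM: "L * x \<le> (L + M) * x" "M * x \<le> (L + M) * x" if "x \<ge> 0" for x
    using that L(1) M(1) by (auto simp: distrib_right)
  have mixed: "norm (f s - g t) \<le> (L + M) * (t - s)" if "s \<in> S" "t \<in> S" "s \<le> c" "c \<le> t" for s t
  proof -
    have "norm (f s - g t) \<le> norm (f s - f c) + norm (g c - g t)"
      using norm_triangle_ineq[of "f s - f c" "g c - g t"] c(2) by simp
    also have "\<dots> \<le> L * (c - s) + M * (t - c)"
      using L(2)[of s c] M(2)[of c t] that c(1) by simp
    also have "\<dots> \<le> (L + M) * (c - s) + (L + M) * (t - c)"
      using that by (intro add_mono LM) auto
    finally show ?thesis
      by (simp add: algebra_simps)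
  qed
  show ?thesis
    unfolding h_def[symmetric]
  proof (rule lipschitz_curveI[of "L + M"])
    fix s t assume st: "s \<in> S" "t \<in> S"
    consider "s \<le> c" "t \<le> c" | "s > c" "t > c" | "s \<le> c" "t > c" | "s > c" "t \<le> c"
      by linarith
    then show "norm (h s - h t) \<le> (L + M) * \<bar>s - t\<bar>"
    proof cases
      case 1
      then show ?thesis
        using L(2)[of s t] LM(1)[of "\<bar>s - t\<bar>"] st by (simp add: h_def)
    next
      case 2
      then show ?thesis
        using M(2)[of s t] LM(2)[of "\<bar>s - t\<bar>"] st by (simp add: h_def)
    next
      case 3
      then show ?thesis
        using mixed[of s t] st by (simp add: h_def)
    next
      case 4
      then show ?thesis
        using mixed[of t s] st by (simp add: h_def norm_minus_commute)
    qed
  qed (use L M in simp)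
qed

definition locally_lipschitz_curve :: "real set \<Rightarrow> (real \<Rightarrow> 'a::real_normed_vector) \<Rightarrow> bool" where
  "locally_lipschitz_curve S f \<longleftrightarrow> (\<forall>t\<in>S. \<exists>r>0. lipschitz_curve (S \<inter> ball t r) f)"

lemma lipschitz_imp_locally_lipschitz: "lipschitz_curve S f \<Longrightarrow> locally_lipschitz_curve S f"
  unfolding locally_lipschitz_curve_def by (metis inf_le1 lipschitz_curve_subset zero_less_one)

lemma lipschitz_imp_absolutely_continuous:
  assumes "lipschitz_curve S f"
  shows "absolutely_continuous_on S f"
  unfolding absolutely_continuous_on_def
proof (intro allI impI)
  fix e :: real assume e: "e > 0"
  obtain L where L: "L \<ge> 0" "\<And>s t. s \<in> S \<Longrightarrow> t \<in> S \<Longrightarrow> norm (f s - f t) \<le> L * \<bar>s - t\<bar>"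
    using assms by (auto simp: lipschitz_curve_def)
  \<comment> \<open>Dividing by \<open>L + 1\<close> instead of \<open>L\<close> covers
    \<open>L = 0\<close> and makes the final inequality strict.\<close>
  have "(\<Sum>(a, b)\<in>D. norm (f b - f a)) < e"
    if D: "\<forall>(a, b)\<in>D. a < b \<and> {a..b} \<subseteq> S" and less: "(\<Sum>(a, b)\<in>D. b - a) < e / (L + 1)" for D
  proof -
    have "(\<Sum>(a, b)\<in>D. norm (f b - f a)) \<le> (\<Sum>(a, b)\<in>D. L * (b - a))"
    proof (rule sum_mono, clarify)
      fix a b assume "(a, b) \<in> D"
      then have "a < b" "{a..b} \<subseteq> S"
        using D by auto
      then have "a < b" "a \<in> S" "b \<in> S"
        by (auto simp: subset_eq)
      then show "norm (f b - f a) \<le> L * (b - a)"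
        using L(2)[of b a] by simp
    qed
    also have "\<dots> = L * (\<Sum>(a, b)\<in>D. b - a)"
      by (simp add: sum_distrib_left case_prod_unfold)
    also have "\<dots> \<le> L * (e / (L + 1))"
      using less L(1) by (intro mult_left_mono) auto
    also have "\<dots> < e"
      using e L(1) by (simp add: field_simps)
    finally show ?thesis .
  qed
  then show "\<exists>\<delta>>0. \<forall>D. finite D \<longrightarrow> (\<forall>(a, b)\<in>D. a < b \<and> {a..b} \<subseteq> S) \<longrightarrow>
      pairwise (\<lambda>(a, b) (c, d). disjnt {a<..<b} {c<..<d}) D \<longrightarrow>
      (\<Sum>(a, b)\<in>D. b - a) < \<delta> \<longrightarrow> (\<Sum>(a, b)\<in>D. norm (f b - f a)) < e"
    using e L(1) by (intro exI[of _ "e / (L + 1)"]) auto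
qed

lemma locally_lipschitz_imp_locally_absolutely_continuous:
  "locally_lipschitz_curve S f \<Longrightarrow> locally_absolutely_continuous_on S f"
  unfolding locally_lipschitz_curve_def locally_absolutely_continuous_on_def
  using lipschitz_imp_absolutely_continuous by metis

lemma locally_lipschitz_curve_bounded_linear:
  "bounded_linear h \<Longrightarrow> locally_lipschitz_curve S f \<Longrightarrow> locally_lipschitz_curve S (\<lambda>t. h (f t))"
  unfolding locally_lipschitz_curve_def using lipschitz_curve_bounded_linear by metis

text \<open>The mean value inequality, on a ball so small that the continuous derivative stays below
  its norm at \<open>t\<^sub>0\<close> plus 1.\<close>

lemma smooth_imp_lipschitz:
  assumes S: "convex S" "t\<^sub>0 \<in> S" and f: "smooth_on S f"
  shows "\<forall>\<^sub>F d in at_right 0. lipschitz_curve (S \<inter> ball t\<^sub>0 d) f"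
proof -
  obtain f' where f': "smooth_on S f'" "\<And>t. t \<in> S \<Longrightarrow> (f has_vector_derivative f' t) (at t within S)"
    using smooth_on_derivative[OF f] by blast
  define L where "L = norm (f' t\<^sub>0) + 1"
  obtain r where r: "r > 0" "\<And>t. t \<in> S \<Longrightarrow> dist t t\<^sub>0 < r \<Longrightarrow> dist (f' t) (f' t\<^sub>0) < 1"
    using smooth_on_imp_continuous_on[OF f'(1)] S(2) unfolding continuous_on_iff
    by (meson zero_less_one)
  have "lipschitz_curve (S \<inter> ball t\<^sub>0 d) f" if "d < r" for d
  proof (rule lipschitz_curveI[of L])
    fix s t assume st: "s \<in> S \<inter> ball t\<^sub>0 d" "t \<in> S \<inter> ball t\<^sub>0 d"
    have "norm (f s - f t) \<le> L * norm (s - t)"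
    proof (rule differentiable_bound[OF _ _ _ st])
      show "convex (S \<inter> ball t\<^sub>0 d)"
        using S(1) by (intro convex_Int convex_ball)
      fix x assume x: "x \<in> S \<inter> ball t\<^sub>0 d"
      show "(f has_derivative (\<lambda>h. h *\<^sub>R f' x)) (at x within S \<inter> ball t\<^sub>0 d)"
        using has_vector_derivative_within_subset[OF f'(2)] x by (auto simp: has_vector_derivative_def)
      have "dist x t\<^sub>0 < r"
        using x that by (simp add: dist_commute)
      then have "norm (f' x) \<le> L"
        using r(2)[of x] x norm_triangle_sub[of "f' x" "f' t\<^sub>0"] by (simp add: L_def dist_norm)
      then show "onorm (\<lambda>h. h *\<^sub>R f' x) \<le> L"
        by (intro onorm_le) (simp add: mult.commute[of L] mult_left_mono)
    qed
    then show "norm (f s - f t) \<le> L * \<bar>s - t\<bar>"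
      by simp
  qed (simp add: L_def)
  then show ?thesis
    unfolding eventually_at_right_field using r(1) by blast
qed


subsection \<open>Continuation of eigensystems\<close>

text \<open>Pairing each eigenvalue with its eigenvector allows both to be glued by the same construction.\<close>

type_synonym 'n frame_curve = "'n \<Rightarrow> real \<Rightarrow> complex \<times> (complex^'n)"

definition eigen_curve :: "(real \<Rightarrow> complex^'n^'n) \<Rightarrow> real set \<Rightarrow> 'n frame_curve \<Rightarrow> bool" where
  "eigen_curve A S f \<longleftrightarrow> (\<forall>t\<in>S. eigen_system (A t) (\<lambda>j. fst (f j t)) (\<lambda>j. snd (f j t)))"

definition lipschitz_frame :: "(real \<Rightarrow> complex^'n^'n) \<Rightarrow> real set \<Rightarrow> 'n frame_curve \<Rightarrow> bool" where
  "lipschitz_frame A S f \<longleftrightarrow> eigen_curve A S f \<and> (\<forall>j. lipschitz_curve S (f j))"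

text \<open>The center is exempt in the second alternative, since eigenvalues of different blocks
  may meet there.\<close>

definition frame_chart :: "(real \<Rightarrow> complex^'n^'n) \<Rightarrow> real set \<Rightarrow> real \<Rightarrow> 'n frame_curve \<Rightarrow> bool" where
  "frame_chart A S t\<^sub>0 f \<longleftrightarrow> lipschitz_frame A S f \<and>
     (\<forall>i j. (\<forall>t\<in>S. fst (f i t) = fst (f j t)) \<or> (\<forall>t\<in>S. t \<noteq> t\<^sub>0 \<longrightarrow> fst (f i t) \<noteq> fst (f j t)))"

definition has_frame_charts :: "(real \<Rightarrow> complex^'n^'n) \<Rightarrow> real set \<Rightarrow> bool" where
  "has_frame_charts A I \<longleftrightarrow> (\<forall>t\<in>I. \<exists>d>0. \<exists>f. frame_chart A (I \<inter> ball t d) t f)"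

lemma eigen_curve_subset: "eigen_curve A S f \<Longrightarrow> T \<subseteq> S \<Longrightarrow> eigen_curve A T f"
  by (auto simp: eigen_curve_def)

lemma lipschitz_frame_subset: "lipschitz_frame A S f \<Longrightarrow> T \<subseteq> S \<Longrightarrow> lipschitz_frame A T f"
  by (auto simp: lipschitz_frame_def intro: eigen_curve_subset lipschitz_curve_subset)

lemma complex_basis_coefficients_zero:
  fixes e :: "'n \<Rightarrow> complex^'n"
  assumes "complex_basis e" "(\<Sum>k\<in>UNIV. c k *s e k) = 0"
  shows "c k = 0"
proof -
  define M where "M = (\<chi> i j. e j $ i)"
  have "invertible M"
    using assms(1) by (simp add: complex_basis_iff_det invertible_det_nz M_def)
  then obtain N where N: "N ** M = mat 1"
    by (auto simp: invertible_def)
  have "M *v (\<chi> k. c k) = 0"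
    using assms(2) by (simp add: matrix_vector_mult_def M_def vec_eq_iff mult.commute)
  then have "N *v (M *v (\<chi> k. c k)) = 0"
    by simp
  then have "(\<chi> k. c k) = 0"
    by (simp add: matrix_vector_mul_assoc N)
  then show ?thesis
    by (simp add: vec_eq_iff)
qed

text \<open>Away from the center of a chart, eigenvalues that agree at one point agree on the whole
  chart, so a constant change of basis within eigenspaces adapts the chart to any given
  eigensystem.\<close>

lemma frame_chart_rebase:
  fixes f :: "'n::finite frame_curve"
  assumes chart: "frame_chart A S t\<^sub>0 f" and y: "y \<in> S" "y \<noteq> t\<^sub>0"
    and e: "eigen_system (A y) l e"
  shows "\<exists>g. lipschitz_frame A S g \<and> (\<forall>j. g j y = (l j, e j))"
proof -
  have f: "eigen_curve A S f" "\<And>j. lipschitz_curve S (f j)"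
    using chart by (auto simp: frame_chart_def lipschitz_frame_def)
  have fy: "complex_basis (\<lambda>j. snd (f j y))" "\<And>j. A y *v snd (f j y) = fst (f j y) *s snd (f j y)"
    using f(1) y(1) by (auto simp: eigen_curve_def eigen_system_def)
  have e: "complex_basis e" "\<And>j. A y *v e j = l j *s e j"
    using e by (auto simp: eigen_system_def)
  have "\<forall>j. \<exists>c. e j = (\<Sum>k\<in>UNIV. c k *s snd (f k y))"
    using complex_basis_expand[OF fy(1)] by blast
  then obtain c where c: "\<And>j. e j = (\<Sum>k\<in>UNIV. c j k *s snd (f k y))"
    by metis
  \<comment> \<open>Expand \<open>A y *v e j\<close> in two ways in the basis of the chart at
    \<open>y\<close>: only vectors with the eigenvalue \<open>l j\<close> can enter the expansion of
    \<open>e j\<close>.\<close>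
  have match: "fst (f k y) = l j" if "c j k \<noteq> 0" for j k
  proof -
    have "(\<Sum>k\<in>UNIV. (c j k * fst (f k y)) *s snd (f k y)) = A y *v e j"
      unfolding c by (simp add: vec.sum vec.scale fy(2))
    also have "\<dots> = (\<Sum>k\<in>UNIV. (l j * c j k) *s snd (f k y))"
      unfolding e(2) by (subst c) (simp add: vec.scale_sum_right)
    finally have "(\<Sum>k\<in>UNIV. (c j k * fst (f k y) - l j * c j k) *s snd (f k y)) = 0"
      by (simp add: vec.scale_left_diff_distrib sum_subtractf)
    then have "c j k * fst (f k y) - l j * c j k = 0"
      by (rule complex_basis_coefficients_zero[OF fy(1)])
    with that show ?thesis
      by (simp add: mult.commute)
  qed
  have "\<exists>k. c j k \<noteq> 0" for j
  proof (rule ccontr)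
    assume "\<nexists>k. c j k \<noteq> 0"
    then have "e j = 0"
      by (subst c) simp
    with complex_basis_nonzero[OF e(1)] show False by blast
  qed
  then obtain m where m: "\<And>j. c j (m j) \<noteq> 0"
    by metis
  have same: "fst (f k t) = fst (f (m j) t)" if "c j k \<noteq> 0" "t \<in> S" for j k t
  proof -
    have "fst (f k y) = fst (f (m j) y)"
      using match[OF that(1)] match[OF m] by simp
    then show ?thesis
      using chart y that(2) unfolding frame_chart_def by blast
  qed
  \<comment> \<open>The coefficients found at \<open>y\<close> are kept constant. By
    \<open>same\<close>, all chart vectors that enter with nonzero coefficient have the eigenvalue
    of the index \<open>m j\<close> on the whole of \<open>S\<close>, so the combination remains an
    eigenvector.\<close>
  define g where "g j t = (fst (f (m j) t), \<Sum>k\<in>UNIV. c j k *s snd (f k t))" for j t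
  have gy: "g j y = (l j, e j)" for j
    using match[OF m] by (simp add: g_def c[symmetric])
  define C where "C = (\<chi> k j. c j k)"
  have det_g: "det (\<chi> i j. snd (g j t) $ i) = det (\<chi> i j. snd (f j t) $ i) * det C" for t
  proof -
    have "(\<chi> i j. snd (g j t) $ i) = (\<chi> i j. snd (f j t) $ i) ** C"
      by (simp add: vec_eq_iff matrix_matrix_mult_def g_def C_def mult.commute)
    then show ?thesis
      by (simp add: det_mul)
  qed
  have "det C \<noteq> 0"
    using det_g[of y] e(1) by (simp add: gy complex_basis_iff_det)
  have "eigen_curve A S g"
    unfolding eigen_curve_def eigen_system_def
  proof (intro ballI conjI allI)
    fix t assume t: "t \<in> S"
    have ft: "complex_basis (\<lambda>j. snd (f j t))" "\<And>j. A t *v snd (f j t) = fst (f j t) *s snd (f j t)"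
      using f(1) t by (auto simp: eigen_curve_def eigen_system_def)
    show "complex_basis (\<lambda>j. snd (g j t))"
      using ft(1) \<open>det C \<noteq> 0\<close> by (simp add: complex_basis_iff_det det_g)
    fix j
    have "A t *v snd (g j t) = (\<Sum>k\<in>UNIV. c j k *s (fst (f k t) *s snd (f k t)))"
      unfolding g_def snd_conv vec.sum vec.scale ft(2) ..
    also have "\<dots> = (\<Sum>k\<in>UNIV. fst (f (m j) t) *s (c j k *s snd (f k t)))"
    proof (rule sum.cong[OF refl])
      fix k
      show "c j k *s (fst (f k t) *s snd (f k t)) = fst (f (m j) t) *s (c j k *s snd (f k t))"
        using same[OF _ t, of j k] by (cases "c j k = 0") (auto simp: mult.commute)
    qed
    also have "\<dots> = fst (g j t) *s snd (g j t)"
      by (simp only: g_def fst_conv snd_conv vec.scale_sum_right)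
    finally show "A t *v snd (g j t) = fst (g j t) *s snd (g j t)" .
  qed
  moreover have "lipschitz_curve S (g j)" for j
  proof -
    have "bounded_linear (\<lambda>p :: complex \<times> (complex^'n). (0 :: complex, c j k *s snd p))" for k
      by (rule bounded_linearI') (auto simp: vec_eq_iff distrib_left)
    then have 1: "lipschitz_curve S (\<lambda>t. (0 :: complex, c j k *s snd (f k t)))" for k
      using f(2) by (rule lipschitz_curve_bounded_linear)
    have "bounded_linear (\<lambda>p :: complex \<times> (complex^'n). (fst p, 0 :: complex^'n))"
      by (rule bounded_linearI') auto
    then have 2: "lipschitz_curve S (\<lambda>t. (fst (f (m j) t), 0 :: complex^'n))"
      using f(2) by (rule lipschitz_curve_bounded_linear)
    \<comment> \<open>The index type \<open>'n option\<close> writes the pair \<open>g j t\<close>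
      as a single finite sum: \<open>None\<close> carries the eigenvalue, \<open>Some k\<close> the
      \<open>k\<close>-th term of the eigenvector.\<close>
    define h where "h x t = (case x of None \<Rightarrow> (fst (f (m j) t), 0) | Some k \<Rightarrow> (0, c j k *s snd (f k t)))" for x t
    have "lipschitz_curve S (\<lambda>t. \<Sum>x\<in>UNIV. h x t)"
    proof (rule lipschitz_curve_sum)
      show "lipschitz_curve S (h x)" for x
        using 1 2 by (cases x) (simp_all add: h_def[abs_def])
    qed simp
    moreover have "(\<Sum>x\<in>UNIV. h x t) = g j t" for t
      by (simp add: UNIV_option_conv sum.reindex h_def g_def prod_eq_iff fst_sum snd_sum)
    ultimately show ?thesis by simp
  qed
  ultimately show ?thesis
    using gy by (intro exI[of _ g]) (simp add: lipschitz_frame_def)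
qed

section \<open>Continuation of a frame to the whole interval\<close>

lemma lipschitz_frame_join:
  assumes "lipschitz_frame A (S \<inter> {..c}) f" "lipschitz_frame A (S \<inter> {c..}) g" "c \<in> S" "\<And>j. f j c = g j c"
  shows "lipschitz_frame A S (\<lambda>j t. if t \<le> c then f j t else g j t)"
proof -
  have "eigen_system (A t) (\<lambda>j. fst (if t \<le> c then f j t else g j t)) (\<lambda>j. snd (if t \<le> c then f j t else g j t))"
    if "t \<in> S" for t
    using assms that by (cases "t \<le> c") (auto simp: lipschitz_frame_def eigen_curve_def)
  then show ?thesis
    using assms by (auto simp: lipschitz_frame_def eigen_curve_def intro!: lipschitz_curve_join)
qed

text \<open>Agreement with \<open>f\<close> is kept only up to \<open>x < d\<close>. A chart can be
  adapted to a frame only at a point other than its center, and the center may be \<open>d\<close>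
  itself; so the old frame is left slightly before its end and is overwritten from there on.\<close>

lemma frame_extension:
  fixes f :: "'n::finite frame_curve"
  assumes charts: "has_frame_charts A I" and I: "is_interval I" "c \<in> I" "d' \<in> I"
    and f: "lipschitz_frame A {c..d} f" and x: "c \<le> x" "x < d" "d \<le> d'"
  shows "\<exists>g. lipschitz_frame A {c..d'} g \<and> (\<forall>j. \<forall>t\<in>{c..x}. g j t = f j t)"
proof -
  define K where "K b \<longleftrightarrow> (\<exists>g. lipschitz_frame A {c..b} g \<and> (\<forall>j. \<forall>t\<in>{c..x}. g j t = f j t))" for b
  have mem: "t \<in> I" if "c \<le> t" "t \<le> d'" for t
    using I that mem_is_interval_1_I by blast
  \<comment> \<open>The relation for the bisection principle: a frame that reaches \<open>a\<close>
    can be prolonged to \<open>b\<close>. It is transitive, and near each \<open>p\<close> it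
    follows from the chart centered at \<open>p\<close>.\<close>
  define L where "L a b \<longleftrightarrow> (d \<le> a \<and> b \<le> d' \<longrightarrow> K a \<longrightarrow> K b)" for a b
  have "L d d'"
    using x(3)
  proof (induction rule: Bolzano)
    case (trans a b c)
    then show ?case by (auto simp: L_def)
  next
    case (local p)
    then obtain r h where r: "r > 0" and h: "frame_chart A (I \<inter> ball p r) p h"
      using charts mem[of p] x unfolding has_frame_charts_def by force
    have "K b" if ab: "a \<le> p" "p \<le> b" "b - a < r" "d \<le> a" "b \<le> d'" and "K a" for a b
    proof -
      obtain g where g: "lipschitz_frame A {c..a} g" "\<And>j t. t \<in> {c..x} \<Longrightarrow> g j t = f j t"
        using \<open>K a\<close> by (auto simp: K_def)
      \<comment> \<open>This leaves room for a joint \<open>y\<close> inside the chart, beyond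
        \<open>x\<close>, and strictly before \<open>a \<le> p\<close>, hence different from the
        center.\<close>
      have "max x (p - r) < a"
        using ab x by auto
      then obtain y where y: "max x (p - r) < y" "y < a"
        using dense by blast
      have yU: "y \<in> I \<inter> ball p r" "y \<noteq> p"
        using y ab x mem[of y] by (auto simp: dist_real_def)
      have "eigen_system (A y) (\<lambda>j. fst (g j y)) (\<lambda>j. snd (g j y))"
        using g(1) y x by (auto simp: lipschitz_frame_def eigen_curve_def)
      from frame_chart_rebase[OF h yU this] obtain k where k: "lipschitz_frame A (I \<inter> ball p r) k"
          "\<And>j. k j y = g j y"
        by auto
      have "lipschitz_frame A ({c..b} \<inter> {..y}) g"
        by (rule lipschitz_frame_subset[OF g(1)]) (use y in auto)
      moreover have "lipschitz_frame A ({c..b} \<inter> {y..}) k"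
        by (rule lipschitz_frame_subset[OF k(1)]) (use y ab x mem in \<open>auto simp: dist_real_def\<close>)
      ultimately have "lipschitz_frame A {c..b} (\<lambda>j t. if t \<le> y then g j t else k j t)"
        by (rule lipschitz_frame_join) (use y ab x k(2) in auto)
      then show ?thesis
        unfolding K_def using g(2) y by (intro exI[of _ "\<lambda>j t. if t \<le> y then g j t else k j t"]) auto
    qed
    then show ?case
      by (intro exI[of _ r] conjI allI impI r) (auto simp: L_def)
  qed
  moreover have "K d"
    using f by (auto simp: K_def)
  ultimately show ?thesis
    by (simp add: K_def L_def)
qed

text \<open>One choice covers bounded and unbounded sets: \<open>s n\<close> exceeds
  \<open>n\<close> or lies within \<open>inverse (Suc n)\<close> of every larger element. To pass
  \<open>t\<close>, apply this to some \<open>u > t\<close> in \<open>R\<close> and to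
  \<open>n\<close> large compared with \<open>u\<close> and with the inverse of
  \<open>u - t\<close>.\<close>

lemma exists_cofinal_sequence:
  fixes R :: "real set"
  assumes ne: "R \<noteq> {}" and no_max: "\<And>t. t \<in> R \<Longrightarrow> \<exists>u\<in>R. t < u"
  shows "\<exists>s :: nat \<Rightarrow> real. (\<forall>n. s n \<in> R) \<and> (\<forall>t\<in>R. \<exists>n. t < s n)"
proof -
  have "\<exists>s\<in>R. real n \<le> s \<or> (\<forall>t\<in>R. t < s + inverse (Suc n))" for n
  proof (cases "bdd_above R")
    case True
    have "\<exists>s\<in>R. Sup R - inverse (Suc n) < s"
      using less_cSup_iff[OF ne True, of "Sup R - inverse (Suc n)"] by simp
    then obtain s where s: "s \<in> R" "Sup R - inverse (Suc n) < s"
      by blast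
    moreover have "t < s + inverse (Suc n)" if "t \<in> R" for t
      using cSup_upper[OF that True] s(2) by linarith
    ultimately show ?thesis by blast
  next
    case False
    then have "\<not> (\<forall>x\<in>R. x \<le> real n)"
      unfolding bdd_above_def by blast
    then show ?thesis
      by (auto simp: not_le intro: less_imp_le)
  qed
  then obtain s where s: "\<And>n. s n \<in> R" "\<And>n. real n \<le> s n \<or> (\<forall>t\<in>R. t < s n + inverse (Suc n))"
    by metis
  have "\<exists>n. t < s n" if t: "t \<in> R" for t
  proof -
    obtain u where u: "u \<in> R" "t < u"
      using no_max[OF t] by blast
    obtain n1 where n1: "inverse (Suc n1) < u - t"
      using reals_Archimedean[of "u - t"] u by auto
    obtain n2 :: nat where n2: "u < n2"
      using reals_Archimedean2 by blast
    define n where "n = max n1 n2"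
    have "inverse (real (Suc n)) \<le> inverse (Suc n1)"
      by (rule le_imp_inverse_le) (auto simp: n_def)
    moreover have "u < real n"
      using n2 by (simp add: n_def less_max_iff_disj)
    ultimately have "t < s n" if "real n \<le> s n \<or> u < s n + inverse (Suc n)"
      using that n1 u by linarith
    then show ?thesis
      using s(2)[of n] u(1) by blast
  qed
  with s(1) show ?thesis by blast
qed

definition local_frame :: "(real \<Rightarrow> complex^'n^'n) \<Rightarrow> real set \<Rightarrow> 'n frame_curve \<Rightarrow> bool" where
  "local_frame A S f \<longleftrightarrow> eigen_curve A S f \<and> (\<forall>j. locally_lipschitz_curve S (f j))"

text \<open>If \<open>I\<close> has a largest element, one extension suffices. Otherwise the frame
  is extended along a cofinal sequence. Each extension may change the end of the previous frame, but
  it leaves an initial part untouched, and these parts exhaust the half interval.\<close>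

lemma frame_right_half:
  fixes f :: "'n::finite frame_curve"
  assumes charts: "has_frame_charts A I" and I: "is_interval I" "c \<in> I" "d \<in> I" "c < d"
    and f: "lipschitz_frame A {c..d} f"
  shows "\<exists>g. local_frame A (I \<inter> {c..}) g \<and> (\<forall>j. g j c = f j c)"
proof (cases "\<exists>b\<in>I. \<forall>t\<in>I. t \<le> b")
  case True
  then obtain b where b: "b \<in> I" "\<And>t. t \<in> I \<Longrightarrow> t \<le> b"
    by blast
  obtain g where g: "lipschitz_frame A {c..b} g" "\<forall>j. \<forall>t\<in>{c..c}. g j t = f j t"
    using frame_extension[OF charts I(1,2) b(1) f, of c] I b(2) by auto
  have "I \<inter> {c..} \<subseteq> {c..b}"
    using b by auto
  with lipschitz_frame_subset[OF g(1)] have "lipschitz_frame A (I \<inter> {c..}) g"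
    by blast
  then show ?thesis
    using g(2) by (intro exI[of _ g]) (auto simp: lipschitz_frame_def local_frame_def lipschitz_imp_locally_lipschitz)
next
  case False
  then obtain s :: "nat \<Rightarrow> real" where s: "\<And>n. s n \<in> I" "\<And>t. t \<in> I \<Longrightarrow> \<exists>n. t < s n"
    using exists_cofinal_sequence[of I] I(2) by (metis empty_iff not_le)
  \<comment> \<open>A state \<open>(x, d, h)\<close> consists of a frame \<open>h\<close> on
    \<open>{c..d}\<close> whose values up to \<open>x\<close> are final. In the next state the old
    \<open>d\<close> takes the place of \<open>x\<close>, and the new end lies beyond
    \<open>s n\<close>.\<close>
  define P where "P n p \<longleftrightarrow> c \<le> fst p \<and> fst p < fst (snd p) \<and> fst (snd p) \<in> I \<and>
      lipschitz_frame A {c..fst (snd p)} (snd (snd p)) \<and> (\<forall>j. snd (snd p) j c = f j c)"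
    for n :: nat and p :: "real \<times> real \<times> 'n frame_curve"
  define Q where "Q n p q \<longleftrightarrow> fst q = fst (snd p) \<and> s n < fst (snd q) \<and>
      (\<forall>j. \<forall>t\<in>{c..fst p}. snd (snd q) j t = snd (snd p) j t)"
    for n :: nat and p q :: "real \<times> real \<times> 'n frame_curve"
  have "\<exists>F. \<forall>n. P n (F n) \<and> Q n (F n) (F (Suc n))"
  proof (rule dependent_nat_choice)
    show "\<exists>p. P 0 p"
      using I f by (intro exI[of _ "(c, d, f)"]) (simp add: P_def)
    fix p n assume p: "P n p"
    obtain d' where d': "d' \<in> I" "fst (snd p) < d'" "s n < d'"
    proof -
      have "max (fst (snd p)) (s n) \<in> I"
        using p s(1) by (auto simp: P_def max_def)
      then obtain d' where "d' \<in> I" "max (fst (snd p)) (s n) < d'"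
        using False by (meson not_le)
      then show ?thesis
        using that by auto
    qed
    obtain g where g: "lipschitz_frame A {c..d'} g" "\<forall>j. \<forall>t\<in>{c..fst p}. g j t = snd (snd p) j t"
      using frame_extension[OF charts I(1,2) d'(1), of "fst (snd p)" "snd (snd p)" "fst p"] p d'(2)
      by (auto simp: P_def)
    then show "\<exists>q. P (Suc n) q \<and> Q n p q"
      using p d' by (intro exI[of _ "(fst (snd p), d', g)"]) (auto simp: P_def Q_def)
  qed
  then obtain F where F: "\<And>n. P n (F n)" "\<And>n. Q n (F n) (F (Suc n))"
    by blast
  define X where "X n = fst (F n)" for n
  define G where "G n = snd (snd (F n))" for n
  have X: "c \<le> X n" "X n < X (Suc n)" for n
    using F(1)[of n] F(2)[of n] by (auto simp: P_def Q_def X_def)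
  have cofinal: "\<exists>n. t < X n" if "t \<in> I" for t
  proof -
    obtain n where "t < s n"
      using s(2) \<open>t \<in> I\<close> by blast
    also have "s n < X (Suc (Suc n))"
      using F(2)[of n] F(2)[of "Suc n"] by (simp add: Q_def X_def)
    finally show ?thesis ..
  qed
  have mono: "X n \<le> X m" if "n \<le> m" for n m
    by (rule lift_Suc_mono_le[of X, OF less_imp_le[OF X(2)] that])
  have frame: "lipschitz_frame A {c..X n} (G n)" for n
    by (rule lipschitz_frame_subset[of A "{c..fst (snd (F n))}"]) (use F(1)[of n] in \<open>auto simp: P_def X_def G_def\<close>)
  have agree: "G m j t = G n j t" if "n \<le> m" "t \<in> {c..X n}" for n m j t
    using that(1)
  proof (induction m rule: dec_induct)
    case (step m)
    have "t \<in> {c..X m}"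
      using that(2) mono[OF step.hyps(1)] by auto
    then have "G (Suc m) j t = G m j t"
      using F(2)[of m] by (auto simp: Q_def X_def G_def)
    with step show ?case by simp
  qed simp
  \<comment> \<open>The values at \<open>t\<close> no longer change once \<open>X n\<close> has
    reached \<open>t\<close>, so the first such stage gives the limit.\<close>
  define g where "g j t = G (LEAST n. t \<le> X n) j t" for j t
  have g: "g j t = G n j t" if t: "t \<in> {c..X n}" for n j t
  proof -
    have "t \<le> X (LEAST n. t \<le> X n)" "(LEAST n. t \<le> X n) \<le> n"
      using t LeastI[of "\<lambda>n. t \<le> X n" n] Least_le[of "\<lambda>n. t \<le> X n" n] by auto
    then show ?thesis
      using t agree[of "LEAST n. t \<le> X n" n t j] by (simp add: g_def)
  qed
  have "local_frame A (I \<inter> {c..}) g"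
    unfolding local_frame_def
  proof
    show "eigen_curve A (I \<inter> {c..}) g"
      unfolding eigen_curve_def
    proof
      fix t assume t: "t \<in> I \<inter> {c..}"
      then obtain n where "t < X n"
        using cofinal by blast
      then have "t \<in> {c..X n}"
        using t by auto
      then show "eigen_system (A t) (\<lambda>j. fst (g j t)) (\<lambda>j. snd (g j t))"
        using frame[of n] by (simp add: g[OF \<open>t \<in> {c..X n}\<close>] lipschitz_frame_def eigen_curve_def)
    qed
    show "\<forall>j. locally_lipschitz_curve (I \<inter> {c..}) (g j)"
      unfolding locally_lipschitz_curve_def
    proof (intro allI ballI)
      fix j t assume t: "t \<in> I \<inter> {c..}"
      then obtain n where n: "t < X n"
        using cofinal by blast
      have sub: "I \<inter> {c..} \<inter> ball t (X n - t) \<subseteq> {c..X n}"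
        by (auto simp: dist_real_def)
      have "lipschitz_curve {c..X n} (G n j)"
        using frame[of n] by (simp add: lipschitz_frame_def)
      then have "lipschitz_curve {c..X n} (g j)"
        by (rule lipschitz_curve_cong) (rule g[symmetric])
      then have "lipschitz_curve (I \<inter> {c..} \<inter> ball t (X n - t)) (g j)"
        using sub by (rule lipschitz_curve_subset)
      then show "\<exists>r>0. lipschitz_curve (I \<inter> {c..} \<inter> ball t r) (g j)"
        using n by (intro exI[of _ "X n - t"]) auto
    qed
  qed
  moreover have "g j c = f j c" for j
    using g[of c 0 j] X(1)[of 0] F(1)[of 0] by (simp add: P_def G_def)
  ultimately show ?thesis
    by blast
qed

lemma frame_right:
  fixes f :: "'n::finite frame_curve"
  assumes charts: "has_frame_charts A I" and I: "is_interval I" "c \<in> I"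
    and f: "lipschitz_frame A (I \<inter> ball c r) f" "r > 0"
  shows "\<exists>g. local_frame A (I \<inter> {c..}) g \<and> (\<forall>j. g j c = f j c)"
proof (cases "\<exists>b\<in>I. c < b")
  case True
  then obtain b where b: "b \<in> I" "c < b"
    by blast
  define d where "d = min b (c + r / 2)"
  have d: "c < d" "d \<in> I" "d < c + r"
    using b f(2) mem_is_interval_1_I[OF I b(1), of d] by (auto simp: d_def)
  have "{c..d} \<subseteq> I \<inter> ball c r"
    using d mem_is_interval_1_I[OF I d(2)] by (auto simp: dist_real_def)
  with f(1) have "lipschitz_frame A {c..d} f"
    by (rule lipschitz_frame_subset)
  then show ?thesis
    using frame_right_half[OF charts I d(2,1)] by blast
next
  case False
  then have "I \<inter> {c..} \<subseteq> I \<inter> ball c r"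
    using f(2) by (auto simp: not_less)
  with f(1) have "lipschitz_frame A (I \<inter> {c..}) f"
    by (rule lipschitz_frame_subset)
  then show ?thesis
    by (intro exI[of _ f]) (auto simp: lipschitz_frame_def local_frame_def lipschitz_imp_locally_lipschitz)
qed

section \<open>Reflection of the interval and the global frame\<close>

lemma lipschitz_curve_reflect: "lipschitz_curve S f \<Longrightarrow> lipschitz_curve (uminus ` S) (\<lambda>t. f (- t))"
  unfolding lipschitz_curve_def by (fastforce simp: abs_minus_commute)

lemma eigen_curve_reflect: "eigen_curve A S f \<Longrightarrow> eigen_curve (\<lambda>t. A (- t)) (uminus ` S) (\<lambda>j t. f j (- t))"
  by (simp add: eigen_curve_def)

lemma lipschitz_frame_reflect:
  "lipschitz_frame A S f \<Longrightarrow> lipschitz_frame (\<lambda>t. A (- t)) (uminus ` S) (\<lambda>j t. f j (- t))"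
  by (simp add: lipschitz_frame_def eigen_curve_reflect lipschitz_curve_reflect)

lemma uminus_Int_ball: "uminus ` (I \<inter> ball t d) = uminus ` I \<inter> ball (- t) d" for t :: real
proof -
  have "x \<in> uminus ` S \<longleftrightarrow> - x \<in> S" for x :: real and S
    by (auto intro: image_eqI[of x uminus "- x"])
  then show ?thesis
    by (auto simp: set_eq_iff dist_real_def)
qed

lemma has_frame_charts_reflect:
  assumes "has_frame_charts A I"
  shows "has_frame_charts (\<lambda>t. A (- t)) (uminus ` I)"
  unfolding has_frame_charts_def
proof
  fix t assume "t \<in> uminus ` I"
  then have "- t \<in> I" by auto
  then obtain d f where d: "d > 0" and f: "frame_chart A (I \<inter> ball (- t) d) (- t) f"
    using assms by (auto simp: has_frame_charts_def)
  have "frame_chart (\<lambda>t. A (- t)) (uminus ` (I \<inter> ball (- t) d)) t (\<lambda>j t. f j (- t))"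
    unfolding frame_chart_def
  proof
    show "lipschitz_frame (\<lambda>t. A (- t)) (uminus ` (I \<inter> ball (- t) d)) (\<lambda>j t. f j (- t))"
      using f by (intro lipschitz_frame_reflect) (simp add: frame_chart_def)
    show "\<forall>i j. (\<forall>s\<in>uminus ` (I \<inter> ball (- t) d). fst (f i (- s)) = fst (f j (- s))) \<or>
        (\<forall>s\<in>uminus ` (I \<inter> ball (- t) d). s \<noteq> t \<longrightarrow> fst (f i (- s)) \<noteq> fst (f j (- s)))"
    proof (intro allI)
      fix i j
      have "(\<forall>s\<in>I \<inter> ball (- t) d. fst (f i s) = fst (f j s)) \<or>
          (\<forall>s\<in>I \<inter> ball (- t) d. s \<noteq> - t \<longrightarrow> fst (f i s) \<noteq> fst (f j s))"
        using f unfolding frame_chart_def by blast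
      then show "(\<forall>s\<in>uminus ` (I \<inter> ball (- t) d). fst (f i (- s)) = fst (f j (- s))) \<or>
          (\<forall>s\<in>uminus ` (I \<inter> ball (- t) d). s \<noteq> t \<longrightarrow> fst (f i (- s)) \<noteq> fst (f j (- s)))"
        by (simp only: ball_simps minus_minus minus_equation_iff[of _ t]) metis
    qed
  qed
  then show "\<exists>d>0. \<exists>f. frame_chart (\<lambda>t. A (- t)) (uminus ` I \<inter> ball t d) t f"
    using d unfolding uminus_Int_ball by auto
qed

text \<open>A single chart at \<open>c\<close> prescribes the values at \<open>c\<close> for the
  continuation to the right and, through the reflected curve, for the one to the left. Both halves
  therefore agree at \<open>c\<close>, and their join is Lipschitz near \<open>c\<close>.\<close>

theorem global_frame:
  assumes charts: "has_frame_charts A I" and I: "is_interval I"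
  shows "\<exists>f. local_frame A I f"
proof (cases "I = {}")
  case True
  then show ?thesis
    by (simp add: local_frame_def eigen_curve_def locally_lipschitz_curve_def)
next
  case False
  then obtain c where c: "c \<in> I" by blast
  then obtain r f where r: "r > 0" and "frame_chart A (I \<inter> ball c r) c f"
    using charts by (auto simp: has_frame_charts_def)
  then have f: "lipschitz_frame A (I \<inter> ball c r) f"
    by (simp add: frame_chart_def)
  obtain g where g: "local_frame A (I \<inter> {c..}) g" "\<And>j. g j c = f j c"
    using frame_right[OF charts I c f r] by blast
  have "is_interval (uminus ` I)"
    using I convex_negations[of I] by (simp add: is_interval_convex_1)
  moreover have "lipschitz_frame (\<lambda>t. A (- t)) (uminus ` I \<inter> ball (- c) r) (\<lambda>j t. f j (- t))"
    using lipschitz_frame_reflect[OF f] by (simp add: uminus_Int_ball)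
  ultimately obtain h where h: "local_frame (\<lambda>t. A (- t)) (uminus ` I \<inter> {- c..}) h" "\<And>j. h j (- c) = f j c"
    using frame_right[OF has_frame_charts_reflect[OF charts], of "- c" r "\<lambda>j t. f j (- t)"] c r by auto
  have hE: "eigen_system (A t) (\<lambda>j. fst (h j (- t))) (\<lambda>j. snd (h j (- t)))" if "t \<in> I" "t \<le> c" for t
    using h(1) that unfolding local_frame_def eigen_curve_def by force
  have hL: "\<exists>r>0. lipschitz_curve (I \<inter> {..c} \<inter> ball t r) (\<lambda>t. h j (- t))" if "t \<in> I" "t \<le> c" for t j
  proof -
    have "- t \<in> uminus ` I \<inter> {- c..}"
      using that by auto
    then obtain r where r: "r > 0" "lipschitz_curve (uminus ` I \<inter> {- c..} \<inter> ball (- t) r) (h j)"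
      using h(1) unfolding local_frame_def locally_lipschitz_curve_def by blast
    have "I \<inter> {..c} \<inter> ball t r \<subseteq> uminus ` (uminus ` I \<inter> {- c..} \<inter> ball (- t) r)"
    proof
      fix s assume "s \<in> I \<inter> {..c} \<inter> ball t r"
      then have "- s \<in> uminus ` I \<inter> {- c..} \<inter> ball (- t) r"
        by (auto simp: dist_real_def)
      then show "s \<in> uminus ` (uminus ` I \<inter> {- c..} \<inter> ball (- t) r)"
        by (rule rev_image_eqI) simp
    qed
    with lipschitz_curve_reflect[OF r(2)] have "lipschitz_curve (I \<inter> {..c} \<inter> ball t r) (\<lambda>t. h j (- t))"
      by (rule lipschitz_curve_subset)
    with r(1) show ?thesis by blast
  qed
  have gL: "\<exists>r>0. lipschitz_curve (I \<inter> {c..} \<inter> ball t r) (g j)" if "t \<in> I" "c \<le> t" for t j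
    using g(1) that unfolding local_frame_def locally_lipschitz_curve_def by simp
  define k where "k j t = (if t \<le> c then h j (- t) else g j t)" for j t
  have "eigen_curve A I k"
    unfolding eigen_curve_def
  proof
    fix t assume "t \<in> I"
    then show "eigen_system (A t) (\<lambda>j. fst (k j t)) (\<lambda>j. snd (k j t))"
      using hE g(1) by (cases "t \<le> c") (auto simp: eigen_curve_def k_def local_frame_def)
  qed
  moreover have "locally_lipschitz_curve I (k j)" for j
    unfolding locally_lipschitz_curve_def
  proof
    fix t assume t: "t \<in> I"
    consider "t < c" | "t = c" | "t > c" by linarith
    then show "\<exists>r>0. lipschitz_curve (I \<inter> ball t r) (k j)"
    proof cases
      case 1
      then obtain r where r: "r > 0" "lipschitz_curve (I \<inter> {..c} \<inter> ball t r) (\<lambda>t. h j (- t))"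
        using hL[OF t, of j] by auto
      have "lipschitz_curve (I \<inter> ball t (min r (c - t))) (\<lambda>t. h j (- t))"
        by (rule lipschitz_curve_subset[OF r(2)]) (auto simp: dist_real_def)
      then have "lipschitz_curve (I \<inter> ball t (min r (c - t))) (k j)"
        by (rule lipschitz_curve_cong) (auto simp: k_def dist_real_def)
      then show ?thesis
        using r(1) 1 by (intro exI[of _ "min r (c - t)"]) auto
    next
      case 2
      obtain r1 where r1: "r1 > 0" "lipschitz_curve (I \<inter> {..c} \<inter> ball c r1) (\<lambda>t. h j (- t))"
        using hL[OF t, of j] 2 by auto
      obtain r2 where r2: "r2 > 0" "lipschitz_curve (I \<inter> {c..} \<inter> ball c r2) (g j)"
        using gL[OF c, of j] by auto
      define r where "r = min r1 r2"
      have "lipschitz_curve (I \<inter> ball c r) (\<lambda>t. if t \<le> c then h j (- t) else g j t)"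
      proof (rule lipschitz_curve_join)
        show "lipschitz_curve (I \<inter> ball c r \<inter> {..c}) (\<lambda>t. h j (- t))"
          by (rule lipschitz_curve_subset[OF r1(2)]) (auto simp: r_def)
        show "lipschitz_curve (I \<inter> ball c r \<inter> {c..}) (g j)"
          by (rule lipschitz_curve_subset[OF r2(2)]) (auto simp: r_def)
      qed (use c r1 r2 g(2) h(2) in \<open>auto simp: r_def\<close>)
      then show ?thesis
        using r1(1) r2(1) 2 by (intro exI[of _ r]) (auto simp: k_def[abs_def] r_def)
    next
      case 3
      then obtain r where r: "r > 0" "lipschitz_curve (I \<inter> {c..} \<inter> ball t r) (g j)"
        using gL[OF t, of j] by auto
      have "lipschitz_curve (I \<inter> ball t (min r (t - c))) (g j)"
        by (rule lipschitz_curve_subset[OF r(2)]) (auto simp: dist_real_def)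
      then have "lipschitz_curve (I \<inter> ball t (min r (t - c))) (k j)"
        by (rule lipschitz_curve_cong) (auto simp: k_def dist_real_def)
      then show ?thesis
        using r(1) 3 by (intro exI[of _ "min r (t - c)"]) auto
    qed
  qed
  ultimately show ?thesis
    by (intro exI[of _ k]) (simp add: local_frame_def)
qed

section \<open>Local and global parameterizations\<close>

lemma lipschitz_curve_Pair:
  assumes "lipschitz_curve S f" "lipschitz_curve S g"
  shows "lipschitz_curve S (\<lambda>t. (f t, g t))"
proof -
  obtain L where L: "L \<ge> 0" "\<And>s t. s \<in> S \<Longrightarrow> t \<in> S \<Longrightarrow> norm (f s - f t) \<le> L * \<bar>s - t\<bar>"
    using assms(1) by (auto simp: lipschitz_curve_def)
  obtain M where M: "M \<ge> 0" "\<And>s t. s \<in> S \<Longrightarrow> t \<in> S \<Longrightarrow> norm (g s - g t) \<le> M * \<bar>s - t\<bar>"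
    using assms(2) by (auto simp: lipschitz_curve_def)
  show ?thesis
  proof (rule lipschitz_curveI[of "L + M"])
    fix s t assume "s \<in> S" "t \<in> S"
    then show "norm ((f s, g s) - (f t, g t)) \<le> (L + M) * \<bar>s - t\<bar>"
      using L(2)[of s t] M(2)[of s t] norm_Pair_le[of "f s - f t" "g s - g t"]
      by (simp add: distrib_right)
  qed (use L M in simp)
qed

lemma smooth_has_frame_charts:
  fixes A :: "real \<Rightarrow> complex^'n^'n"
  assumes I: "is_interval I" "\<And>t. t \<in> I \<Longrightarrow> t islimpt I"
    and A: "smooth_on I A" "\<And>t. t \<in> I \<Longrightarrow> normal_matrix (A t)" "generic_matrix_curve I A"
  shows "has_frame_charts A I"
  unfolding has_frame_charts_def
proof
  fix t assume t: "t \<in> I"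
  obtain d ev v where d: "d > 0"
    and smooth: "\<And>j :: 'n. smooth_on (I \<inter> ball t d) (ev j)" "\<And>j. smooth_on (I \<inter> ball t d) (v j)"
    and eig: "\<And>s. s \<in> I \<inter> ball t d \<Longrightarrow> eigen_system (A s) (\<lambda>j. ev j s) (\<lambda>j. v j s)"
    and sep: "\<And>i j. ev i = ev j \<or> (\<forall>s\<in>I \<inter> ball t d. s \<noteq> t \<longrightarrow> ev i s \<noteq> ev j s)"
    using smooth_chart[OF I(1) t I(2)[OF t] A] by blast
  have S: "convex (I \<inter> ball t d)" "t \<in> I \<inter> ball t d"
    using I(1) t d by (auto simp: is_interval_convex_1 intro: convex_Int)
  have "\<forall>\<^sub>F e in at_right 0. \<forall>j. lipschitz_curve (I \<inter> ball t d \<inter> ball t e) (ev j)"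
    "\<forall>\<^sub>F e in at_right 0. \<forall>j. lipschitz_curve (I \<inter> ball t d \<inter> ball t e) (v j)"
    by (intro eventually_all_finite smooth_imp_lipschitz S smooth)+
  then have "\<forall>\<^sub>F e in at_right 0. \<forall>j. lipschitz_curve (I \<inter> ball t d \<inter> ball t e) (\<lambda>s. (ev j s, v j s))"
    by eventually_elim (simp add: lipschitz_curve_Pair)
  then obtain e where e: "e > 0" "\<forall>j. lipschitz_curve (I \<inter> ball t d \<inter> ball t e) (\<lambda>s. (ev j s, v j s))"
    by (rule obtain_radius)
  have eq: "I \<inter> ball t (min d e) = I \<inter> ball t d \<inter> ball t e"
    by auto
  have "frame_chart A (I \<inter> ball t (min d e)) t (\<lambda>j s. (ev j s, v j s))"
    unfolding frame_chart_def lipschitz_frame_def eigen_curve_def eq fst_conv snd_conv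
  proof (intro conjI allI ballI)
    show "lipschitz_curve (I \<inter> ball t d \<inter> ball t e) (\<lambda>s. (ev j s, v j s))" for j
      using e(2) by blast
    show "eigen_system (A s) (\<lambda>j. ev j s) (\<lambda>j. v j s)" if "s \<in> I \<inter> ball t d \<inter> ball t e" for s
      using that by (intro eig) simp
    show "(\<forall>s\<in>I \<inter> ball t d \<inter> ball t e. ev i s = ev j s) \<or>
        (\<forall>s\<in>I \<inter> ball t d \<inter> ball t e. s \<noteq> t \<longrightarrow> ev i s \<noteq> ev j s)" for i j
      using sep[of i j] by auto
  qed
  then show "\<exists>d>0. \<exists>f. frame_chart A (I \<inter> ball t d) t f"
    using d e(1) by (intro exI[of _ "min d e"]) auto
qed

lemma has_eigen_parameterizationI:
  fixes B :: "real \<Rightarrow> complex^'n^'n"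
  assumes "\<And>j :: 'n. reg_val S (ev j)" "\<And>j. reg_vec S (v j)"
    "\<And>t. t \<in> S \<Longrightarrow> eigen_system (B t) (\<lambda>j. ev j t) (\<lambda>j. v j t)"
  shows "has_eigen_parameterization reg_val reg_vec S B"
  unfolding has_eigen_parameterization_def
  using assms by (intro exI[of _ ev] exI[of _ v]) (auto simp: eigen_system_def complex_basis_def)

text \<open>Serves the interval with a single point, which is no limit point of it, so that germs at
  that point are not covered by \<open>regular_germs\<close>.\<close>

lemma has_eigen_parameterization_const:
  fixes M :: "complex^'n^'n"
  assumes "normal_matrix M" "\<And>t. t \<in> S \<Longrightarrow> B t = M"
    and "\<And>c. reg_val S (\<lambda>t. c)" "\<And>c. reg_vec S (\<lambda>t. c)"
  shows "has_eigen_parameterization reg_val reg_vec S B"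
proof -
  obtain e l where "complex_basis e" "\<And>j. M *v e j = l j *s e j"
    using normal_matrix_exists_eigenbasis[OF assms(1)] by blast
  then show ?thesis
    using assms(2-4)
    by (intro has_eigen_parameterizationI[of _ _ "\<lambda>j t. l j" _ "\<lambda>j t. e j"]) (auto simp: eigen_system_def)
qed

lemma real_analytic_on_const: "real_analytic_on S (\<lambda>t. c)"
  unfolding real_analytic_on_def
proof
  fix t1
  have "(\<lambda>k. (t - t1) ^ k *\<^sub>R (if k = 0 then c else 0)) = (\<lambda>k. if k = 0 then c else 0)" for t
    by auto
  then have "(\<lambda>k. (t - t1) ^ k *\<^sub>R (if k = 0 then c else 0)) sums c" for t
    using sums_single[of 0 "\<lambda>_. c"] by simp
  then show "\<exists>r>0. \<exists>a. \<forall>t\<in>S \<inter> ball t1 r. (\<lambda>k. (t - t1) ^ k *\<^sub>R a k) sums c"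
    by (intro exI[of _ 1] conjI exI[of _ "\<lambda>k. if k = 0 then c else 0"]) auto
qed

lemma locally_absolutely_continuous_on_const: "locally_absolutely_continuous_on S (\<lambda>t. c)"
  by (intro locally_lipschitz_imp_locally_absolutely_continuous lipschitz_imp_locally_lipschitz
      lipschitz_curveI[of 0]) auto

text \<open>The chain rule for an affine substitution contributes the factor \<open>s ^ k\<close> to
  the \<open>k\<close>-th derivative. It is applied to the identity and to the reflection at
  \<open>t\<^sub>0\<close>.\<close>

lemma smooth_on_affine:
  assumes "smooth_on S f" "\<And>t. t \<in> T \<Longrightarrow> a + s * (t - b) \<in> S"
  shows "smooth_on T (\<lambda>t. f (a + s * (t - b)))"
proof -
  obtain F where F: "\<And>t. t \<in> S \<Longrightarrow> F 0 t = f t"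
      "\<And>k t. t \<in> S \<Longrightarrow> (F k has_vector_derivative F (Suc k) t) (at t within S)"
    using assms(1) by (auto simp: smooth_on_def)
  have "((\<lambda>t. s ^ k *\<^sub>R F k (a + s * (t - b))) has_vector_derivative s ^ Suc k *\<^sub>R F (Suc k) (a + s * (t - b)))
      (at t within T)" if t: "t \<in> T" for k t
  proof -
    have "((\<lambda>t. a + s * (t - b)) has_vector_derivative s) (at t within T)"
      by (auto intro!: derivative_eq_intros simp: has_real_derivative_iff_has_vector_derivative[symmetric])
    moreover have "(F k has_vector_derivative F (Suc k) (a + s * (t - b))) (at (a + s * (t - b)) within (\<lambda>t. a + s * (t - b)) ` T)"
      by (rule has_vector_derivative_within_subset[OF F(2)]) (use assms(2) t in auto)
    ultimately have "((F k \<circ> (\<lambda>t. a + s * (t - b))) has_vector_derivative s *\<^sub>R F (Suc k) (a + s * (t - b))) (at t within T)"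
      by (rule vector_diff_chain_within)
    then have "((\<lambda>t. s ^ k *\<^sub>R F k (a + s * (t - b))) has_vector_derivative s ^ k *\<^sub>R (s *\<^sub>R F (Suc k) (a + s * (t - b)))) (at t within T)"
      unfolding comp_def by (rule bounded_linear.has_vector_derivative[OF bounded_linear_scaleR_right])
    then show ?thesis
      by (simp add: mult.commute)
  qed
  then show ?thesis
    unfolding smooth_on_def using F(1) assms(2)
    by (intro exI[of _ "\<lambda>k t. s ^ k *\<^sub>R F k (a + s * (t - b))"]) auto
qed

text \<open>For \<open>\<bar>s\<bar> = 1\<close> the substitution is an isometry, so the radius is
  unchanged; the \<open>k\<close>-th coefficient is multiplied by \<open>s ^ k\<close>.\<close>

lemma real_analytic_on_affine:
  assumes "real_analytic_on S f" "\<And>t. t \<in> T \<Longrightarrow> a + s * (t - b) \<in> S" "\<bar>s\<bar> = 1"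
  shows "real_analytic_on T (\<lambda>t. f (a + s * (t - b)))"
  unfolding real_analytic_on_def
proof
  fix t1 assume "t1 \<in> T"
  then obtain r c where r: "r > 0" "\<forall>t\<in>S \<inter> ball (a + s * (t1 - b)) r.
      (\<lambda>k. (t - (a + s * (t1 - b))) ^ k *\<^sub>R c k) sums f t"
    using assms(1,2) unfolding real_analytic_on_def by blast
  have "(\<lambda>k. (t - t1) ^ k *\<^sub>R (s ^ k *\<^sub>R c k)) sums f (a + s * (t - b))" if "t \<in> T \<inter> ball t1 r" for t
  proof -
    have diff: "a + s * (t - b) - (a + s * (t1 - b)) = s * (t - t1)"
      by (simp add: algebra_simps)
    have "dist (a + s * (t1 - b)) (a + s * (t - b)) = \<bar>s * (t - t1)\<bar>"
      unfolding diff[symmetric] dist_real_def by (rule abs_minus_commute)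
    then have "dist (a + s * (t1 - b)) (a + s * (t - b)) = dist t1 t"
      using assms(3) by (simp add: abs_mult dist_real_def)
    then have "a + s * (t - b) \<in> S \<inter> ball (a + s * (t1 - b)) r"
      using that assms(2)[of t] by simp
    from r(2)[rule_format, OF this]
    have "(\<lambda>k. (s * (t - t1)) ^ k *\<^sub>R c k) sums f (a + s * (t - b))"
      unfolding diff .
    then show ?thesis
      by (simp add: power_mult_distrib mult.commute)
  qed
  with r(1) show "\<exists>r>0. \<exists>c. \<forall>t\<in>T \<inter> ball t1 r. (\<lambda>k. (t - t1) ^ k *\<^sub>R c k) sums f (a + s * (t - b))"
    by (intro exI[of _ r] conjI exI[of _ "\<lambda>k. s ^ k *\<^sub>R c k"] ballI)
qed

lemma has_eigen_parameterization_affine: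
  fixes B :: "real \<Rightarrow> complex^'n^'n"
  assumes "\<And>j :: 'n. reg_val S (ev j)" "\<And>j. reg_vec S (v j)"
    and "\<And>t. t \<in> S \<Longrightarrow> eigen_system (B t) (\<lambda>j. ev j t) (\<lambda>j. v j t)"
    and "\<And>t. t \<in> T \<Longrightarrow> h t \<in> S"
    and "\<And>f. reg_val S f \<Longrightarrow> reg_val T (\<lambda>t. f (h t))" "\<And>f. reg_vec S f \<Longrightarrow> reg_vec T (\<lambda>t. f (h t))"
  shows "has_eigen_parameterization reg_val reg_vec T (\<lambda>t. B (h t))"
  using assms by (intro has_eigen_parameterizationI[of _ _ "\<lambda>j t. ev j (h t)" _ "\<lambda>j t. v j (h t)"]) auto

theorem theorem6p2:
  fixes I :: "real set" and A :: "real \<Rightarrow> complex^'n^'n"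
  assumes "is_interval I"
    and "smooth_on I A"
    and "\<And>t. t \<in> I \<Longrightarrow> normal_matrix (A t)"
    and "generic_matrix_curve I A"
  shows "(\<forall>t\<^sub>0\<in>I. \<exists>N>0. \<forall>s\<in>{1, - 1}.
            (\<exists>\<delta>>0. has_eigen_parameterization smooth_on smooth_on
                     (power_domain I t\<^sub>0 s N \<inter> ball t\<^sub>0 \<delta>) (\<lambda>t. A (t\<^sub>0 + s * (t - t\<^sub>0) ^ N))) \<and>
            (real_analytic_on I A \<longrightarrow>
              (\<exists>\<delta>>0. has_eigen_parameterization real_analytic_on real_analytic_on
                       (power_domain I t\<^sub>0 s N \<inter> ball t\<^sub>0 \<delta>) (\<lambda>t. A (t\<^sub>0 + s * (t - t\<^sub>0) ^ N))))) \<and>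
         has_eigen_parameterization locally_absolutely_continuous_on
           locally_absolutely_continuous_on I A"
proof -
  have interval: "is_interval I" and smooth: "smooth_on I A"
    and normal: "\<And>t. t \<in> I \<Longrightarrow> normal_matrix (A t)" and generic: "generic_matrix_curve I A"
    using assms by blast+
  show ?thesis
  proof (cases "\<exists>t\<^sub>0\<in>I. \<not> t\<^sub>0 islimpt I")
    case True
    then obtain t\<^sub>0 where t0: "t\<^sub>0 \<in> I" "\<not> t\<^sub>0 islimpt I"
      by blast
    \<comment> \<open>In a connected set with more than one point every point is a limit point, so
      this case concerns only a one-point interval.\<close>
    have "\<not> (\<forall>x. I \<noteq> {x})"
      using connected_imp_perfect[of I t\<^sub>0] t0 is_interval_connected[OF interval] by blast
    with t0(1) have I: "I = {t\<^sub>0}"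
      by auto
    have dom: "A (t + s * (u - t) ^ 1) = A t\<^sub>0" if "t \<in> I" "u \<in> power_domain I t s 1 \<inter> ball t 1" for s t u
      using that by (auto simp: power_domain_def I)
    note const = has_eigen_parameterization_const[OF normal[OF t0(1)] dom]
    have "\<exists>\<delta>>0. has_eigen_parameterization smooth_on smooth_on
        (power_domain I t s 1 \<inter> ball t \<delta>) (\<lambda>u. A (t + s * (u - t) ^ 1))" if "t \<in> I" for t s
      by (intro exI[of _ 1] conjI const that smooth_on_const) simp
    moreover have "\<exists>\<delta>>0. has_eigen_parameterization real_analytic_on real_analytic_on
        (power_domain I t s 1 \<inter> ball t \<delta>) (\<lambda>u. A (t + s * (u - t) ^ 1))" if "t \<in> I" for t s
      by (intro exI[of _ 1] conjI const that real_analytic_on_const) simp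
    moreover have "has_eigen_parameterization locally_absolutely_continuous_on locally_absolutely_continuous_on I A"
      by (rule has_eigen_parameterization_const[OF normal[OF t0(1)]])
        (simp_all add: I locally_absolutely_continuous_on_const)
    ultimately show ?thesis
      by (intro conjI ballI exI[of _ "1 :: nat"] impI) simp_all
  next
    case False
    then have limpt: "\<And>t. t \<in> I \<Longrightarrow> t islimpt I"
      by blast
    have "\<exists>\<delta>>0. has_eigen_parameterization smooth_on smooth_on
        (power_domain I t\<^sub>0 s 1 \<inter> ball t\<^sub>0 \<delta>) (\<lambda>t. A (t\<^sub>0 + s * (t - t\<^sub>0) ^ 1))"
      if t0: "t\<^sub>0 \<in> I" and s: "s \<in> {1, - 1}" for t\<^sub>0 s :: real
    proof -
      obtain d ev v where d: "d > 0"
        and reg: "\<And>j :: 'n. smooth_on (I \<inter> ball t\<^sub>0 d) (ev j)" "\<And>j. smooth_on (I \<inter> ball t\<^sub>0 d) (v j)"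
        and eig: "\<And>t. t \<in> I \<inter> ball t\<^sub>0 d \<Longrightarrow> eigen_system (A t) (\<lambda>j. ev j t) (\<lambda>j. v j t)"
        using smooth_chart[OF interval t0 limpt[OF t0] smooth normal generic] by blast
      \<comment> \<open>With exponent 1 the substitution is the identity or the reflection at
        \<open>t\<^sub>0\<close>, and both preserve the ball around
        \<open>t\<^sub>0\<close>.\<close>
      have mem: "t\<^sub>0 + s * (t - t\<^sub>0) \<in> I \<inter> ball t\<^sub>0 d" if "t \<in> power_domain I t\<^sub>0 s 1 \<inter> ball t\<^sub>0 d" for t
        using that s by (auto simp: power_domain_def dist_real_def)
      have "has_eigen_parameterization smooth_on smooth_on
          (power_domain I t\<^sub>0 s 1 \<inter> ball t\<^sub>0 d) (\<lambda>t. A (t\<^sub>0 + s * (t - t\<^sub>0)))"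
      proof (rule has_eigen_parameterization_affine[where B = A and h = "\<lambda>t. t\<^sub>0 + s * (t - t\<^sub>0)"])
        show "smooth_on (power_domain I t\<^sub>0 s 1 \<inter> ball t\<^sub>0 d) (\<lambda>t. f (t\<^sub>0 + s * (t - t\<^sub>0)))"
          if "smooth_on (I \<inter> ball t\<^sub>0 d) f" for f :: "real \<Rightarrow> complex"
          using that mem by (rule smooth_on_affine)
        show "smooth_on (power_domain I t\<^sub>0 s 1 \<inter> ball t\<^sub>0 d) (\<lambda>t. f (t\<^sub>0 + s * (t - t\<^sub>0)))"
          if "smooth_on (I \<inter> ball t\<^sub>0 d) f" for f :: "real \<Rightarrow> complex^'n"
          using that mem by (rule smooth_on_affine)
      qed (fact reg eig mem)+
      then show ?thesis
        using d by auto
    qed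
    moreover have "\<exists>\<delta>>0. has_eigen_parameterization real_analytic_on real_analytic_on
        (power_domain I t\<^sub>0 s 1 \<inter> ball t\<^sub>0 \<delta>) (\<lambda>t. A (t\<^sub>0 + s * (t - t\<^sub>0) ^ 1))"
      if t0: "t\<^sub>0 \<in> I" and s: "s \<in> {1, - 1}" and analytic: "real_analytic_on I A" for t\<^sub>0 s :: real
    proof -
      obtain d ev v where d: "d > 0"
        and reg: "\<And>j :: 'n. real_analytic_on (I \<inter> ball t\<^sub>0 d) (ev j)" "\<And>j. real_analytic_on (I \<inter> ball t\<^sub>0 d) (v j)"
        and eig: "\<And>t. t \<in> I \<inter> ball t\<^sub>0 d \<Longrightarrow> eigen_system (A t) (\<lambda>j. ev j t) (\<lambda>j. v j t)"
        using analytic_chart[OF t0 limpt[OF t0] analytic smooth normal generic] by blast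
      have mem: "t\<^sub>0 + s * (t - t\<^sub>0) \<in> I \<inter> ball t\<^sub>0 d" if "t \<in> power_domain I t\<^sub>0 s 1 \<inter> ball t\<^sub>0 d" for t
        using that s by (auto simp: power_domain_def dist_real_def)
      have "has_eigen_parameterization real_analytic_on real_analytic_on
          (power_domain I t\<^sub>0 s 1 \<inter> ball t\<^sub>0 d) (\<lambda>t. A (t\<^sub>0 + s * (t - t\<^sub>0)))"
      proof (rule has_eigen_parameterization_affine[where B = A and h = "\<lambda>t. t\<^sub>0 + s * (t - t\<^sub>0)"])
        show "real_analytic_on (power_domain I t\<^sub>0 s 1 \<inter> ball t\<^sub>0 d) (\<lambda>t. f (t\<^sub>0 + s * (t - t\<^sub>0)))"
          if "real_analytic_on (I \<inter> ball t\<^sub>0 d) f" for f :: "real \<Rightarrow> complex"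
          using that mem by (rule real_analytic_on_affine) (use s in auto)
        show "real_analytic_on (power_domain I t\<^sub>0 s 1 \<inter> ball t\<^sub>0 d) (\<lambda>t. f (t\<^sub>0 + s * (t - t\<^sub>0)))"
          if "real_analytic_on (I \<inter> ball t\<^sub>0 d) f" for f :: "real \<Rightarrow> complex^'n"
          using that mem by (rule real_analytic_on_affine) (use s in auto)
      qed (fact reg eig mem)+
      then show ?thesis
        using d by auto
    qed
    moreover have "has_eigen_parameterization locally_absolutely_continuous_on locally_absolutely_continuous_on I A"
    proof -
      obtain f where f: "local_frame A I f"
        using global_frame[OF smooth_has_frame_charts[OF interval limpt smooth normal generic] interval] by blast
      show ?thesis
      proof (rule has_eigen_parameterizationI)
        show "locally_absolutely_continuous_on I (\<lambda>t. fst (f j t))" "locally_absolutely_continuous_on I (\<lambda>t. snd (f j t))" for j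
          using f unfolding local_frame_def
          by (auto intro!: locally_lipschitz_imp_locally_absolutely_continuous
              locally_lipschitz_curve_bounded_linear[OF bounded_linear_fst]
              locally_lipschitz_curve_bounded_linear[OF bounded_linear_snd])
        show "eigen_system (A t) (\<lambda>j. fst (f j t)) (\<lambda>j. snd (f j t))" if "t \<in> I" for t
          using f that by (simp add: local_frame_def eigen_curve_def)
      qed
    qed
    ultimately show ?thesis
      by (intro conjI ballI exI[of _ "1 :: nat"] impI) simp_all
  qed
qed

end
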